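(* For any $\epsilon > 0$, the resource-constrained joint replenishment problem can be approximated within factor $1+\epsilon$ of optimal. The running time of the algorithm is $O(n^{\tilde{O}(D^3/\epsilon^4)})$.
   Context: Joint replenishment problem: there are $n$ commodities; commodity $i \in [n]$ has ordering cost $K_i > 0$ and holding-cost parameter $H_i > 0$, and there is a joint ordering cost $K_0 > 0$. A policy is a vector $T = (T_1,\ldots,T_n)$ of positive reals, commodity $i$ being ordered at times $0, T_i, 2T_i,\ldots$. Its cost is $F(T) = J(T) + \sum_{i} \left(\frac{K_i}{T_i} + H_i T_i\right)$, where $J(T) = K_0 \lim_{\Delta\to\infty} N(T,\Delta)/\Delta$ and $N(T,\Delta)$ is the number of distinct points of $\bigcup_{i} \{0, T_i, 2T_i, \ldots\}$ lying in $[0,\Delta]$. In the resource-constrained version there are $D$ resources with nonnegative coefficients $\alpha_{id}$ and capacities $\beta_d > 0$, and a policy is feasible only if $\sum_{i\in[n]} \frac{\alpha_{id}}{T_i} \leq \beta_d$ for every $d \in [D]$; the goal is to minimize $F$ over feasible policies. Approximation within factor $1+\epsilon$ means computing a feasible policy whose cost is at most $1+\epsilon$ times the optimal cost. $\tilde{O}(\cdot)$ hides polylogarithmic factors.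
   Formalization: The time bound reads O(max(2,n)^{Õ(D³/min(1,ε)⁴)}): for n = 1 base 2 is used, and for ε > 1 the exponent for ε = 1, since the literal bound would be less than the time to read the input; time is counted on an exact real RAM with square roots. *)

theory Defs
  imports Complex_Main
begin

section \<open>Resource-constrained joint replenishment\<close>

text \<open>Commodities are numbered \<open>0, \<dots>, n - 1\<close> and resources \<open>0, \<dots>, D - 1\<close>; values of the
  functions outside these ranges play no role.\<close>

record rc_instance =
  ncom :: nat
  nres :: nat
  joint_cost :: real
  order_cost :: "nat \<Rightarrow> real"
  hold_cost :: "nat \<Rightarrow> real"
  alpha :: "nat \<Rightarrow> nat \<Rightarrow> real"
  beta :: "nat \<Rightarrow> real"

definition valid_instance :: "rc_instance \<Rightarrow> bool" where
  "valid_instance I \<longleftrightarrow>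
     ncom I \<ge> 1 \<and> nres I \<ge> 1 \<and> joint_cost I > 0 \<and>
     (\<forall>i<ncom I. order_cost I i > 0 \<and> hold_cost I i > 0) \<and>
     (\<forall>i<ncom I. \<forall>d<nres I. alpha I i d \<ge> 0) \<and>
     (\<forall>d<nres I. beta I d > 0)"

definition order_count :: "nat \<Rightarrow> (nat \<Rightarrow> real) \<Rightarrow> real \<Rightarrow> nat" where
  "order_count n T \<Delta> = card ((\<Union>i<n. range (\<lambda>k::nat. real k * T i)) \<inter> {0..\<Delta>})"

text \<open>For a policy (all \<open>T i > 0\<close>) the limit exists: by inclusion-exclusion over the
  intersections of the arithmetic progressions.\<close>

definition joint_ordering_cost :: "rc_instance \<Rightarrow> (nat \<Rightarrow> real) \<Rightarrow> real" where
  "joint_ordering_cost I T =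
     joint_cost I * Lim at_top (\<lambda>\<Delta>. real (order_count (ncom I) T \<Delta>) / \<Delta>)"

definition cost :: "rc_instance \<Rightarrow> (nat \<Rightarrow> real) \<Rightarrow> real" where
  "cost I T = joint_ordering_cost I T
     + (\<Sum>i<ncom I. order_cost I i / T i + hold_cost I i * T i)"

definition feasible :: "rc_instance \<Rightarrow> (nat \<Rightarrow> real) \<Rightarrow> bool" where
  "feasible I T \<longleftrightarrow>
     (\<forall>i<ncom I. T i > 0) \<and>
     (\<forall>d<nres I. (\<Sum>i<ncom I. alpha I i d / T i) \<le> beta I d)"

definition opt :: "rc_instance \<Rightarrow> real" where
  "opt I = Inf (cost I ` {T. feasible I T})"

section \<open>A real RAM\<close>

text \<open>
  Programs are while programs over two memories, one of natural numbers and one of (exact) real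
  numbers, each organised as a collection of unbounded arrays. Array names are literals of the
  program; indices are computed. Natural numbers admit addition and truncated subtraction only;
  real numbers admit the four arithmetic operations, square roots and comparisons. There is no
  rounding operation from reals to naturals and there are no real literals. Square roots are
  indispensable for a running time that depends only on \<open>n\<close>, \<open>D\<close> and \<open>\<epsilon>\<close>: already for \<open>n = 1\<close>
  the unconstrained optimum is \<open>sqrt ((K\<^sub>0 + K\<^sub>1) / H\<^sub>1)\<close>.
\<close>

datatype nexp =
    NLit nat
  | NArr nat nexp
  | NAdd nexp nexp
  | NSub nexp nexp

datatype rexp =
    RArr nat nexp
  | ROfNat nexp
  | RAdd rexp rexp
  | RSub rexp rexp
  | RMul rexp rexp
  | RDiv rexp rexp
  | RSqrt rexp

datatype bexp =
    NLess nexp nexp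
  | RLess rexp rexp
  | BNot bexp
  | BAnd bexp bexp

datatype com =
    Skip
  | NStore nat nexp nexp \<comment> \<open>array, index, value\<close>
  | RStore nat nexp rexp \<comment> \<open>array, index, value\<close>
  | Seq com com
  | Cond bexp com com
  | Loop bexp com

record state =
  nmem :: "nat \<Rightarrow> nat \<Rightarrow> nat"
  rmem :: "nat \<Rightarrow> nat \<Rightarrow> real"

primrec nval :: "nexp \<Rightarrow> state \<Rightarrow> nat" where
  "nval (NLit m) s = m"
| "nval (NArr a e) s = nmem s a (nval e s)"
| "nval (NAdd e f) s = nval e s + nval f s"
| "nval (NSub e f) s = nval e s - nval f s"

primrec rval :: "rexp \<Rightarrow> state \<Rightarrow> real" where
  "rval (RArr a e) s = rmem s a (nval e s)"
| "rval (ROfNat e) s = real (nval e s)"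
| "rval (RAdd e f) s = rval e s + rval f s"
| "rval (RSub e f) s = rval e s - rval f s"
| "rval (RMul e f) s = rval e s * rval f s"
| "rval (RDiv e f) s = rval e s / rval f s"
| "rval (RSqrt e) s = sqrt (rval e s)"

primrec bval :: "bexp \<Rightarrow> state \<Rightarrow> bool" where
  "bval (NLess e f) s = (nval e s < nval f s)"
| "bval (RLess e f) s = (rval e s < rval f s)"
| "bval (BNot b) s = (\<not> bval b s)"
| "bval (BAnd b c) s = (bval b s \<and> bval c s)"

definition nstore :: "state \<Rightarrow> nat \<Rightarrow> nat \<Rightarrow> nat \<Rightarrow> state" where
  "nstore s a j v = s\<lparr>nmem := (nmem s)(a := (nmem s a)(j := v))\<rparr>"

definition rstore :: "state \<Rightarrow> nat \<Rightarrow> nat \<Rightarrow> real \<Rightarrow> state" where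
  "rstore s a j v = s\<lparr>rmem := (rmem s)(a := (rmem s a)(j := v))\<rparr>"

text \<open>
  \<open>exec c s t s'\<close>: started in \<open>s\<close>, program \<open>c\<close> halts in \<open>s'\<close> after \<open>t\<close> steps. Every executed
  assignment and every evaluated test is one step. Counting the individual operations instead
  changes \<open>t\<close> by at most a constant factor, since the expressions are part of the program text.
\<close>

inductive exec :: "com \<Rightarrow> state \<Rightarrow> nat \<Rightarrow> state \<Rightarrow> bool" where
  Skip: "exec Skip s 1 s"
| NStore: "exec (NStore a i e) s 1 (nstore s a (nval i s) (nval e s))"
| RStore: "exec (RStore a i e) s 1 (rstore s a (nval i s) (rval e s))"
| Seq: "exec c s t s' \<Longrightarrow> exec d s' u s'' \<Longrightarrow> exec (Seq c d) s (t + u) s''"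
| CondTrue: "bval b s \<Longrightarrow> exec c s t s' \<Longrightarrow> exec (Cond b c d) s (t + 1) s'"
| CondFalse: "\<not> bval b s \<Longrightarrow> exec d s t s' \<Longrightarrow> exec (Cond b c d) s (t + 1) s'"
| LoopFalse: "\<not> bval b s \<Longrightarrow> exec (Loop b c) s 1 s"
| LoopTrue: "bval b s \<Longrightarrow> exec c s t s' \<Longrightarrow> exec (Loop b c) s' u s'' \<Longrightarrow>
    exec (Loop b c) s (t + u + 1) s''"

inductive_cases SkipE: "exec Skip s t s'"
inductive_cases NStoreE: "exec (NStore a i e) s t s'"
inductive_cases RStoreE: "exec (RStore a i e) s t s'"
inductive_cases SeqE: "exec (Seq c d) s t s'"
inductive_cases CondE: "exec (Cond b c d) s t s'"
inductive_cases LoopE: "exec (Loop b c) s t s'"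

lemma exec_deterministic:
  "exec c s t s' \<Longrightarrow> exec c s u s'' \<Longrightarrow> u = t \<and> s'' = s'"
proof (induction arbitrary: u s'' rule: exec.induct)
  case (Seq c s t s' d t' s2)
  from Seq.prems show ?case by (rule SeqE) (auto dest!: Seq.IH)
next
  case (CondTrue b s c t s' d)
  from CondTrue.prems show ?case by (rule CondE) (auto dest: CondTrue.IH simp: CondTrue.hyps(1))
next
  case (CondFalse b s d t s' c)
  from CondFalse.prems show ?case by (rule CondE) (auto dest: CondFalse.IH simp: CondFalse.hyps(1))
next
  case (LoopFalse b s c)
  from LoopFalse.prems show ?case by (rule LoopE) (use LoopFalse.hyps in simp_all)
next
  case (LoopTrue b s c t s' t' s2)
  from LoopTrue.prems show ?case by (rule LoopE) (auto dest: LoopTrue.IH simp: LoopTrue.hyps(1))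
qed (auto elim: SkipE NStoreE RStoreE)

section \<open>Input, output and running time\<close>

text \<open>
  Input: \<open>n\<close> and \<open>D\<close> in array 0 of the natural memory; in the real memory, \<open>K\<^sub>0\<close> and \<open>\<epsilon>\<close> in
  array 0, the \<open>K\<^sub>i\<close> in array 1, the \<open>H\<^sub>i\<close> in array 2, the matrix of the resource coefficients row
  by row in array 3, the capacities in array 4. All other cells are 0.
  Output: array 5 of the real memory.
\<close>

definition input_state :: "rc_instance \<Rightarrow> real \<Rightarrow> state" where
  "input_state I \<epsilon> = (let n = ncom I; D = nres I in
     \<lparr>nmem = (\<lambda>_ _. 0)(0 := (\<lambda>_. 0)(0 := n, 1 := D)),
      rmem = (\<lambda>_ _. 0)
        (0 := (\<lambda>_. 0)(0 := joint_cost I, 1 := \<epsilon>),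
         1 := (\<lambda>i. if i < n then order_cost I i else 0),
         2 := (\<lambda>i. if i < n then hold_cost I i else 0),
         3 := (\<lambda>j. if j < n * D then alpha I (j div D) (j mod D) else 0),
         4 := (\<lambda>d. if d < D then beta I d else 0))\<rparr>)"

definition output_policy :: "state \<Rightarrow> nat \<Rightarrow> real" where
  "output_policy s = rmem s 5"

definition approximates :: "com \<Rightarrow> rc_instance \<Rightarrow> real \<Rightarrow> nat \<Rightarrow> bool" where
  \<comment> \<open>on input \<open>I\<close> and \<open>\<epsilon>\<close>, the program halts after \<open>t\<close> steps with a
      \<open>(1 + \<epsilon>)\<close>-approximate policy\<close>
  "approximates prog I \<epsilon> t \<longleftrightarrow>
     (\<exists>s. exec prog (input_state I \<epsilon>) t s \<and> feasible I (output_policy s) \<and>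
          cost I (output_policy s) \<le> (1 + \<epsilon>) * opt I)"

text \<open>Big-O up to factors polylogarithmic in \<open>g\<close>, uniformly on \<open>A\<close>; meant for \<open>g \<ge> 1\<close> on \<open>A\<close>.\<close>

definition soft_O_on :: "'a set \<Rightarrow> ('a \<Rightarrow> real) \<Rightarrow> ('a \<Rightarrow> real) set" where
  "soft_O_on A g = {f. \<exists>c k. \<forall>x\<in>A. \<bar>f x\<bar> \<le> c * g x * log 2 (1 + g x) ^ k}"

text \<open>
  The exponent functions hidden in the soft-O of \<open>D\<^sup>3 / \<epsilon>\<^sup>4\<close>. The asymptotics concern small \<open>\<epsilon>\<close>;
  for \<open>\<epsilon> > 1\<close> the bound for \<open>\<epsilon> = 1\<close> is meant, as \<open>D\<^sup>3 / \<epsilon>\<^sup>4\<close> itself tends to 0 when \<open>\<epsilon>\<close> grows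
  and no algorithm can then even read its input in time \<open>n\<close> to that power. For the same reason
  the base of the running time bound is \<open>max 2 n\<close>: powers of \<open>n = 1\<close> are constant, while the
  input has \<open>n * D\<close> coefficients.
\<close>

definition exponents :: "(nat \<times> real \<Rightarrow> real) set" where
  "exponents = soft_O_on {(D, \<epsilon>). D \<ge> 1 \<and> \<epsilon> > 0} (\<lambda>(D, \<epsilon>). real D ^ 3 / (min 1 \<epsilon>) ^ 4)"

end

theory Submission
  imports Defs "HOL-Analysis.Kronecker_Approximation_Theorem"
begin

text \<open>
  Let \<open>e = 1 / E\<close> be the accuracy. Up to a factor \<open>1 + O(e)\<close> in cost and in resource usage (the latter
  is repaired by stretching the final policy) a policy with shortest period \<open>t\<close> can be brought into a
  form described by few integers.

  \<^item> \<open>t\<close> lies within a polynomial factor of a number \<open>w\<close> that is computable from the instance, so a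
    polynomial grid contains some \<open>B\<close> slightly above \<open>t\<close>.
  \<^item> Periods up to \<open>E t\<close> fall into \<open>E\<^sup>2\<close> buckets. Within a bucket, raising all periods to the largest
    keeps the policy feasible and only removes orders.
  \<^item> By Dirichlet's theorem the \<open>E\<^sup>2\<close> remaining periods are close to multiples \<open>A\<^sub>l B / q\<close> with integers of
    size exponential in \<open>E\<^sup>2\<close>. The rounding preserves every relation between two periods that has small
    coefficients, hence all coincidences of orders that matter for the joint cost.
  \<^item> Periods up to \<open>n E t\<close> are rounded up to multiples of \<open>B\<close>, at no joint cost. Longer ones contribute
    at most \<open>e K\<^sub>0 / B\<close> to the joint cost altogether and are taken from a grid of polynomial size.

  The algorithm enumerates \<open>B\<close>, \<open>q\<close> and the \<open>A\<^sub>l\<close>, computes the joint cost by counting over one period,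
  and assigns periods to commodities by dynamic programming over rounded resource consumptions.
\<close>

section \<open>Densities of unions of arithmetic progressions\<close>

text \<open>The joint cost is discontinuous in the periods: an arbitrarily small change of two of
  them can destroy all their common orders after time 0. Rounding every short period separately
  would lose these savings, so the rounding has to respect exact rational relations. Losing
  relations with large coefficients is affordable: if two progressions with periods at least
  \<open>r\<close> meet only beyond coefficient \<open>\<Psi>\<close>, their common points have
  density at most \<open>1 / (\<Psi> r)\<close>. Relations between pairs suffice because orders are
  compared by a map that fails to be injective only where two progressions collide.

  Periods are mostly rounded upwards, which keeps the capacities intact. A period is shortened only
  if it is so long that even afterwards it uses a negligible share of each capacity. Additive losses
  of density are charged to the density \<open>1 / t\<close> that a single short period
  \<open>t\<close> already forces.

  The exponent \<open>E ^ 4\<close> arises because about \<open>E ^ 2\<close> integers are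
  enumerated, each exponential in \<open>E ^ 2\<close> up to a logarithm.\<close>

definition progression :: "real \<Rightarrow> real set" where
  "progression t = range (\<lambda>k::nat. real k * t)"

definition has_density :: "real set \<Rightarrow> real \<Rightarrow> bool" where
  "has_density X d \<longleftrightarrow> ((\<lambda>\<Delta>. real (card (X \<inter> {0..\<Delta>})) / \<Delta>) \<longlongrightarrow> d) at_top"

definition locally_finite :: "real set \<Rightarrow> bool" where
  "locally_finite X \<longleftrightarrow> (\<forall>\<Delta>. finite (X \<inter> {0..\<Delta>}))"

lemma multiple_in_progression: "real k * t \<in> progression t"
  by (auto simp: progression_def)

lemma progression_Int_Icc:
  assumes "t > 0"
  shows "progression t \<inter> {0..\<Delta>} = (\<lambda>k. real k * t) ` {k. real k \<le> \<Delta> / t}"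
  using assms by (auto simp: progression_def field_simps)

lemma real_le_set_eq: "x \<ge> 0 \<Longrightarrow> {k. real k \<le> x} = {..nat \<lfloor>x\<rfloor>}"
  by (auto simp: le_nat_iff le_floor_iff)

lemma finite_real_le_set: "finite {k. real k \<le> x}"
proof (cases "x \<ge> 0")
  case False
  then have "{k. real k \<le> x} = {}" using of_nat_0_le_iff order_trans by blast
  then show ?thesis by simp
qed (simp add: real_le_set_eq)

lemma card_progression_Int_Icc:
  assumes "t > 0" "\<Delta> \<ge> 0"
  shows "card (progression t \<inter> {0..\<Delta>}) = Suc (nat \<lfloor>\<Delta> / t\<rfloor>)"
proof -
  have "inj_on (\<lambda>k. real k * t) {..nat \<lfloor>\<Delta> / t\<rfloor>}"
    using assms by (auto simp: inj_on_def)
  then show ?thesis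
    unfolding progression_Int_Icc[OF assms(1)] using assms
    by (simp add: real_le_set_eq card_image)
qed

lemma card_progression_le:
  assumes "t > 0" "\<Delta> \<ge> 0"
  shows "real (card (progression t \<inter> {0..\<Delta>})) \<le> \<Delta> / t + 1"
  using assms unfolding card_progression_Int_Icc[OF assms] by simp

lemma locally_finite_progression:
  assumes "t \<ge> 0"
  shows "locally_finite (progression t)"
proof (cases "t = 0")
  case True
  then show ?thesis by (auto simp: locally_finite_def progression_def)
next
  case False
  then show ?thesis
    using assms by (simp add: locally_finite_def progression_Int_Icc finite_real_le_set)
qed

lemma locally_finite_UN:
  "finite I \<Longrightarrow> (\<And>i. i \<in> I \<Longrightarrow> locally_finite (X i)) \<Longrightarrow> locally_finite (\<Union>i\<in>I. X i)"
  by (simp add: locally_finite_def Int_UN_distrib2 [symmetric] UN_extend_simps(4) del: UN_simps)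

lemma locally_finite_progressions:
  fixes T :: "nat \<Rightarrow> real"
  assumes "\<And>i. i < n \<Longrightarrow> T i \<ge> 0"
  shows "locally_finite (\<Union>i<n. progression (T i))"
  using assms by (intro locally_finite_UN) (auto intro: locally_finite_progression)

lemma has_density_progression:
  assumes "t > 0"
  shows "has_density (progression t) (1 / t)"
  unfolding has_density_def
proof (rule tendsto_sandwich)
  show "\<forall>\<^sub>F \<Delta> in at_top. 1 / t \<le> real (card (progression t \<inter> {0..\<Delta>})) / \<Delta>"
    using eventually_gt_at_top[of 0]
  proof eventually_elim
    case (elim \<Delta>)
    have "\<Delta> / t \<le> real (Suc (nat \<lfloor>\<Delta> / t\<rfloor>))" by linarith
    then show ?case
      using elim assms by (simp add: card_progression_Int_Icc field_simps)
  qed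
  show "\<forall>\<^sub>F \<Delta> in at_top. real (card (progression t \<inter> {0..\<Delta>})) / \<Delta> \<le> 1 / t + 1 / \<Delta>"
    using eventually_gt_at_top[of 0]
  proof eventually_elim
    case (elim \<Delta>)
    then show ?case
      using card_progression_le[OF assms, of \<Delta>] by (simp add: field_simps)
  qed
  have "((\<lambda>\<Delta>::real. 1 / \<Delta>) \<longlongrightarrow> 0) at_top"
    using tendsto_inverse_0_at_top[OF filterlim_ident] by (simp add: inverse_eq_divide)
  then show "((\<lambda>\<Delta>. 1 / t + 1 / \<Delta>) \<longlongrightarrow> 1 / t) at_top"
    using tendsto_add[OF tendsto_const] by fastforce
qed simp

section \<open>Intersections of progressions and existence of the density\<close>

lemma diff_in_progression:
  assumes "b \<ge> 0" "x \<in> progression b" "y \<in> progression b" "y \<le> x"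
  shows "x - y \<in> progression b"
proof -
  obtain i j where ij: "x = real i * b" "y = real j * b"
    using assms by (auto simp: progression_def)
  show ?thesis
  proof (cases "b = 0")
    case True
    then show ?thesis using ij multiple_in_progression[of 0 b] by simp
  next
    case False
    then have "j \<le> i" using assms ij by simp
    then have "x - y = real (i - j) * b" using ij by (simp add: of_nat_diff algebra_simps)
    then show ?thesis by (simp only: multiple_in_progression)
  qed
qed

text \<open>Euclid's argument: the least positive common point divides every other common point. If
  there is none, the intersection is \<open>{0}\<close>, that is,
  \<open>progression 0\<close>.\<close>

lemma progression_Int:
  assumes a: "a \<ge> 0" and b: "b \<ge> 0"
  obtains c where "c \<ge> 0" "progression a \<inter> progression b = progression c"
proof (cases "\<exists>k>0. a > 0 \<and> real k * a \<in> progression b")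
  case False
  have "x \<in> {0}" if x: "x \<in> progression a \<inter> progression b" for x
  proof -
    obtain k where k: "x = real k * a" using x by (auto simp: progression_def)
    have "\<not> (k > 0 \<and> a > 0)" using False x k by blast
    then have "k = 0 \<or> a = 0" using a by linarith
    then show ?thesis using k by auto
  qed
  then have "progression a \<inter> progression b \<subseteq> {0}" by (rule subsetI)
  moreover have "real 0 * a \<in> progression a" "real 0 * b \<in> progression b"
    by (rule multiple_in_progression)+
  ultimately have "progression a \<inter> progression b = {0}" by auto
  moreover have "progression 0 = {0}" by (auto simp: progression_def)
  ultimately have "progression a \<inter> progression b = progression 0" by simp
  then show ?thesis by (intro that[of 0]) auto
next
  case True
  then have apos: "a > 0" by blast
  define k where "k = (LEAST k. k > 0 \<and> real k * a \<in> progression b)"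
  have k: "k > 0 \<and> real k * a \<in> progression b"
  proof -
    have "\<exists>k. k > 0 \<and> real k * a \<in> progression b" using True by blast
    then show ?thesis unfolding k_def by (rule LeastI_ex)
  qed
  have least: "\<not> (0 < r \<and> real r * a \<in> progression b)" if "r < k" for r
    using not_less_Least[OF that[unfolded k_def]] .
  obtain m where m: "real k * a = real m * b" using k by (auto simp: progression_def)
  have "progression a \<inter> progression b = progression (real k * a)"
  proof (intro equalityI subsetI)
    fix x assume x: "x \<in> progression a \<inter> progression b"
    then obtain j where j: "x = real j * a" by (auto simp: progression_def)
    define q where "q = j div k"
    have q: "j = q * k + j mod k" by (simp add: q_def)
    have qm: "real (q * m) * b = real (q * k) * a"
      using arg_cong[OF m, of "\<lambda>x. real q * x"] by (simp only: of_nat_mult mult.assoc)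
    \<comment> \<open>Subtracting \<open>q\<close> times the least common point leaves the common
      point \<open>(j mod k) * a\<close>, which is smaller and therefore 0.\<close>
    have "x - real (q * m) * b \<in> progression b"
    proof (rule diff_in_progression[OF b])
      have "real (q * m) * b = real (q * k) * a" by (rule qm)
      also have "\<dots> \<le> x" unfolding j using apos
        by (intro mult_right_mono) (simp_all add: q_def del: of_nat_mult)
      finally show "real (q * m) * b \<le> x" .
        next
      show "real (q * m) * b \<in> progression b" by (rule multiple_in_progression)
    qed (use x in blast)
    moreover have "x - real (q * m) * b = real (j mod k) * a"
    proof -
      have "real j = real (q * k) + real (j mod k)" using q by (simp only: of_nat_add[symmetric])
      then have "real j * a = real (q * k) * a + real (j mod k) * a" by (simp only: distrib_right)
      then show ?thesis unfolding j qm by linarith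
    qed
    ultimately have "\<not> 0 < j mod k" using least[of "j mod k"] k by simp
    then have "j mod k = 0" by simp
    then have "j = q * k" using q by simp
    then have "x = real q * (real k * a)" unfolding j by (simp only: of_nat_mult mult.assoc)
    then show "x \<in> progression (real k * a)" by (simp only: multiple_in_progression)
  next
    fix x assume "x \<in> progression (real k * a)"
    then obtain j where "x = real j * (real k * a)" by (auto simp: progression_def)
    then have "x = real (j * k) * a" "x = real (j * m) * b"
      using m by (simp_all only: of_nat_mult mult.assoc)
    moreover have "real (j * k) * a \<in> progression a" "real (j * m) * b \<in> progression b"
      by (rule multiple_in_progression)+
    ultimately show "x \<in> progression a \<inter> progression b" by (simp only: IntI)
  qed
  then show ?thesis using that[of "real k * a"] apos by simp
qed

text \<open>Degenerate periods \<open>0\<close> are admitted because two incommensurable progressions meet in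
  \<open>progression 0\<close> only.\<close>

lemma has_density_progressions_ex:
  fixes T :: "nat \<Rightarrow> real"
  shows "(\<And>i. i < n \<Longrightarrow> T i \<ge> 0) \<Longrightarrow> \<exists>d. has_density (\<Union>i<n. progression (T i)) d"
proof (induction n arbitrary: T)
  case 0
  then show ?case by (auto simp: has_density_def intro!: exI[of _ 0])
next
  case (Suc n)
  let ?X = "\<Union>i<n. progression (T i)" and ?Y = "progression (T n)"
  obtain d1 where d1: "has_density ?X d1" using Suc.IH[of T] Suc.prems by auto
  obtain d2 where d2: "has_density ?Y d2"
  proof (cases "T n = 0")
    case True
    have "((\<lambda>\<Delta>::real. 1 / \<Delta>) \<longlongrightarrow> 0) at_top"
      using tendsto_inverse_0_at_top[OF filterlim_ident] by (simp add: inverse_eq_divide)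
    moreover have "eventually (\<lambda>\<Delta>. 1 / \<Delta> = real (card (?Y \<inter> {0..\<Delta>})) / \<Delta>) at_top"
      using eventually_ge_at_top[of 0]
    proof eventually_elim
      case (elim \<Delta>)
      then have "?Y \<inter> {0..\<Delta>} = {0}" using True by (auto simp: progression_def)
      then show ?case by simp
    qed
    ultimately have "has_density ?Y 0"
      unfolding has_density_def by (rule Lim_transform_eventually)
    then show ?thesis using that by blast
  next
    case False
    then show ?thesis using that has_density_progression[of "T n"] Suc.prems[of n] by auto
  qed
  \<comment> \<open>Inclusion-exclusion for the last progression: \<open>?X \<inter> ?Y\<close> is
    again a union of \<open>n\<close> progressions, so the induction hypothesis applies to it with
    other periods, some of them possibly 0.\<close>
  have "\<forall>i. \<exists>c. i < n \<longrightarrow> c \<ge> 0 \<and> progression (T i) \<inter> ?Y = progression c"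
  proof
    fix i
    show "\<exists>c. i < n \<longrightarrow> c \<ge> 0 \<and> progression (T i) \<inter> ?Y = progression c"
    proof (cases "i < n")
      case True
      then have "T i \<ge> 0" "T n \<ge> 0" using Suc.prems by auto
      then obtain c where "c \<ge> 0" "progression (T i) \<inter> ?Y = progression c"
        by (rule progression_Int)
      then show ?thesis by auto
    qed simp
  qed
  from choice[OF this] obtain c where "\<forall>i. i < n \<longrightarrow> c i \<ge> 0 \<and> progression (T i) \<inter> ?Y = progression (c i)"
    by (rule exE)
  then have c: "c i \<ge> 0" "progression (T i) \<inter> ?Y = progression (c i)" if "i < n" for i
    using that by auto
  obtain d3 where "has_density (\<Union>i<n. progression (c i)) d3" using Suc.IH[of c] c by auto
  moreover have "(\<Union>i<n. progression (c i)) = (\<Union>i<n. progression (T i) \<inter> ?Y)"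
    by (rule SUP_cong) (simp_all add: c)
  then have "(\<Union>i<n. progression (c i)) = ?X \<inter> ?Y" by blast
  ultimately have d3: "has_density (?X \<inter> ?Y) d3" by simp
  have fin: "finite (?X \<inter> {0..\<Delta>})" "finite (?Y \<inter> {0..\<Delta>})" for \<Delta>
    using locally_finite_progressions[of n T] locally_finite_progression[of "T n"] Suc.prems
    by (auto simp: locally_finite_def)
  have "real (card ((\<Union>i<Suc n. progression (T i)) \<inter> {0..\<Delta>})) / \<Delta> =
      real (card (?X \<inter> {0..\<Delta>})) / \<Delta> + real (card (?Y \<inter> {0..\<Delta>})) / \<Delta>
      - real (card (?X \<inter> ?Y \<inter> {0..\<Delta>})) / \<Delta>" for \<Delta>
  proof -
    have "(\<Union>i<Suc n. progression (T i)) \<inter> {0..\<Delta>} = (?X \<inter> {0..\<Delta>}) \<union> (?Y \<inter> {0..\<Delta>})"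
      by (auto simp: less_Suc_eq)
    moreover have "?X \<inter> ?Y \<inter> {0..\<Delta>} = (?X \<inter> {0..\<Delta>}) \<inter> (?Y \<inter> {0..\<Delta>})" by auto
    ultimately have "card ((\<Union>i<Suc n. progression (T i)) \<inter> {0..\<Delta>}) + card (?X \<inter> ?Y \<inter> {0..\<Delta>})
      = card (?X \<inter> {0..\<Delta>}) + card (?Y \<inter> {0..\<Delta>})"
      using card_Un_Int[OF fin] by simp
    then have "real (card ((\<Union>i<Suc n. progression (T i)) \<inter> {0..\<Delta>})) + real (card (?X \<inter> ?Y \<inter> {0..\<Delta>}))
      = real (card (?X \<inter> {0..\<Delta>})) + real (card (?Y \<inter> {0..\<Delta>}))"
      by (metis of_nat_add)
    then show ?thesis by (simp add: add_divide_distrib[symmetric] diff_divide_distrib[symmetric])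
  qed
  then have "has_density (\<Union>i<Suc n. progression (T i)) (d1 + d2 - d3)"
    using d1 d2 d3 unfolding has_density_def by (simp only: tendsto_diff tendsto_add)
  then show ?case by blast
qed

section \<open>Comparison of densities\<close>

lemma has_density_le:
  assumes X: "has_density X a" and Y: "has_density Y b"
    and le: "\<And>\<Delta>. \<Delta> > 0 \<Longrightarrow>
      real (card (X \<inter> {0..\<Delta>})) \<le> real (card (Y \<inter> {0..\<Delta>})) + \<Delta> * r + C"
  shows "a \<le> b + r"
proof (rule tendsto_le)
  show "((\<lambda>\<Delta>. real (card (X \<inter> {0..\<Delta>})) / \<Delta>) \<longlongrightarrow> a) at_top"
    using X by (simp add: has_density_def)
  \<comment> \<open>An error linear in \<open>\<Delta>\<close> survives as \<open>r\<close>, a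
    bounded one vanishes after division by \<open>\<Delta>\<close>.\<close>
  have "((\<lambda>\<Delta>::real. C * inverse \<Delta>) \<longlongrightarrow> C * 0) at_top"
    by (intro tendsto_mult tendsto_const tendsto_inverse_0_at_top filterlim_ident)
  then have "((\<lambda>\<Delta>. real (card (Y \<inter> {0..\<Delta>})) / \<Delta> + r + C * inverse \<Delta>) \<longlongrightarrow> b + r + C * 0) at_top"
    using Y unfolding has_density_def by (intro tendsto_add tendsto_const)
  then show "((\<lambda>\<Delta>. real (card (Y \<inter> {0..\<Delta>})) / \<Delta> + r + C * inverse \<Delta>) \<longlongrightarrow> b + r) at_top"
    by simp
  show "\<forall>\<^sub>F \<Delta> in at_top. real (card (X \<inter> {0..\<Delta>})) / \<Delta>
      \<le> real (card (Y \<inter> {0..\<Delta>})) / \<Delta> + r + C * inverse \<Delta>"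
    using eventually_gt_at_top[of 0]
  proof eventually_elim
    case (elim \<Delta>)
    then show ?case using le[OF elim] by (simp add: field_simps)
  qed
qed simp

lemma has_density_unique: "has_density X a \<Longrightarrow> has_density X b \<Longrightarrow> a = b"
  unfolding has_density_def by (rule tendsto_unique[OF trivial_limit_at_top_linorder]) 

lemma has_density_mono:
  assumes "has_density X a" "has_density Y b" "X \<subseteq> Y" "locally_finite Y"
  shows "a \<le> b"
proof -
  have "a \<le> b + 0"
  proof (rule has_density_le[OF assms(1,2), of _ 0])
    fix \<Delta> :: real
    have "card (X \<inter> {0..\<Delta>}) \<le> card (Y \<inter> {0..\<Delta>})"
      using assms(3,4) by (intro card_mono) (auto simp: locally_finite_def)
    then show "real (card (X \<inter> {0..\<Delta>})) \<le> real (card (Y \<inter> {0..\<Delta>})) + \<Delta> * 0 + 0" by simp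
  qed
  then show ?thesis by simp
qed

text \<open>Each added progression costs at most its own density. The additional \<open>+ 1\<close>
  in every count sums up to the constant \<open>card S\<close>, which disappears in the
  limit.\<close>

lemma has_density_Un_progressions_le:
  assumes "has_density X a" "has_density Y b" "locally_finite Y" "finite S"
    and sub: "X \<subseteq> Y \<union> (\<Union>i\<in>S. progression (T i))" and pos: "\<And>i. i \<in> S \<Longrightarrow> T i > 0"
  shows "a \<le> b + (\<Sum>i\<in>S. 1 / T i)"
proof (rule has_density_le[OF assms(1,2), of _ "real (card S)"])
  fix \<Delta> :: real assume D: "\<Delta> > 0"
  have fin: "finite (Y \<inter> {0..\<Delta>})" "\<And>i. i \<in> S \<Longrightarrow> finite (progression (T i) \<inter> {0..\<Delta>})"
    using assms(3) locally_finite_progression pos by (auto simp: locally_finite_def less_imp_le)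
  have "X \<inter> {0..\<Delta>} \<subseteq> (Y \<inter> {0..\<Delta>}) \<union> (\<Union>i\<in>S. progression (T i) \<inter> {0..\<Delta>})"
    using sub by auto
  then have "card (X \<inter> {0..\<Delta>}) \<le> card ((Y \<inter> {0..\<Delta>}) \<union> (\<Union>i\<in>S. progression (T i) \<inter> {0..\<Delta>}))"
  proof (rule card_mono[rotated])
    show "finite ((Y \<inter> {0..\<Delta>}) \<union> (\<Union>i\<in>S. progression (T i) \<inter> {0..\<Delta>}))"
      using fin assms(4) by (intro finite_UnI finite_UN_I)
  qed
  also have "\<dots> \<le> card (Y \<inter> {0..\<Delta>}) + card (\<Union>i\<in>S. progression (T i) \<inter> {0..\<Delta>})"
    by (rule card_Un_le)
  also have "card (\<Union>i\<in>S. progression (T i) \<inter> {0..\<Delta>}) \<le> (\<Sum>i\<in>S. card (progression (T i) \<inter> {0..\<Delta>}))"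
    by (rule card_UN_le[OF assms(4)])
  finally have "card (X \<inter> {0..\<Delta>}) \<le> card (Y \<inter> {0..\<Delta>})
      + (\<Sum>i\<in>S. card (progression (T i) \<inter> {0..\<Delta>}))"
    by simp
  then have "real (card (X \<inter> {0..\<Delta>})) \<le> real (card (Y \<inter> {0..\<Delta>})
      + (\<Sum>i\<in>S. card (progression (T i) \<inter> {0..\<Delta>})))"
    by (rule of_nat_mono)
  also have "\<dots> = real (card (Y \<inter> {0..\<Delta>}))
      + (\<Sum>i\<in>S. real (card (progression (T i) \<inter> {0..\<Delta>})))"
    by simp
  also have "(\<Sum>i\<in>S. real (card (progression (T i) \<inter> {0..\<Delta>}))) \<le> (\<Sum>i\<in>S. \<Delta> / T i + 1)"
    using pos D by (intro sum_mono card_progression_le) auto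
  also have "\<dots> = \<Delta> * (\<Sum>i\<in>S. 1 / T i) + real (card S)"
    by (simp add: sum.distrib sum_distrib_left)
  finally show "real (card (X \<inter> {0..\<Delta>}))
      \<le> real (card (Y \<inter> {0..\<Delta>})) + \<Delta> * (\<Sum>i\<in>S. 1 / T i) + real (card S)"
    by simp
qed

lemma has_density_scale:
  assumes "has_density X d" "c > 0"
  shows "has_density ((\<lambda>x. c * x) ` X) (d / c)"
  unfolding has_density_def
proof -
  have eq: "card ((\<lambda>x. c * x) ` X \<inter> {0..\<Delta>}) = card (X \<inter> {0..\<Delta> / c})" for \<Delta>
  proof -
    have "(\<lambda>x. c * x) ` X \<inter> {0..\<Delta>} = (\<lambda>x. c * x) ` (X \<inter> {0..\<Delta> / c})"
      using assms(2) by (auto simp: field_simps zero_le_mult_iff)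
    moreover have "inj_on (\<lambda>x. c * x) (X \<inter> {0..\<Delta> / c})" using assms(2) by (auto simp: inj_on_def)
    ultimately show ?thesis by (simp add: card_image)
  qed
  have "filterlim (\<lambda>\<Delta>. \<Delta> / c) at_top at_top"
    using filterlim_tendsto_pos_mult_at_top[OF tendsto_const[of "1 / c"] _ filterlim_ident] assms(2)
    by simp
  then have "((\<lambda>\<Delta>. real (card (X \<inter> {0..\<Delta> / c})) / (\<Delta> / c)) \<longlongrightarrow> d) at_top"
    using assms(1) unfolding has_density_def by (rule filterlim_compose[rotated])
  then have "((\<lambda>\<Delta>. real (card (X \<inter> {0..\<Delta> / c})) / (\<Delta> / c) / c) \<longlongrightarrow> d / c) at_top"
    using assms(2) by (intro tendsto_divide tendsto_const) auto
  moreover have "(\<lambda>\<Delta>. real (card (X \<inter> {0..\<Delta> / c})) / (\<Delta> / c) / c) =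
      (\<lambda>\<Delta>. real (card ((\<lambda>x. c * x) ` X \<inter> {0..\<Delta>})) / \<Delta>)"
    using assms(2) by (simp add: eq)
  ultimately show "((\<lambda>\<Delta>. real (card ((\<lambda>x. c * x) ` X \<inter> {0..\<Delta>})) / \<Delta>) \<longlongrightarrow> d / c) at_top"
    by simp
qed

lemma scaled_progression: "(\<lambda>x. c * x) ` progression t = progression (c * t)"
  unfolding progression_def image_image by (simp add: mult.left_commute)

text \<open>Defined through \<open>has_density\<close> so that the comparison lemmas apply directly;
  \<open>joint_ordering_cost_eq\<close> links it to the limit in the definition of the cost.\<close>

definition order_density :: "nat \<Rightarrow> (nat \<Rightarrow> real) \<Rightarrow> real" where
  "order_density n T = (THE d. has_density (\<Union>i<n. progression (T i)) d)"

lemma has_density_density: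
  assumes "\<And>i. i < n \<Longrightarrow> T i > 0"
  shows "has_density (\<Union>i<n. progression (T i)) (order_density n T)"
  unfolding order_density_def
proof (rule theI')
  obtain d where "has_density (\<Union>i<n. progression (T i)) d"
    using has_density_progressions_ex[of n T] assms by (auto simp: less_imp_le)
  then show "\<exists>!d. has_density (\<Union>i<n. progression (T i)) d"
    using has_density_unique by blast
qed

lemma joint_ordering_cost_eq:
  assumes "\<And>i. i < ncom I \<Longrightarrow> T i > 0"
  shows "joint_ordering_cost I T = joint_cost I * order_density (ncom I) T"
proof -
  have "Lim at_top (\<lambda>\<Delta>. real (order_count (ncom I) T \<Delta>) / \<Delta>) = order_density (ncom I) T"
    using has_density_density[OF assms]
    by (intro tendsto_Lim) (auto simp: has_density_def order_count_def progression_def)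
  then show ?thesis by (simp add: joint_ordering_cost_def)
qed

lemma density_mono:
  assumes "\<And>i. i < n \<Longrightarrow> T i > 0" "\<And>i. i < m \<Longrightarrow> R i > 0"
    "(\<Union>i<n. progression (T i)) \<subseteq> (\<Union>i<m. progression (R i))"
  shows "order_density n T \<le> order_density m R"
  using has_density_mono[OF has_density_density has_density_density assms(3)]
    locally_finite_progressions[of m R] assms(1,2) by (simp add: less_imp_le)

lemma density_le_add:
  assumes "\<And>i. i < n \<Longrightarrow> T i > 0" "\<And>i. i < m \<Longrightarrow> R i > 0" "\<And>i. i \<in> S \<Longrightarrow> Q i > 0" "finite S"
    "(\<Union>i<n. progression (T i)) \<subseteq> (\<Union>i<m. progression (R i)) \<union> (\<Union>i\<in>S. progression (Q i))"
  shows "order_density n T \<le> order_density m R + (\<Sum>i\<in>S. 1 / Q i)"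
  using has_density_Un_progressions_le[OF has_density_density has_density_density _ assms(4,5)]
    locally_finite_progressions[of m R] assms(1-3) by (simp add: less_imp_le)

text \<open>One point of a progression brings all its multiples along, and these alone have density
  \<open>1 / t\<close>.\<close>

lemma density_ge:
  assumes "\<And>i. i < n \<Longrightarrow> T i > 0" "t > 0" "t \<in> (\<Union>i<n. progression (T i))"
  shows "1 / t \<le> order_density n T"
proof (rule has_density_mono[OF has_density_progression has_density_density])
  obtain i k where ik: "i < n" "t = real k * T i" using assms(3) by (auto simp: progression_def)
  have "progression t \<subseteq> progression (T i)"
  proof
    fix x assume "x \<in> progression t"
    then obtain j where "x = real j * t" by (auto simp: progression_def)
    then have "x = real (j * k) * T i" using ik by simp
    then show "x \<in> progression (T i)" by (simp only: multiple_in_progression)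
  qed
  then show "progression t \<subseteq> (\<Union>i<n. progression (T i))" using ik by auto
  show "locally_finite (\<Union>i<n. progression (T i))"
    using assms(1) by (intro locally_finite_progressions) (simp add: less_imp_le)
qed (use assms in auto)

lemma density_scale:
  assumes "\<And>i. i < n \<Longrightarrow> T i > 0" "c > 0"
  shows "order_density n (\<lambda>i. c * T i) = order_density n T / c"
proof -
  have "has_density ((\<lambda>x. c * x) ` (\<Union>i<n. progression (T i))) (order_density n T / c)"
    using assms by (intro has_density_scale has_density_density)
  then have "has_density (\<Union>i<n. progression (c * T i)) (order_density n T / c)"
    by (simp only: image_UN scaled_progression)
  moreover have "has_density (\<Union>i<n. progression (c * T i)) (order_density n (\<lambda>i. c * T i))"
    using has_density_density[of n "\<lambda>i. c * T i"] assms by simp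
  ultimately show ?thesis using has_density_unique by blast
qed

lemma density_ge_inverse:
  assumes "\<And>i. i < n \<Longrightarrow> T i > 0" "i < n"
  shows "1 / T i \<le> order_density n T"
  using multiple_in_progression[of 1 "T i"] assms by (intro density_ge) auto

section \<open>Rounding periods to integer multiples\<close>

text \<open>Two progressions \<open>a\<close> and \<open>b\<close> meet in the multiples of some
  \<open>c\<close>. When their periods are replaced by \<open>a'\<close> and \<open>b'\<close>,
  coincidences can break only if \<open>c\<close> is a multiple of \<open>a\<close> or of
  \<open>b\<close> by a factor of at least \<open>\<Psi>\<close>. Then
  \<open>c \<ge> \<Psi> r\<close>, and few points are affected. The set \<open>S\<close> collects
  the broken coincidences, seen from the side of \<open>a'\<close>.\<close>

lemma finite_card_collisions:
  fixes a b :: real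
  assumes a: "a > 0" "a' \<ge> a" and b: "b > 0" and r: "r > 0" "r \<le> a" "r \<le> b"
    and Psi: "\<Psi> > 0" and D: "\<Delta> > 0"
    and rel: "\<And>i j. i \<le> \<Psi> \<Longrightarrow> j \<le> \<Psi> \<Longrightarrow> real i * a = real j * b \<Longrightarrow> real i * a' = real j * b'"
  defines "S \<equiv> {x. \<exists>k k'. x = real k * a' \<and> real k * a = real k' * b \<and> real k * a' \<noteq> real k' * b' \<and> x \<le> \<Delta>}"
  shows "finite S \<and> real (card S) \<le> \<Delta> / (real \<Psi> * r) + 1"
proof (cases "S = {}")
  case True
  then show ?thesis using Psi r D by simp
next
  case False
  obtain c where c: "c \<ge> 0" "progression a \<inter> progression b = progression c"
    using a b by (auto intro: progression_Int[of a b])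
  have mem: "real i * c \<in> progression a \<inter> progression b" for i
    unfolding c(2) by (rule multiple_in_progression)
  obtain k k' where kk: "real k * a = real k' * b" "real k * a' \<noteq> real k' * b'"
    using False unfolding S_def by blast
  have exc: "\<exists>j. real i * a = real j * c" if "real i * a = real i' * b" for i i'
  proof -
    have "real i * a \<in> progression b" unfolding that by (rule multiple_in_progression)
    then have "real i * a \<in> progression c"
      unfolding c(2)[symmetric] by (intro IntI multiple_in_progression)
    then show ?thesis by (auto simp: progression_def)
  qed
  have cpos: "c > 0"
  proof (rule ccontr)
    assume "\<not> c > 0"
    then have "c = 0" using c(1) by simp
    then have "real k * a = 0" using exc[OF kk(1)] by auto
    then have "k = 0" "k' = 0" using a b kk(1) by auto
    then show False using kk(2) by simp
  qed
  obtain i where i: "c = real i * a" using mem[of 1] by (auto simp: progression_def)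
  obtain j where j: "c = real j * b" using mem[of 1] by (auto simp: progression_def)
  \<comment> \<open>A relation with small coefficients at \<open>c\<close> would carry over to
    \<open>a'\<close> and \<open>b'\<close>, and from there to all multiples of \<open>c\<close>,
    contrary to the broken coincidence \<open>k\<close>, \<open>k'\<close>.\<close>
  have "\<not> (i \<le> \<Psi> \<and> j \<le> \<Psi>)"
  proof
    assume "i \<le> \<Psi> \<and> j \<le> \<Psi>"
    then have eq: "real i * a' = real j * b'" using rel[of i j] i j by simp
    obtain h where h: "real k * a = real h * c" using exc[OF kk(1)] by blast
    have "real k * a = real h * real i * a" using h i by simp
    then have k: "real k = real h * real i" using a by simp
    have "real k' * b = real h * real j * b" using h j kk(1) by simp
    then have k': "real k' = real h * real j" using b by simp
    show False using kk(2) eq unfolding k k' by simp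
  qed
  then have cge: "c \<ge> real \<Psi> * r"
  proof -
    consider "\<Psi> \<le> i" | "\<Psi> \<le> j" using \<open>\<not> (i \<le> \<Psi> \<and> j \<le> \<Psi>)\<close> by linarith
    then show ?thesis
    proof cases
      case 1
      then show ?thesis unfolding i using r by (intro mult_mono) auto
    next
      case 2
      then show ?thesis unfolding j using r by (intro mult_mono) auto
    qed
  qed
  \<comment> \<open>\<open>?h\<close> turns \<open>k * a\<close> into \<open>k * a'\<close>. As
    \<open>a \<le> a'\<close>, the preimage of a point up to \<open>\<Delta>\<close> is at most
    \<open>\<Delta>\<close> too.\<close>
  let ?h = "\<lambda>y. y * (a' / a)"
  have sub: "S \<subseteq> ?h ` (progression c \<inter> {0..\<Delta>})"
  proof
    fix x assume "x \<in> S"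
    then obtain l l' where l: "x = real l * a'" "real l * a = real l' * b" "x \<le> \<Delta>"
      unfolding S_def by blast
    obtain h where h: "real l * a = real h * c" using exc[OF l(2)] by blast
    have "real l * a \<le> real l * a'" using a by (intro mult_left_mono) auto
    then have "real h * c \<in> progression c \<inter> {0..\<Delta>}"
      using l(1,3) c(1) multiple_in_progression[of h c] unfolding h by simp
    moreover have "x = ?h (real h * c)" unfolding l(1) h[symmetric] using a by simp
    ultimately show "x \<in> ?h ` (progression c \<inter> {0..\<Delta>})" by blast
  qed
  have fin: "finite (progression c \<inter> {0..\<Delta>})"
    using locally_finite_progression[OF c(1)] by (simp add: locally_finite_def)
  have "card S \<le> card (progression c \<inter> {0..\<Delta>})"
    using sub fin by (meson card_image_le card_mono finite_imageI order_trans)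
  also have "real \<dots> \<le> \<Delta> / c + 1" using cpos D by (intro card_progression_le) auto
  finally have "real (card S) \<le> \<Delta> / c + 1" by simp
  moreover have "\<Delta> / c \<le> \<Delta> / (real \<Psi> * r)"
    using cge D Psi r by (intro divide_left_mono) (auto intro!: mult_pos_pos cpos)
  ultimately show ?thesis using sub fin finite_subset by fastforce
qed

text \<open>The map sending the point \<open>k R' l\<close> to \<open>k R l\<close> decreases points, and it is injective up to
  collisions between progressions that have no small common multiple.\<close>

lemma density_transfer:
  fixes R R' :: "nat \<Rightarrow> real"
  assumes r: "r > 0" "\<And>l. l < m \<Longrightarrow> R l \<ge> r" and R': "\<And>l. l < m \<Longrightarrow> R' l \<ge> R l"
    and Psi: "\<Psi> > 0"
    and rel: "\<And>l l' i j. l < m \<Longrightarrow> l' < m \<Longrightarrow> i \<le> \<Psi> \<Longrightarrow> j \<le> \<Psi> \<Longrightarrow>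
      real i * R l = real j * R l' \<Longrightarrow> real i * R' l = real j * R' l'"
  shows "order_density m R' \<le> order_density m R + real m ^ 2 / (real \<Psi> * r)"
proof -
  let ?X = "\<Union>l<m. progression (R l)" and ?X' = "\<Union>l<m. progression (R' l)"
  have pos: "R l > 0" "R' l > 0" if "l < m" for l
    using r(1) r(2)[OF that] R'[OF that] by linarith+
  show ?thesis
  proof (rule has_density_le[OF has_density_density has_density_density, of _ _ _ _ _ "real m ^ 2"])
    fix \<Delta> :: real assume D: "\<Delta> > 0"
    \<comment> \<open>A point of \<open>?X'\<close> may be a multiple of several periods;
      \<open>p\<close> fixes one multiplier and one index for each point, which makes
      \<open>f\<close> a function of the point.\<close>
    have "\<forall>x\<in>?X'. \<exists>p. snd p < m \<and> x = real (fst p) * R' (snd p)"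
      by (force simp: progression_def)
    from bchoice[OF this] obtain p
      where p: "\<And>x. x \<in> ?X' \<Longrightarrow> snd (p x) < m" "\<And>x. x \<in> ?X' \<Longrightarrow> x = real (fst (p x)) * R' (snd (p x))"
      by blast
    define f where "f x = real (fst (p x)) * R (snd (p x))" for x
    define S where "S l l' = {x. \<exists>k k'. x = real k * R' l \<and> real k * R l = real k' * R l' \<and>
      real k * R' l \<noteq> real k' * R' l' \<and> x \<le> \<Delta>}" for l l'
    have S: "finite (S l l') \<and> real (card (S l l')) \<le> \<Delta> / (real \<Psi> * r) + 1" if "l < m" "l' < m" for l l'
      unfolding S_def using that r R' Psi pos D by (intro finite_card_collisions rel) auto
    define Bd where "Bd = (\<Union>q\<in>{..<m} \<times> {..<m}. S (fst q) (snd q))"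
    have finB: "finite Bd" unfolding Bd_def using S by (intro finite_UN_I) auto
    have finX: "finite (?X \<inter> {0..\<Delta>})" "finite (?X' \<inter> {0..\<Delta>})"
      using locally_finite_progressions[of m R] locally_finite_progressions[of m R'] pos
      by (simp_all add: locally_finite_def less_imp_le)
    have img: "f ` (?X' \<inter> {0..\<Delta>} - Bd) \<subseteq> ?X \<inter> {0..\<Delta>}"
    proof
      fix y assume "y \<in> f ` (?X' \<inter> {0..\<Delta>} - Bd)"
      then obtain x where x: "x \<in> ?X'" "x \<le> \<Delta>" "y = f x"
        by (elim imageE DiffE IntE) (simp only: atLeastAtMost_iff)
      have "f x \<le> real (fst (p x)) * R' (snd (p x))"
        unfolding f_def using R' p(1)[OF x(1)] by (intro mult_left_mono) auto
      also have "\<dots> = x" using p(2)[OF x(1)] by simp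
      finally have "f x \<le> \<Delta>" using x(2) by simp
      moreover have "f x \<ge> 0" unfolding f_def using pos(1)[OF p(1)[OF x(1)]] by simp
      moreover have "f x \<in> ?X"
        unfolding f_def using p(1)[OF x(1)] multiple_in_progression by auto
      ultimately show "y \<in> ?X \<inter> {0..\<Delta>}" using x(3) by simp
    qed
    have inj: "inj_on f (?X' \<inter> {0..\<Delta>} - Bd)"
    proof (rule inj_onI, rule ccontr)
      fix x y assume x: "x \<in> ?X' \<inter> {0..\<Delta>} - Bd" and y: "y \<in> ?X' \<inter> {0..\<Delta>} - Bd"
        and eq: "f x = f y" and ne: "x \<noteq> y"
      have xX: "x \<in> ?X'" and yX: "y \<in> ?X'" using x y by blast+
      \<comment> \<open>Equal images mean that the multiples agree for \<open>R\<close>, while the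
        points themselves differ for \<open>R'\<close>: a broken coincidence.\<close>
      have "x \<in> S (snd (p x)) (snd (p y))"
        unfolding S_def mem_Collect_eq
      proof (intro exI conjI)
        show "x = real (fst (p x)) * R' (snd (p x))" by (rule p(2)[OF xX])
        show "real (fst (p x)) * R (snd (p x)) = real (fst (p y)) * R (snd (p y))"
          using eq by (simp add: f_def)
        show "real (fst (p x)) * R' (snd (p x)) \<noteq> real (fst (p y)) * R' (snd (p y))"
          using ne p(2)[OF xX] p(2)[OF yX] by simp
        show "x \<le> \<Delta>" using x by simp
      qed
      then have "x \<in> Bd" unfolding Bd_def using p(1)[OF xX] p(1)[OF yX] by force
      then show False using x by blast
    qed
    have "card (?X' \<inter> {0..\<Delta>}) \<le> card (?X' \<inter> {0..\<Delta>} - Bd) + card Bd"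
      using finX finB card_mono[of "(?X' \<inter> {0..\<Delta>} - Bd) \<union> Bd" "?X' \<inter> {0..\<Delta>}"]
        card_Un_le[of "?X' \<inter> {0..\<Delta>} - Bd" Bd] by force
    also have "card (?X' \<inter> {0..\<Delta>} - Bd) \<le> card (?X \<inter> {0..\<Delta>})"
      using card_inj_on_le[OF inj img finX(1)] .
    finally have "real (card (?X' \<inter> {0..\<Delta>})) \<le> real (card (?X \<inter> {0..\<Delta>})) + real (card Bd)"
      by linarith
    moreover have "card Bd \<le> (\<Sum>q\<in>{..<m} \<times> {..<m}. card (S (fst q) (snd q)))"
      unfolding Bd_def by (rule card_UN_le) simp
    then have "real (card Bd) \<le> (\<Sum>q\<in>{..<m} \<times> {..<m}. real (card (S (fst q) (snd q))))"
      using of_nat_mono by fastforce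
    moreover have "\<dots> \<le> (\<Sum>q\<in>{..<m} \<times> {..<m}. \<Delta> / (real \<Psi> * r) + 1)"
      using S by (intro sum_mono) auto
    moreover have "\<dots> = \<Delta> * (real m ^ 2 / (real \<Psi> * r)) + real m ^ 2"
      by (simp add: power2_eq_square algebra_simps)
    ultimately show "real (card (?X' \<inter> {0..\<Delta>})) \<le>
        real (card (?X \<inter> {0..\<Delta>})) + \<Delta> * (real m ^ 2 / (real \<Psi> * r)) + real m ^ 2"
      by linarith
  qed (use pos in auto)
qed

section \<open>Densities of integral progressions by counting over one period\<close>

definition period_count :: "nat \<Rightarrow> (nat \<Rightarrow> nat) \<Rightarrow> nat \<Rightarrow> nat" where
  "period_count m A P = card {x. x < P \<and> (\<exists>l<m. A l dvd x)}"

lemma card_periodic: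
  assumes "\<And>l. l < m \<Longrightarrow> A l dvd P"
  shows "card {x. x < j * P \<and> (\<exists>l<m. A l dvd x)} = j * period_count m A P"
proof (induction j)
  case (Suc j)
  let ?G = "\<lambda>x. \<exists>l<m. A l dvd x"
  have G: "?G (x + j * P) = ?G x" for x
  proof -
    have "A l dvd x + j * P \<longleftrightarrow> A l dvd x" if "l < m" for l
      using assms[OF that] by (simp add: dvd_add_left_iff)
    then show ?thesis by blast
  qed
  have "{x. x < Suc j * P \<and> ?G x} = {x. x < j * P \<and> ?G x} \<union> (\<lambda>x. x + j * P) ` {x. x < P \<and> ?G x}"
  proof (intro equalityI subsetI)
    fix x assume x: "x \<in> {x. x < Suc j * P \<and> ?G x}"
    show "x \<in> {x. x < j * P \<and> ?G x} \<union> (\<lambda>x. x + j * P) ` {x. x < P \<and> ?G x}"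
    proof (cases "x < j * P")
      case False
      then have "x = (x - j * P) + j * P" by simp
      moreover from this have "x - j * P \<in> {x. x < P \<and> ?G x}"
        using x False G[of "x - j * P"] by auto
      ultimately show ?thesis by blast
    qed (use x in blast)
  next
    fix x assume "x \<in> {x. x < j * P \<and> ?G x} \<union> (\<lambda>x. x + j * P) ` {x. x < P \<and> ?G x}"
    then show "x \<in> {x. x < Suc j * P \<and> ?G x}" using G by auto
  qed
  moreover have "{x. x < j * P \<and> ?G x} \<inter> (\<lambda>x. x + j * P) ` {x. x < P \<and> ?G x} = {}" by auto
  moreover have "card ((\<lambda>x. x + j * P) ` {x. x < P \<and> ?G x}) = period_count m A P"
    unfolding period_count_def by (intro card_image) (auto simp: inj_on_def)
  ultimately show ?case using Suc.IH by (simp add: card_Un_disjoint)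
qed simp

text \<open>The limit is known to exist, so it may be computed along
  \<open>\<Delta> = j P \<delta>\<close>, where the number of orders is exactly \<open>j\<close>
  times the count over one period, plus one.\<close>

lemma density_integral:
  assumes A: "\<And>l. l < m \<Longrightarrow> A l > 0 \<and> A l dvd P" and P: "P > 0" and \<delta>: "\<delta> > 0" and m: "m > 0"
  shows "order_density m (\<lambda>l. real (A l) * \<delta>) = real (period_count m A P) / (real P * \<delta>)"
proof -
  let ?X = "\<Union>l<m. progression (real (A l) * \<delta>)"
  let ?c = "period_count m A P"
  have lim: "((\<lambda>\<Delta>. real (card (?X \<inter> {0..\<Delta>})) / \<Delta>) \<longlongrightarrow> order_density m (\<lambda>l. real (A l) * \<delta>)) at_top"
    using has_density_density[of m "\<lambda>l. real (A l) * \<delta>"] A \<delta> by (simp add: has_density_def)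
  have "filterlim (\<lambda>j. (real P * \<delta>) * real j) at_top sequentially"
    using P \<delta> by (intro filterlim_tendsto_pos_mult_at_top[OF tendsto_const] filterlim_real_sequentially) auto
  from filterlim_compose[OF lim this]
  have 1: "(\<lambda>j. real (card (?X \<inter> {0..(real P * \<delta>) * real j})) / ((real P * \<delta>) * real j))
      \<longlonglongrightarrow> order_density m (\<lambda>l. real (A l) * \<delta>)" .
  have cd: "card (?X \<inter> {0..(real P * \<delta>) * real j}) = j * ?c + 1" for j
  proof -
    \<comment> \<open>The closed interval contains its right end \<open>j * P\<close>, which the
      half-open period count leaves out. It is an order because \<open>A l\<close> divides
      \<open>P\<close>.\<close>
    have "?X \<inter> {0..(real P * \<delta>) * real j} = (\<lambda>x. real x * \<delta>) ` (insert (j * P) {x. x < j * P \<and> (\<exists>l<m. A l dvd x)})"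
    proof (intro equalityI subsetI)
      fix x assume x: "x \<in> ?X \<inter> {0..(real P * \<delta>) * real j}"
      then obtain l k where lk: "l < m" "x = real k * (real (A l) * \<delta>)" by (auto simp: progression_def)
      have "real (k * A l) * \<delta> \<le> real (j * P) * \<delta>" using x lk by (simp add: algebra_simps)
      then have "k * A l \<le> j * P" using \<delta> by (simp del: of_nat_mult)
      moreover have "x = real (k * A l) * \<delta>" using lk by simp
      ultimately show "x \<in> (\<lambda>x. real x * \<delta>) ` (insert (j * P) {x. x < j * P \<and> (\<exists>l<m. A l dvd x)})"
        using lk(1) by (intro image_eqI[of _ _ "k * A l"]) auto
    next
      fix x assume "x \<in> (\<lambda>x. real x * \<delta>) ` (insert (j * P) {x. x < j * P \<and> (\<exists>l<m. A l dvd x)})"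
      then obtain y where y: "x = real y * \<delta>" "y \<le> j * P" "y = j * P \<or> (\<exists>l<m. A l dvd y)"
        by (elim imageE) (auto simp: le_less)
      have "\<exists>l<m. A l dvd y" using y(3) A m by auto
      then obtain l k where l: "l < m" "y = A l * k" by (auto simp: dvd_def)
      have "real y * \<delta> \<le> real (j * P) * \<delta>" using y(2) \<delta> by (intro mult_right_mono) (simp_all del: of_nat_mult)
      then have "x \<le> (real P * \<delta>) * real j" using y(1) by (simp add: algebra_simps)
      moreover have "x = real k * (real (A l) * \<delta>)" using y(1) l(2) by simp
      ultimately show "x \<in> ?X \<inter> {0..(real P * \<delta>) * real j}"
        using l(1) multiple_in_progression[of k "real (A l) * \<delta>"] \<delta> by auto
    qed
    moreover have "inj (\<lambda>x. real x * \<delta>)" using \<delta> by (auto simp: inj_def)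
    ultimately have "card (?X \<inter> {0..(real P * \<delta>) * real j}) = card (insert (j * P) {x. x < j * P \<and> (\<exists>l<m. A l dvd x)})"
      by (simp only: card_image[OF inj_on_subset[OF _ subset_UNIV]])
    also have "\<dots> = j * ?c + 1"
      using card_periodic[of m A P j] A by simp
    finally show ?thesis .
  qed
  have "(\<lambda>j. real ?c / (real P * \<delta>) + 1 / (real P * \<delta>) * inverse (real j)) \<longlonglongrightarrow> real ?c / (real P * \<delta>) + 1 / (real P * \<delta>) * 0"
    by (intro tendsto_add tendsto_mult tendsto_const lim_inverse_n)
  moreover have "\<forall>\<^sub>F j in sequentially. real ?c / (real P * \<delta>) + 1 / (real P * \<delta>) * inverse (real j)
      = real (card (?X \<inter> {0..(real P * \<delta>) * real j})) / ((real P * \<delta>) * real j)"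
    using eventually_gt_at_top[of 0]
  proof eventually_elim
    case (elim j)
    then show ?case using P \<delta> unfolding cd by (simp add: field_simps)
  qed
  ultimately have "(\<lambda>j. real (card (?X \<inter> {0..(real P * \<delta>) * real j})) / ((real P * \<delta>) * real j))
      \<longlonglongrightarrow> real ?c / (real P * \<delta>) + 1 / (real P * \<delta>) * 0"
    by (rule Lim_transform_eventually)
  from LIMSEQ_unique[OF 1 this] show ?thesis by simp
qed

text \<open>A relation between integers that holds up to an error below \<open>1\<close> holds exactly, so good simultaneous
  approximations inherit all relations with small coefficients.\<close>

lemma simultaneous_rounding:
  fixes R :: "nat \<Rightarrow> real" and N m :: nat
  assumes N: "N \<ge> 2 * \<Psi>" "\<Psi> > 0" and r: "r > 0" and R: "\<And>l. l < m \<Longrightarrow> R l \<ge> r"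
  obtains q :: nat and A :: "nat \<Rightarrow> nat" where "0 < q" "q \<le> N ^ m"
    "\<And>l. l < m \<Longrightarrow> \<bar>real q * R l / r - real (A l)\<bar> < 1 / real N"
    "\<And>l. l < m \<Longrightarrow> A l > 0"
    "\<And>l l' i j. l < m \<Longrightarrow> l' < m \<Longrightarrow> i \<le> \<Psi> \<Longrightarrow> j \<le> \<Psi> \<Longrightarrow>
      real i * R l = real j * R l' \<Longrightarrow> i * A l = j * A l'"
proof -
  have N0: "N > 0" using N by linarith
  obtain q p where q: "0 < q" "q \<le> int (N ^ m)"
    and p: "\<And>i. i < m \<Longrightarrow> \<bar>of_int q * (R i / r) - of_int (p i)\<bar> < 1 / real N"
    by (rule Dirichlet_approx_simult[OF N0, of m "\<lambda>l. R l / r"]) auto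
  have N1: "1 / real N \<le> 1" using N0 by simp
  \<comment> \<open>From \<open>R l \<ge> r\<close> and \<open>q \<ge> 1\<close> the approximated
    number is at least 1, and an error below \<open>1 / N \<le> 1\<close> keeps the integer
    positive. This allows the passage from \<open>int\<close> to \<open>nat\<close>.\<close>
  have ppos: "p l > 0" if "l < m" for l
  proof -
    have "1 \<le> R l / r" using R[OF that] r by simp
    then have "1 * 1 \<le> of_int q * (R l / r)" using q(1) by (intro mult_mono) auto
    then have "of_int (p l) > (0::real)" using p[OF that] N1 by linarith
    then show ?thesis by simp
  qed
  have qr: "real (nat q) = of_int q" using q(1) by simp
  show ?thesis
  proof (rule that[of "nat q" "\<lambda>l. nat (p l)"])
    show "0 < nat q" using q by simp
    show "nat q \<le> N ^ m" using q by linarith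
    show c: "\<bar>real (nat q) * R l / r - real (nat (p l))\<bar> < 1 / real N" if "l < m" for l
      using p[OF that] ppos[OF that] qr by simp
    show "nat (p l) > 0" if "l < m" for l using ppos[OF that] by simp
    fix l l' i j assume l: "l < m" "l' < m" and ij: "i \<le> \<Psi>" "j \<le> \<Psi>" and eq: "real i * R l = real j * R l'"
    let ?x = "of_int q * (R l / r)" and ?y = "of_int q * (R l' / r)"
    have xy: "real i * ?x = real j * ?y" using eq by (simp add: field_simps)
    \<comment> \<open>For the exact values \<open>?x\<close> and \<open>?y\<close> the difference is
      0. Replacing them by integers costs less than
      \<open>(i + j) / N \<le> 2 \<Psi> / N \<le> 1\<close>; strictness needs a positive
      coefficient, hence the case distinctions.\<close>
    have "\<bar>real i * of_int (p l) - real j * of_int (p l')\<bar> < 1"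
    proof (cases "i = 0 \<and> j = 0")
      case False
      have "real i * of_int (p l) - real j * of_int (p l') =
          real j * (?y - of_int (p l')) - real i * (?x - of_int (p l))"
        using xy by (simp add: algebra_simps)
      also have "\<bar>\<dots>\<bar> \<le> real j * \<bar>?y - of_int (p l')\<bar> + real i * \<bar>?x - of_int (p l)\<bar>"
        using abs_triangle_ineq4[of "real j * (?y - of_int (p l'))" "real i * (?x - of_int (p l))"]
        by (simp add: abs_mult)
      also have "\<dots> < real j * (1 / real N) + real i * (1 / real N)"
      proof -
        have a: "real j * \<bar>?y - of_int (p l')\<bar> \<le> real j * (1 / real N)"
          "real i * \<bar>?x - of_int (p l)\<bar> \<le> real i * (1 / real N)"
          using p[OF l(1)] p[OF l(2)] by (intro mult_left_mono; simp)+
        show ?thesis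
        proof (cases "i = 0")
          case True
          then have "real j * \<bar>?y - of_int (p l')\<bar> < real j * (1 / real N)"
            using p[OF l(2)] False by (intro mult_strict_left_mono) auto
          then show ?thesis using a by linarith
        next
          case False
          then have "real i * \<bar>?x - of_int (p l)\<bar> < real i * (1 / real N)"
            using p[OF l(1)] by (intro mult_strict_left_mono) auto
          then show ?thesis using a by linarith
        qed
      qed
      also have "\<dots> \<le> 1"
      proof -
        have "real i + real j \<le> real N" using N(1) ij by linarith
        then show ?thesis using N0 by (simp add: field_simps)
      qed
      finally show ?thesis .
    qed simp
    then have "\<bar>of_int (int i * p l - int j * p l') :: real\<bar> < 1" by simp
    then have "\<bar>int i * p l - int j * p l'\<bar> < 1" by linarith
    then have "int i * p l = int j * p l'" by simp
    then have "int (i * nat (p l)) = int (j * nat (p l'))"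
      using ppos[OF l(1)] ppos[OF l(2)] by simp
    then show "i * nat (p l) = j * nat (p l')" by (simp only: of_nat_eq_iff)
  qed
qed

section \<open>Structured policies\<close>

locale instance_with_accuracy =
  fixes I :: rc_instance and E :: nat
  assumes valid: "valid_instance I" and E_ge: "E \<ge> 4"
begin

abbreviation "n \<equiv> ncom I"
abbreviation "D \<equiv> nres I"
abbreviation "K0 \<equiv> joint_cost I"
abbreviation "K \<equiv> order_cost I"
abbreviation "H \<equiv> hold_cost I"
abbreviation "e \<equiv> 1 / real E"

lemma n_pos: "n > 0" and D_pos: "D > 0" and K0_pos: "K0 > 0"
  and K_pos: "i < n \<Longrightarrow> K i > 0" and H_pos: "i < n \<Longrightarrow> H i > 0"
  and alpha_nonneg: "i < n \<Longrightarrow> d < D \<Longrightarrow> alpha I i d \<ge> 0"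
  and beta_pos: "d < D \<Longrightarrow> beta I d > 0"
  using valid by (auto simp: valid_instance_def)

lemma E_pos: "E > 0" and e_pos: "e > 0" and e_le: "e \<le> 1 / 4"
proof -
  show "E > 0" "e > 0" using E_ge by auto
  have "real E \<ge> 4" using E_ge by simp
  then show "e \<le> 1 / 4" by (simp add: field_simps)
qed

section \<open>Costs of single commodities and the reference period\<close>

definition item_cost :: "nat \<Rightarrow> real \<Rightarrow> real" where
  "item_cost i t = K i / t + H i * t"

text \<open>The classical economic order quantity, the minimiser of
  \<open>item_cost i\<close>.\<close>

definition eoq :: "nat \<Rightarrow> real" where "eoq i = sqrt (K i / H i)"

text \<open>The economic order quantity of a commodity that pays the joint cost alone.\<close>

definition joint_eoq :: "nat \<Rightarrow> real" where "joint_eoq i = sqrt ((K0 + K i) / H i)"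

text \<open>The period from which on commodity \<open>i\<close> on its own fits into all capacities.
  The inserted 0 is the value from which the program starts the maximum.\<close>

definition bottleneck :: "nat \<Rightarrow> real" where
  "bottleneck i = Max (insert 0 ((\<lambda>d. alpha I i d / beta I d) ` {..<D}))"

text \<open>The number \<open>w\<close> of the overview. A commodity attaining the minimum can bear
  the whole joint cost when ordered at a period around \<open>base\<close>. Conversely, a commodity
  with bottleneck below \<open>base\<close> has \<open>joint_eoq\<close> at least
  \<open>base\<close>, so that at periods far below \<open>base\<close> its holding cost is small
  against \<open>K0\<close> and its ordering cost.\<close>

definition base :: real where
  "base = Min ((\<lambda>i. max (joint_eoq i) (bottleneck i)) ` {..<n})"

lemma cost_eq:
  assumes "\<And>i. i < n \<Longrightarrow> T i > 0"
  shows "cost I T = K0 * order_density n T + (\<Sum>i<n. item_cost i (T i))"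
  using joint_ordering_cost_eq[OF assms] by (simp add: cost_def item_cost_def)

lemma item_cost_pos: "i < n \<Longrightarrow> t > 0 \<Longrightarrow> item_cost i t > 0"
  unfolding item_cost_def using K_pos H_pos by (intro add_pos_pos) auto

lemma item_cost_le_stretch:
  assumes "i < n" "0 < t" "t \<le> t'" "t' \<le> x * t" "x \<ge> 1"
  shows "item_cost i t' \<le> x * item_cost i t"
proof -
  have "K i / t' \<le> K i / t"
    using assms K_pos[OF assms(1)] by (intro divide_left_mono) auto
  also have "\<dots> \<le> x * (K i / t)"
    using mult_right_mono[of 1 x "K i / t"] assms K_pos[OF assms(1)] by simp
  finally have "K i / t' \<le> x * (K i / t)" .
  moreover have "H i * t' \<le> x * (H i * t)"
    using mult_left_mono[OF assms(4), of "H i"] H_pos[OF assms(1)] by (simp add: algebra_simps)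
  ultimately show ?thesis by (simp add: item_cost_def algebra_simps)
qed

lemma eoq_pos: "i < n \<Longrightarrow> eoq i > 0"
  using K_pos H_pos by (simp add: eoq_def)

text \<open>A longer period saves less ordering cost than it adds holding cost once
  \<open>t * t' \<ge> K i / H i\<close>.\<close>

lemma item_cost_mono_above_eoq:
  assumes i: "i < n" and t: "eoq i \<le> t" "t \<le> t'"
  shows "item_cost i t \<le> item_cost i t'"
proof -
  have t0: "t > 0" "t' > 0" using eoq_pos[OF i] t by linarith+
  have "K i / H i = eoq i ^ 2" using K_pos[OF i] H_pos[OF i] by (simp add: eoq_def)
  also have "\<dots> \<le> t * t'"
    unfolding power2_eq_square using t eoq_pos[OF i] by (intro mult_mono) auto
  finally have "K i \<le> H i * (t * t')" using H_pos[OF i] by (simp add: field_simps)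
  then have "K i * (t' - t) \<le> H i * (t * t') * (t' - t)" using t by (intro mult_right_mono) auto
  moreover have "K i / t - K i / t' = K i * (t' - t) / (t * t')" using t0 by (simp add: field_simps)
  ultimately have "K i / t - K i / t' \<le> H i * (t' - t)"
    using t0 by (simp add: field_simps)
  then show ?thesis by (simp add: item_cost_def algebra_simps)
qed

lemma item_cost_ge_eoq:
  assumes i: "i < n" and t: "t > 0"
  shows "item_cost i (eoq i) \<le> item_cost i t"
proof -
  let ?s = "eoq i"
  have s: "?s > 0" using eoq_pos[OF i] .
  have K: "K i = H i * ?s\<^sup>2" using K_pos[OF i] H_pos[OF i] by (simp add: eoq_def)
  have "0 \<le> H i * (?s - t)\<^sup>2 / t" using H_pos[OF i] t by simp
  also have "\<dots> = H i * ?s\<^sup>2 / t + H i * t - 2 * H i * ?s"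
    using t by (simp add: field_simps power2_eq_square)
  finally have "2 * H i * ?s \<le> H i * ?s\<^sup>2 / t + H i * t" by simp
  moreover have "item_cost i ?s = 2 * H i * ?s"
    unfolding item_cost_def K using s by (simp add: power2_eq_square field_simps)
  ultimately show ?thesis unfolding item_cost_def K by simp
qed

lemma bottleneck_nonneg: "bottleneck i \<ge> 0"
  unfolding bottleneck_def by (rule Max_ge) auto

lemma alpha_le_bottleneck:
  assumes "d < D"
  shows "alpha I i d \<le> bottleneck i * beta I d"
proof -
  have "alpha I i d / beta I d \<le> bottleneck i"
    unfolding bottleneck_def using assms by (intro Max_ge) auto
  then show ?thesis using beta_pos[OF assms] by (simp add: field_simps)
qed

lemma bottleneck_le:
  assumes i: "i < n" and pos: "\<And>i. i < n \<Longrightarrow> T i > 0" and x: "x \<ge> 0"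
    and sum: "\<And>d. d < D \<Longrightarrow> (\<Sum>i<n. alpha I i d / T i) \<le> x * beta I d"
  shows "bottleneck i \<le> x * T i"
proof -
  have "alpha I i d / beta I d \<le> x * T i" if d: "d < D" for d
  proof -
    have "alpha I i d / T i \<le> (\<Sum>i<n. alpha I i d / T i)"
      using i pos alpha_nonneg[OF _ d] by (intro member_le_sum) (auto simp: less_imp_le)
    also have "\<dots> \<le> x * beta I d" by (rule sum[OF d])
    finally show ?thesis using pos[OF i] beta_pos[OF d] by (simp add: field_simps)
  qed
  moreover have "x * T i \<ge> 0" using x pos[OF i] by simp
  ultimately show ?thesis unfolding bottleneck_def by (subst Max_le_iff) auto
qed

lemma joint_eoq_pos: "i < n \<Longrightarrow> joint_eoq i > 0"
  using K_pos[of i] H_pos[of i] K0_pos by (simp add: joint_eoq_def)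

lemma joint_cost_eq: "i < n \<Longrightarrow> K0 + K i = H i * (joint_eoq i)\<^sup>2"
  using K_pos[of i] H_pos[of i] K0_pos by (simp add: joint_eoq_def)

lemma base_le: "i < n \<Longrightarrow> base \<le> max (joint_eoq i) (bottleneck i)"
  unfolding base_def by (intro Min_le) auto

lemma base_attained: "\<exists>i<n. base = max (joint_eoq i) (bottleneck i)"
proof -
  have "base \<in> (\<lambda>i. max (joint_eoq i) (bottleneck i)) ` {..<n}"
    unfolding base_def using n_pos by (intro Min_in) auto
  then show ?thesis by auto
qed

lemma base_pos: "base > 0"
proof -
  obtain i where "i < n" "base = max (joint_eoq i) (bottleneck i)" using base_attained by blast
  then show ?thesis using joint_eoq_pos[of i] by simp
qed

section \<open>Bringing the shortest period close to the reference\<close>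

lemma progressions_cong_or:
  assumes "\<And>i. i < n \<Longrightarrow> T' i = T i \<or> T' i = t"
  shows "(\<Union>i<n. progression (T' i)) \<subseteq> (\<Union>i<n. progression (T i)) \<union> progression t"
proof
  fix x assume "x \<in> (\<Union>i<n. progression (T' i))"
  then obtain i where "i < n" "x \<in> progression (T' i)" by blast
  then show "x \<in> (\<Union>i<n. progression (T i)) \<union> progression t"
    using assms[of i] by auto
qed

text \<open>All replaced commodities share one new progression, so the increase is
  \<open>1 / t\<close> whatever their number.\<close>

lemma density_replace_le:
  assumes pos: "\<And>i. i < n \<Longrightarrow> T i > 0" and t: "t > 0"
    and T': "\<And>i. i < n \<Longrightarrow> T' i = T i \<or> T' i = t"
  shows "order_density n T' \<le> order_density n T + 1 / t"
proof -
  have pos': "T' i > 0" if "i < n" for i using T'[OF that] pos[OF that] t by auto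
  have "order_density n T' \<le> order_density n T + (\<Sum>i\<in>{0::nat}. 1 / (\<lambda>_. t) i)"
  proof (rule density_le_add)
    show "(\<Union>i<n. progression (T' i)) \<subseteq> (\<Union>i<n. progression (T i)) \<union> (\<Union>i\<in>{0::nat}. progression t)"
      using progressions_cong_or[of T' T t] T' by simp
  qed (use pos pos' t in auto)
  then show ?thesis by simp
qed

lemma order_density_nonneg:
  assumes "\<And>i. i < n \<Longrightarrow> T i > 0"
  shows "order_density n T \<ge> 0"
proof -
  have "1 / T 0 \<le> order_density n T" by (rule density_ge_inverse[OF assms n_pos])
  moreover have "1 / T 0 > 0" using assms[OF n_pos] by simp
  ultimately show ?thesis by linarith
qed

text \<open>The commodity \<open>j\<close> attaining \<open>base\<close> is moved down to
  \<open>t = n E base\<close>. Its ordering cost together with the additional joint cost is at most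
  \<open>H j * base\<^sup>2 / t\<close>, an \<open>e\<close> fraction of the holding cost that
  \<open>j\<close> paid before. Its share of each capacity becomes at most \<open>e\<close>, since
  its bottleneck is at most \<open>base\<close>.\<close>

lemma bound_shortest_above:
  assumes pos: "\<And>i. i < n \<Longrightarrow> T i > 0"
    and sum: "\<And>d. d < D \<Longrightarrow> (\<Sum>i<n. alpha I i d / T i) \<le> beta I d"
    and long: "\<And>i. i < n \<Longrightarrow> T i > n * E * base"
  obtains T' where "\<And>i. i < n \<Longrightarrow> T' i \<ge> n * E * base" "\<exists>i<n. T' i = n * E * base"
    "\<And>d. d < D \<Longrightarrow> (\<Sum>i<n. alpha I i d / T' i) \<le> (1 + e) * beta I d"
    "cost I T' \<le> (1 + e) * cost I T"
proof -
  obtain j where j: "j < n" "base = max (joint_eoq j) (bottleneck j)" using base_attained by blast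
  define t where "t = n * E * base"
  have nE: "real n * real E \<ge> 1" "real n * real E \<ge> real E"
  proof -
    have "real n \<ge> 1" "real E \<ge> 1" using n_pos E_ge by auto
    then show "real n * real E \<ge> real E" using mult_right_mono[of 1 "real n" "real E"] by simp
    then show "real n * real E \<ge> 1" using \<open>real E \<ge> 1\<close> by linarith
  qed
  have t: "t > 0" unfolding t_def using n_pos E_pos base_pos by simp
  define T' where "T' = T(j := t)"
  have pos': "T' i > 0" if "i < n" for i using pos[OF that] t by (simp add: T'_def)
  have dens: "order_density n T' \<le> order_density n T + 1 / t"
    by (rule density_replace_le[OF pos t]) (auto simp: T'_def)
  have Tj: "t \<le> T j" using long[OF j(1)] by (simp add: t_def)
  have "K0 / t + item_cost j t \<le> (1 + e) * item_cost j (T j)"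
  proof -
    have "K0 + K j \<le> H j * base\<^sup>2"
      unfolding joint_cost_eq[OF j(1)] using j joint_eoq_pos[OF j(1)] H_pos[OF j(1)]
      by (intro mult_left_mono power_mono) auto
    then have "(K0 + K j) / t \<le> H j * base\<^sup>2 / t" using t by (intro divide_right_mono) auto
    also have "\<dots> = H j * base / (n * E)"
      unfolding t_def using base_pos n_pos E_pos by (simp add: power2_eq_square field_simps)
    also have "\<dots> \<le> H j * t / E"
    proof (rule frac_le)
      have "base \<le> t" unfolding t_def using mult_right_mono[OF nE(1), of base] base_pos by simp
      then show "H j * base \<le> H j * t" using H_pos[OF j(1)] by (intro mult_left_mono) auto
      show "real E \<le> real (n * E)" using nE(2) by simp
    qed (use H_pos[OF j(1)] t E_pos in auto)
    also have "\<dots> \<le> H j * T j / E"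
      using Tj H_pos[OF j(1)] by (intro divide_right_mono mult_left_mono) auto
    finally have "(K0 + K j) / t \<le> e * (H j * T j)" by simp
    moreover have "H j * t \<le> H j * T j" using Tj H_pos[OF j(1)] by (intro mult_left_mono) auto
    moreover have "K j / T j \<ge> 0" using K_pos[OF j(1)] pos[OF j(1)] by simp
    moreover have "e * (K j / T j) \<ge> 0" using \<open>K j / T j \<ge> 0\<close> e_pos by (intro mult_nonneg_nonneg) auto
    ultimately show ?thesis by (simp only: item_cost_def add_divide_distrib distrib_left distrib_right mult_1_left)
  qed
  moreover have "K0 * order_density n T' \<le> K0 * order_density n T + K0 / t"
    using mult_left_mono[OF dens, of K0] K0_pos by (simp add: algebra_simps)
  moreover have "e * (K0 * order_density n T) \<ge> 0"
    using order_density_nonneg[OF pos] K0_pos e_pos by (intro mult_nonneg_nonneg) auto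
  moreover have "e * (\<Sum>i\<in>{..<n} - {j}. item_cost i (T i)) \<ge> 0"
    using pos e_pos by (intro mult_nonneg_nonneg sum_nonneg) (auto simp: item_cost_pos less_imp_le)
  moreover have "(\<Sum>i<n. item_cost i (T' i)) = item_cost j t + (\<Sum>i\<in>{..<n} - {j}. item_cost i (T i))"
    using j(1) by (subst sum.remove[of _ j]) (auto simp: T'_def intro!: sum.cong)
  moreover have "(\<Sum>i<n. item_cost i (T i)) = item_cost j (T j) + (\<Sum>i\<in>{..<n} - {j}. item_cost i (T i))"
    using j(1) by (subst sum.remove[of _ j]) auto
  moreover have "cost I T = K0 * order_density n T + (\<Sum>i<n. item_cost i (T i))"
    "cost I T' = K0 * order_density n T' + (\<Sum>i<n. item_cost i (T' i))"
    by (intro cost_eq pos pos'; assumption)+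
  ultimately have cost: "cost I T' \<le> (1 + e) * cost I T"
    by (simp only: distrib_left distrib_right mult_1_left)
  have "(\<Sum>i<n. alpha I i d / T' i) \<le> (1 + e) * beta I d" if d: "d < D" for d
  proof -
    have "alpha I j d / t \<le> e * beta I d"
    proof -
      have "alpha I j d \<le> base * beta I d"
        using alpha_le_bottleneck[OF d, of j] j(2) beta_pos[OF d]
        by (smt (verit) mult_right_mono)
      also have "\<dots> \<le> e * beta I d * t"
      proof -
        have "base * real E \<le> t" unfolding t_def using nE(2) base_pos by simp
        then have "base \<le> e * t" using E_pos by (simp add: field_simps)
        then show ?thesis using mult_right_mono[of base "e * t" "beta I d"] beta_pos[OF d]
          by (simp add: algebra_simps)
      qed
      finally show ?thesis using t by (simp add: field_simps)
    qed
    moreover have "(\<Sum>i<n. alpha I i d / T' i) = alpha I j d / t + (\<Sum>i\<in>{..<n} - {j}. alpha I i d / T i)"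
      using j(1) by (subst sum.remove[of _ j]) (auto simp: T'_def intro!: sum.cong)
    moreover have "(\<Sum>i\<in>{..<n} - {j}. alpha I i d / T i) \<le> (\<Sum>i<n. alpha I i d / T i)"
      using pos alpha_nonneg[OF _ d] by (intro sum_mono2) (auto simp: less_imp_le)
    ultimately show ?thesis using sum[OF d] by (simp add: algebra_simps)
  qed
  moreover have "T' i \<ge> t" if "i < n" for i using long[OF that] by (simp add: T'_def t_def)
  moreover have "\<exists>i<n. T' i = t" using j(1) by (auto simp: T'_def)
  ultimately show ?thesis using that[of T'] cost by (simp add: t_def)
qed

text \<open>All periods are raised to at least \<open>t = base / (n E)\<close>. The period of
  \<open>j\<close>, shorter than \<open>t / E\<close>, already forces a density above
  \<open>E / t\<close>, so the new progression adds at most an \<open>e\<close> fraction. The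
  holding cost of a raised commodity is at most an \<open>n\<close>-th part of
  \<open>e K0 / t\<close> plus an \<open>e\<close> fraction of its former ordering cost.\<close>

lemma bound_shortest_below:
  assumes pos: "\<And>i. i < n \<Longrightarrow> T i > 0"
    and sum: "\<And>d. d < D \<Longrightarrow> (\<Sum>i<n. alpha I i d / T i) \<le> beta I d"
    and j: "j < n" "T j < base / (n * E ^ 2)"
  obtains T' where "\<And>i. i < n \<Longrightarrow> T' i \<ge> base / (n * E)" "T' j = base / (n * E)"
    "\<And>d. d < D \<Longrightarrow> (\<Sum>i<n. alpha I i d / T' i) \<le> beta I d"
    "cost I T' \<le> (1 + 2 * e) * cost I T"
proof -
  define t where "t = base / (n * E)"
  have t: "t > 0" unfolding t_def using n_pos E_pos base_pos by simp
  have n1: "real n \<ge> 1" and E1: "real E \<ge> 1" using n_pos E_pos by auto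
  have tb: "t \<le> base"
  proof -
    have "1 * 1 \<le> real n * real E" using n1 E1 by (intro mult_mono) auto
    then show ?thesis unfolding t_def using base_pos by (simp add: divide_le_eq)
  qed
  have tjE: "T j < t * e"
    using j(2) unfolding t_def by (simp add: power2_eq_square)
  have tj: "T j < t"
  proof -
    have "t * e \<le> t * 1" using t E1 by (intro mult_left_mono) (auto simp: field_simps)
    then show ?thesis using tjE by simp
  qed
  define T' where "T' i = max (T i) t" for i
  have pos': "T' i > 0" for i using t by (simp add: T'_def)
  have dens: "order_density n T' \<le> order_density n T + 1 / t"
    by (rule density_replace_le[OF pos t]) (auto simp: T'_def max_def)
  have t1: "1 / t \<le> e * order_density n T"
  proof -
    have "1 / (t * e) \<le> 1 / T j" using tjE pos[OF j(1)] t e_pos by (intro divide_left_mono mult_pos_pos) auto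
    also have "\<dots> \<le> order_density n T" by (rule density_ge_inverse[OF pos j(1)])
    finally show ?thesis using t E_pos by (simp add: field_simps)
  qed
  have item: "item_cost i (T' i) \<le> (1 + e) * item_cost i (T i) + e * (K0 / t) / n" if i: "i < n" for i
  proof (cases "T i \<ge> t")
    case True
    then have "T' i = T i" by (simp add: T'_def)
    moreover have "e * item_cost i (T i) \<ge> 0" "e * (K0 / t) / n \<ge> 0"
      using item_cost_pos[OF i pos[OF i]] e_pos K0_pos t by (simp_all add: mult_nonneg_nonneg)
    ultimately show ?thesis by (simp only: distrib_right mult_1_left)
  next
    case False
    then have T': "T' i = t" by (simp add: T'_def)
    \<comment> \<open>Feasibility bounds the bottleneck by the period, which is below
      \<open>base\<close>; so in the maximum that bounds \<open>base\<close> the term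
      \<open>joint_eoq i\<close> must be the large one.\<close>
    have "bottleneck i \<le> 1 * T i" by (rule bottleneck_le[OF i pos]) (simp_all add: sum)
    then have "bottleneck i < base" using False tb by simp
    then have jb: "base \<le> joint_eoq i" using base_le[OF i] by linarith
    have KK: "K0 + K i > 0" using K0_pos K_pos[OF i] by simp
    have "H i * base\<^sup>2 \<le> K0 + K i"
      unfolding joint_cost_eq[OF i] using jb H_pos[OF i] base_pos by (intro mult_left_mono power_mono) auto
    then have "H i * (t * (n * E))\<^sup>2 \<le> K0 + K i" unfolding t_def using n_pos E_pos by simp
    then have "H i * t \<le> (K0 + K i) / t / (real n * real E)\<^sup>2"
      using t n_pos E_pos by (simp add: field_simps power2_eq_square)
    also have "\<dots> \<le> (K0 + K i) / t / (real n * real E)"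
    proof (rule divide_left_mono)
      have "1 * 1 \<le> real n * real E" using n1 E1 by (intro mult_mono) auto
      then show "real n * real E \<le> (real n * real E)\<^sup>2"
        unfolding power2_eq_square using mult_right_mono[of 1 "real n * real E" "real n * real E"] by simp
    qed (use KK t n_pos E_pos in auto)
    also have "\<dots> = e * (K0 / t) / n + (K i / t) * (1 / (real n * real E))"
      using n_pos E_pos t by (simp add: field_simps)
    also have "(K i / t) * (1 / (real n * real E)) \<le> (K i / T i) * e"
    proof (rule mult_mono)
      show "K i / t \<le> K i / T i" using False pos[OF i] K_pos[OF i] by (intro divide_left_mono) auto
      show "1 / (real n * real E) \<le> e"
        using mult_right_mono[of 1 "real n" "real E"] n1 E_pos by (intro divide_left_mono) auto
    qed (use K_pos[OF i] pos[OF i] n_pos E_pos in auto)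
    finally have "H i * t \<le> e * (K0 / t) / n + e * (K i / T i)" by (simp only: mult.commute)
    moreover have "K i / t \<le> K i / T i" using False pos[OF i] K_pos[OF i] by (intro divide_left_mono) auto
    moreover have "H i * T i \<ge> 0" "e * (H i * T i) \<ge> 0"
      using H_pos[OF i] pos[OF i] e_pos by (simp_all add: mult_nonneg_nonneg)
    ultimately show ?thesis unfolding T' item_cost_def by (simp only: distrib_right distrib_left mult_1_left)
  qed
  have "(\<Sum>i<n. item_cost i (T' i)) \<le> (\<Sum>i<n. (1 + e) * item_cost i (T i) + e * (K0 / t) / n)"
    using item by (intro sum_mono) auto
  also have "\<dots> = (1 + e) * (\<Sum>i<n. item_cost i (T i)) + e * (K0 / t)"
    using n_pos by (simp add: sum.distrib sum_distrib_left)
  also have "e * (K0 / t) \<le> e * (K0 * order_density n T)"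
  proof -
    have "order_density n T \<ge> 0" by (rule order_density_nonneg[OF pos])
    then have "e * order_density n T \<le> 1 * order_density n T" using E1 by (intro mult_right_mono) auto
    then have "1 / t \<le> order_density n T" using t1 by linarith
    then show ?thesis using mult_left_mono[of "1 / t" "order_density n T" "e * K0"] e_pos K0_pos by simp
  qed
  finally have "(\<Sum>i<n. item_cost i (T' i)) \<le> (1 + e) * (\<Sum>i<n. item_cost i (T i)) + e * (K0 * order_density n T)"
    by simp
  moreover have "K0 * order_density n T' \<le> K0 * order_density n T + e * (K0 * order_density n T)"
  proof -
    have "order_density n T' \<le> order_density n T + e * order_density n T" using dens t1 by linarith
    then have "K0 * order_density n T' \<le> K0 * (order_density n T + e * order_density n T)"
      using K0_pos by (intro mult_left_mono) auto
    also have "\<dots> = K0 * order_density n T + e * (K0 * order_density n T)"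
      by (simp add: algebra_simps)
    finally show ?thesis .
  qed
  moreover have "e * (\<Sum>i<n. item_cost i (T i)) \<ge> 0"
    using pos e_pos by (intro mult_nonneg_nonneg sum_nonneg) (auto simp: item_cost_pos less_imp_le)
  moreover have "cost I T = K0 * order_density n T + (\<Sum>i<n. item_cost i (T i))"
    "cost I T' = K0 * order_density n T' + (\<Sum>i<n. item_cost i (T' i))"
    by (intro cost_eq pos pos'; assumption)+
  ultimately have cost: "cost I T' \<le> (1 + 2 * e) * cost I T"
    by (simp only: distrib_left distrib_right mult_1_left)
  have "(\<Sum>i<n. alpha I i d / T' i) \<le> beta I d" if d: "d < D" for d
  proof -
    have "(\<Sum>i<n. alpha I i d / T' i) \<le> (\<Sum>i<n. alpha I i d / T i)"
      using alpha_nonneg[OF _ d] pos by (intro sum_mono divide_left_mono) (auto simp: T'_def less_max_iff_disj)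
    then show ?thesis using sum[OF d] by simp
  qed
  moreover have "T' j = t" using tj by (simp add: T'_def)
  moreover have "T' i \<ge> t" for i by (simp add: T'_def)
  ultimately show ?thesis using that[of T'] cost by (simp add: t_def)
qed

lemma cost_nonneg:
  assumes "\<And>i. i < n \<Longrightarrow> T i > 0"
  shows "cost I T \<ge> 0"
proof -
  have "order_density n T \<ge> 0" by (rule order_density_nonneg[OF assms])
  moreover have "cost I T = K0 * order_density n T + (\<Sum>i<n. item_cost i (T i))"
    by (rule cost_eq[OF assms])
  moreover have "(\<Sum>i<n. item_cost i (T i)) \<ge> 0"
    using assms by (intro sum_nonneg) (simp add: item_cost_pos less_imp_le)
  ultimately show ?thesis using K0_pos by simp
qed

lemma normalize_shortest:
  assumes "feasible I T"
  obtains T' j where "\<And>i. i < n \<Longrightarrow> T' i > 0" "j < n" "\<And>i. i < n \<Longrightarrow> T' j \<le> T' i"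
    "base / (n * E ^ 2) \<le> T' j" "T' j \<le> n * E * base"
    "\<And>d. d < D \<Longrightarrow> (\<Sum>i<n. alpha I i d / T' i) \<le> (1 + e) * beta I d"
    "cost I T' \<le> (1 + 2 * e) * cost I T"
proof -
  have pos: "T i > 0" if "i < n" for i using assms that by (simp add: feasible_def)
  have sum: "(\<Sum>i<n. alpha I i d / T i) \<le> beta I d" if "d < D" for d
    using assms that by (simp add: feasible_def)
  have cost0: "cost I T \<ge> 0" by (rule cost_nonneg[OF pos])
  have ecost: "e * cost I T \<ge> 0" using cost0 e_pos by (intro mult_nonneg_nonneg) auto
  have ebeta: "e * beta I d \<ge> 0" if "d < D" for d
    using beta_pos[OF that] e_pos by (intro mult_nonneg_nonneg) auto
  have n1: "real n \<ge> 1" and E1: "real E \<ge> 1" using n_pos E_pos by auto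
  have a: "base / (n * E ^ 2) \<le> base / (n * E)"
    using n1 E1 base_pos by (intro divide_left_mono) (auto simp: power2_eq_square)
  have nE: "1 * 1 \<le> real n * real E" using n1 E1 by (intro mult_mono) auto
  have b: "base / (n * E) \<le> base" using nE base_pos by (simp add: divide_le_eq)
  have c: "base \<le> n * E * base" using mult_right_mono[OF nE, of base] base_pos by simp
  \<comment> \<open>In the last case nothing changes: no period is too short and one of them is at
    most \<open>n E base\<close>, so the minimal one lies in the window.\<close>
  consider (long) "\<And>i. i < n \<Longrightarrow> T i > n * E * base"
    | (short) j where "j < n" "T j < base / (n * E ^ 2)"
    | (good) i where "i < n" "T i \<le> n * E * base" "\<And>j. j < n \<Longrightarrow> T j \<ge> base / (n * E ^ 2)"
    by (meson not_le)
  then show ?thesis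
  proof cases
    case long
    obtain T' where T': "\<And>i. i < n \<Longrightarrow> T' i \<ge> n * E * base" "\<exists>i<n. T' i = n * E * base"
      "\<And>d. d < D \<Longrightarrow> (\<Sum>i<n. alpha I i d / T' i) \<le> (1 + e) * beta I d"
      "cost I T' \<le> (1 + e) * cost I T"
      by (rule bound_shortest_above[OF pos sum long]) (assumption | (rule that, assumption+))+
    obtain j where j: "j < n" "T' j = n * E * base" using T'(2) by blast
    show ?thesis
    proof (rule that[of T' j])
      show "T' i > 0" if "i < n" for i using T'(1)[OF that] c base_pos by linarith
      show "cost I T' \<le> (1 + 2 * e) * cost I T"
        using T'(4) ecost by (simp only: distrib_right mult.assoc)
      show "base / (n * E ^ 2) \<le> T' j" using a b c j(2) by linarith
    qed (use T' j in auto)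
  next
    case short
    obtain T' where T': "\<And>i. i < n \<Longrightarrow> T' i \<ge> base / (n * E)" "T' j = base / (n * E)"
      "\<And>d. d < D \<Longrightarrow> (\<Sum>i<n. alpha I i d / T' i) \<le> beta I d"
      "cost I T' \<le> (1 + 2 * e) * cost I T"
      by (rule bound_shortest_below[OF pos sum short]) (assumption | (rule that, assumption+))+
    show ?thesis
    proof (rule that[of T' j])
      have "base / (n * E) > 0" using base_pos n_pos E_pos by simp
      then show "T' i > 0" if "i < n" for i using T'(1)[OF that] by linarith
      show "(\<Sum>i<n. alpha I i d / T' i) \<le> (1 + e) * beta I d" if "d < D" for d
        using T'(3)[OF that] ebeta[OF that] by (simp only: distrib_right mult_1_left)
    qed (use T' short a b c in auto)
  next
    case good
    have "Min (T ` {..<n}) \<in> T ` {..<n}" using n_pos by (intro Min_in) auto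
    then obtain j where j: "j < n" "T j = Min (T ` {..<n})" by auto
    have jmin: "T j \<le> T i" if "i < n" for i unfolding j(2) using that by (intro Min_le) auto
    show ?thesis
    proof (rule that[of T j])
      show "(\<Sum>i<n. alpha I i d / T i) \<le> (1 + e) * beta I d" if "d < D" for d
        using sum[OF that] ebeta[OF that] by (simp only: distrib_right mult_1_left)
      show "cost I T \<le> (1 + 2 * e) * cost I T"
        using ecost by (simp only: distrib_right mult_1_left mult.assoc)
      show "base / (n * E ^ 2) \<le> T j" by (rule good(3)[OF j(1)])
      show "T i > 0" if "i < n" for i by (rule pos[OF that])
      show "T j \<le> T i" if "i < n" for i by (rule jmin[OF that])
      show "T j \<le> n * E * base" using jmin[OF good(1)] good(2) by linarith
    qed (rule j(1))
  qed
qed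

section \<open>Finite parameters and the admissible periods of a commodity\<close>

definition buckets :: nat where "buckets = E ^ 2"

text \<open>Makes the loss \<open>m\<^sup>2 / (\<Psi> r)\<close> of \<open>density_transfer\<close>
  equal to \<open>e / r\<close> for \<open>m = buckets + 1\<close> periods.\<close>

definition coeff_bound :: nat where "coeff_bound = E * (buckets + 1) ^ 2"

text \<open>The bound \<open>N ^ m\<close> on the common denominator in
  \<open>simultaneous_rounding\<close>, for \<open>N = 2 * coeff_bound\<close> and
  \<open>m = buckets + 1\<close>.\<close>

definition denom_bound :: nat where "denom_bound = (2 * coeff_bound) ^ (buckets + 1)"

text \<open>Exceeds the numerators, which are at most \<open>q * E\<close>, as well as the grid
  index, which is at most \<open>2 n\<^sup>2 E\<^sup>4\<close>. So one base serves for all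
  enumerated integers.\<close>

definition digit_base :: nat where "digit_base = 4 * n ^ 2 * E ^ 4 * denom_bound"

definition choices :: nat where "choices = buckets + n * E + n * E ^ 2 + 1"

text \<open>Start of the grid for long periods. From \<open>eoq i\<close> on the item cost
  increases; \<open>bottleneck i\<close> makes the resource share at the far end of the grid
  negligible; \<open>n E B\<close> limits the joint cost of \<open>n\<close> long periods to
  \<open>e K0 / B\<close>.\<close>

definition personal :: "real \<Rightarrow> nat \<Rightarrow> real" where
  "personal B i = max (max (eoq i) (bottleneck i)) (real (n * E) * B)"

text \<open>\<open>A buckets\<close> is the common denominator \<open>q\<close>. The
  \<open>+ 1\<close> in the second range lets the multiples start at \<open>B\<close>
  itself.\<close>

definition choice_value :: "(nat \<Rightarrow> nat) \<Rightarrow> real \<Rightarrow> nat \<Rightarrow> nat \<Rightarrow> real" where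
  "choice_value A B i c =
     (if c < buckets then A c * B / A buckets
      else if c < buckets + n * E then real (c - buckets + 1) * B
      else personal B i * (1 + real (c - (buckets + n * E)) / E))"

text \<open>Rounding up within the range to which the period belongs saves resources and costs a
  factor of at most \<open>1 + 6 e\<close>. The additive slack \<open>e * beta I d / n\<close> is
  for the single case of rounding down, beyond the end of the personal grid.\<close>

lemma item_choice:
  fixes B t0 :: real
  assumes i: "i < n" and t: "t0 > 0" "t0 \<le> t" and B: "t0 \<le> B" "B \<le> (1 + 2 * e) * t0"
    and bot: "bottleneck i \<le> (1 + e) * t"
    and short: "t \<le> E * t0 \<Longrightarrow>
      \<exists>l<buckets. t \<le> A l * B / A buckets \<and> A l * B / A buckets \<le> (1 + 6 * e) * t"
  shows "\<exists>c<choices. item_cost i (choice_value A B i c) \<le> (1 + 6 * e) * item_cost i t \<and>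
    choice_value A B i c > 0 \<and>
    (\<forall>d<D. alpha I i d / choice_value A B i c \<le> alpha I i d / t + e * beta I d / n)"
proof -
  have tpos: "t > 0" using t by linarith
  have ee: "e * e \<le> 1 / 4 * e" using e_le e_pos by (intro mult_right_mono) auto
  have n1: "real n \<ge> 1" and E1: "real E \<ge> 1" using n_pos E_pos by auto
  have eb: "e * beta I d / n \<ge> 0" if "d < D" for d
    using beta_pos[OF that] e_pos by simp
  have costt: "item_cost i t > 0" by (rule item_cost_pos[OF i tpos])
  have usage: "alpha I i d / t' \<le> alpha I i d / t + e * beta I d / n"
    if "t \<le> t'" "d < D" for t' d
  proof -
    have "alpha I i d / t' \<le> alpha I i d / t"
      using that tpos alpha_nonneg[OF i that(2)] by (intro divide_left_mono) auto
    then show ?thesis using eb[OF that(2)] by linarith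
  qed
  have fin: ?thesis if "c < choices" "choice_value A B i c = t'" "t \<le> t'" "t' \<le> (1 + 6 * e) * t" for c t'
  proof (intro exI[of _ c] conjI allI impI)
    show "item_cost i (choice_value A B i c) \<le> (1 + 6 * e) * item_cost i t"
      unfolding that(2) using e_pos by (intro item_cost_le_stretch[OF i tpos that(3,4)]) simp
  qed (use that usage tpos in auto)
  consider (1) "t \<le> E * t0" | (2) "E * t0 < t" "t \<le> n * E * t0" | (3) "n * E * t0 < t" by linarith
  then show ?thesis
  proof cases
    case 1
    obtain l where l: "l < buckets" "t \<le> A l * B / A buckets" "real (A l) * B / A buckets \<le> (1 + 6 * e) * t"
      using short[OF 1] by blast
    show ?thesis
      by (rule fin[of l, OF _ _ l(2,3)]) (use l(1) in \<open>simp_all add: choices_def choice_value_def\<close>)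
  next
    case 2
    define k where "k = nat \<lceil>t / B\<rceil>"
    have Bpos: "B > 0" using t B by linarith
    have tB: "t / B > 0" using tpos Bpos by simp
    have k1: "t / B \<le> real k" "real k < t / B + 1" unfolding k_def using tB by linarith+
    have kpos: "k > 0" using k1(1) tB by simp
    have "t / B \<le> t / t0" using t B tpos by (intro divide_left_mono) auto
    also have "\<dots> \<le> real (n * E)" using 2 t by (simp add: field_simps)
    finally have "\<lceil>t / B\<rceil> \<le> int (n * E)" by (subst ceiling_le_iff) (simp only: of_int_of_nat_eq)
    then have kle: "k \<le> n * E" unfolding k_def by (simp only: nat_le_iff)
    obtain k' where k': "k = Suc k'" using kpos by (cases k) auto
    have v: "choice_value A B i (buckets + k') = real k * B"
      using kle unfolding k' by (simp add: choice_value_def)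
    show ?thesis
    proof (rule fin[OF _ v])
      show "buckets + k' < choices" using kle k' by (simp add: choices_def)
      show "t \<le> real k * B" using k1(1) Bpos by (simp add: field_simps)
      have "real k * B \<le> t + B" using k1(2) Bpos by (simp add: field_simps)
      also have "B \<le> (1 + 2 * e) * (t / E)"
      proof -
        have "t0 \<le> t / E" using 2 E_pos by (simp add: field_simps)
        then have "(1 + 2 * e) * t0 \<le> (1 + 2 * e) * (t / E)" using e_pos by (intro mult_left_mono) auto
        then show ?thesis using B by linarith
      qed
      also have "t + (1 + 2 * e) * (t / E) = (1 + e + 2 * (e * e)) * t"
        using E_pos by (simp add: field_simps)
      also have "\<dots> \<le> (1 + 6 * e) * t"
        using ee e_pos tpos by (intro mult_right_mono) linarith+
      finally show "real k * B \<le> (1 + 6 * e) * t" by simp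
    qed
  next
    case 3
    let ?v = "personal B i"
    have nEB: "n * E * B \<le> (1 + 2 * e) * t"
    proof -
      have "n * E * B \<le> n * E * ((1 + 2 * e) * t0)" using B by (intro mult_left_mono) auto
      also have "\<dots> = (1 + 2 * e) * (n * E * t0)" by (simp add: algebra_simps)
      also have "\<dots> \<le> (1 + 2 * e) * t" using 3 e_pos by (intro mult_left_mono) auto
      finally show ?thesis .
    qed
    have vpos: "?v > 0" unfolding personal_def using eoq_pos[OF i] by simp
    have val: "choice_value A B i (buckets + n * E + k) = ?v * (1 + real k / E)" for k
      by (simp add: choice_value_def)
    show ?thesis
    proof (cases "t \<le> ?v")
      case True
      \<comment> \<open>If \<open>eoq i\<close> attains the maximum, the start of the grid is
        optimal even when it lies far above \<open>t\<close>. Each of the other two terms is at most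
        \<open>(1 + 2 e) t\<close>.\<close>
      have "item_cost i ?v \<le> (1 + 6 * e) * item_cost i t"
      proof (cases "?v = eoq i")
        case True
        have "item_cost i ?v \<le> item_cost i t" unfolding True by (rule item_cost_ge_eoq[OF i tpos])
        moreover have "e * item_cost i t \<ge> 0" using costt e_pos by (intro mult_nonneg_nonneg) auto
        ultimately show ?thesis by (simp only: distrib_right mult_1_left mult.assoc)
      next
        case False
        then have "?v = bottleneck i \<or> ?v = n * E * B" unfolding personal_def by linarith
        moreover have "(1 + e) * t \<le> (1 + 6 * e) * t" "(1 + 2 * e) * t \<le> (1 + 6 * e) * t"
          using e_pos tpos by (intro mult_right_mono; linarith)+
        ultimately have "?v \<le> (1 + 6 * e) * t" using bot nEB by linarith
        then show ?thesis using e_pos by (intro item_cost_le_stretch[OF i tpos True]) auto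
      qed
      then show ?thesis
        using usage[OF True] val[of 0] vpos
        by (intro exI[of _ "buckets + n * E"]) (auto simp: choices_def)
    next
      case False
      then have vt: "?v < t" by simp
      show ?thesis
      proof (cases "t \<le> ?v * (1 + n * E)")
        case True
        define k where "k = nat \<lceil>(t / ?v - 1) * E\<rceil>"
        have "t / ?v \<ge> 1" using vt vpos by simp
        then have pos: "(t / ?v - 1) * E \<ge> 0" by simp
        have k1: "(t / ?v - 1) * E \<le> real k" "real k < (t / ?v - 1) * E + 1"
          unfolding k_def using pos by linarith+
        have "t / ?v - 1 \<le> n * E" using True vpos by (simp add: field_simps)
        then have "(t / ?v - 1) * E \<le> real n * real E * real E" using E_pos by simp
        also have "\<dots> = real (n * E ^ 2)" by (simp add: power2_eq_square)
        finally have "\<lceil>(t / ?v - 1) * E\<rceil> \<le> int (n * E ^ 2)" by (subst ceiling_le_iff) (simp only: of_int_of_nat_eq)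
        then have kle: "k \<le> n * E ^ 2" unfolding k_def by (simp only: nat_le_iff)
        show ?thesis
        proof (rule fin[OF _ val])
          show "buckets + n * E + k < choices" using kle by (simp add: choices_def)
          have "t / ?v \<le> 1 + real k / E" using k1(1) E_pos by (simp add: field_simps)
          then show "t \<le> ?v * (1 + real k / E)" using vpos by (simp add: field_simps)
          have "real k / E \<le> (t / ?v - 1) + e" using k1(2) E_pos by (simp add: field_simps)
          then have "?v * (1 + real k / E) \<le> ?v * (t / ?v + e)" using vpos by (intro mult_left_mono) auto
          also have "\<dots> = t + e * ?v" using vpos by (simp add: field_simps)
          also have "\<dots> \<le> t + e * t" using vt e_pos by (intro add_left_mono mult_left_mono) auto
          also have "\<dots> \<le> (1 + 6 * e) * t"
          proof -
            have "e * t \<ge> 0" using e_pos tpos by (intro mult_nonneg_nonneg) auto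
            then show ?thesis by (simp only: distrib_right mult_1_left mult.assoc)
          qed
          finally show "?v * (1 + real k / E) \<le> (1 + 6 * e) * t" .
        qed
      next
        case False
        \<comment> \<open>The end of the grid. Shortening \<open>t\<close> to it cannot increase the
          item cost, both being above \<open>eoq i\<close>, and even there the commodity uses at
          most an \<open>e / n\<close> share of each capacity.\<close>
        define t' where "t' = ?v * (1 + n * E)"
        have t't: "t' < t" using False by (simp add: t'_def)
        have vt': "?v \<le> t'" unfolding t'_def using vpos by (simp add: algebra_simps)
        have t'pos: "t' > 0" using vpos vt' by linarith
        have "real (n * E ^ 2) / E = n * E" using E_pos by (simp add: power2_eq_square)
        then have val': "choice_value A B i (buckets + n * E + n * E ^ 2) = t'"
          unfolding val t'_def by simp
        have "eoq i \<le> t'" using vt' unfolding personal_def by simp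
        then have "item_cost i t' \<le> item_cost i t" using t't by (intro item_cost_mono_above_eoq[OF i]) auto
        moreover have "e * item_cost i t \<ge> 0" using costt e_pos by (intro mult_nonneg_nonneg) auto
        ultimately have ic: "item_cost i t' \<le> (1 + 6 * e) * item_cost i t"
          by (simp only: distrib_right mult_1_left mult.assoc)
        have us: "alpha I i d / t' \<le> alpha I i d / t + e * beta I d / n" if d: "d < D" for d
        proof -
          have "alpha I i d * (n * E) \<le> bottleneck i * beta I d * (n * E)"
            using alpha_le_bottleneck[OF d, of i] by (intro mult_right_mono) auto
          also have "\<dots> \<le> ?v * beta I d * (1 + n * E)"
            using beta_pos[OF d] vpos bottleneck_nonneg[of i]
            by (intro mult_mono mult_right_mono) (auto simp: personal_def)
          also have "\<dots> = t' * beta I d" by (simp add: t'_def)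
          finally have "alpha I i d / t' \<le> e * beta I d / n"
            using t'pos n_pos E_pos by (simp add: field_simps)
          moreover have "alpha I i d / t \<ge> 0" using alpha_nonneg[OF i d] tpos by simp
          ultimately show ?thesis by linarith
        qed
        show ?thesis
          using val' ic us t'pos
          by (intro exI[of _ "buckets + n * E + n * E ^ 2"]) (auto simp: choices_def)
      qed
    qed
  qed
qed

section \<open>From a feasible policy to a structured one\<close>

definition grid_base :: "nat \<Rightarrow> real" where
  "grid_base k = base * real k / (real n * real E ^ 3)"

text \<open>The cost without the separate orders of long periods. Multiples of \<open>B\<close> are
  free because index \<open>buckets\<close> contributes the progression of \<open>B\<close>
  itself.\<close>

definition estimate :: "(nat \<Rightarrow> nat) \<Rightarrow> real \<Rightarrow> (nat \<Rightarrow> nat) \<Rightarrow> real" where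
  "estimate A B c = K0 * order_density (buckets + 1) (\<lambda>l. real (A l) * (B / A buckets))
     + (\<Sum>i<n. item_cost i (choice_value A B i (c i)))"

lemma E_real_ge: "real E \<ge> 4" using E_ge by simp

text \<open>Buckets have width \<open>t0 / E\<close>, so the maximum of a bucket exceeds its members
  by at most \<open>e t0\<close>, which is at most an \<open>e\<close> fraction of them. An empty
  bucket receives \<open>t0\<close>, a period of the policy, so that no order is added.\<close>

lemma bucket_representatives:
  fixes T :: "nat \<Rightarrow> real"
  assumes pos: "\<And>i. i < n \<Longrightarrow> T i > 0" and j: "j < n" and min: "\<And>i. i < n \<Longrightarrow> T j \<le> T i"
  obtains R :: "nat \<Rightarrow> real" where "\<And>l. l < buckets \<Longrightarrow> R l \<in> T ` {..<n}" "R buckets = T j"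
    "\<And>l. l \<le> buckets \<Longrightarrow> T j \<le> R l \<and> R l \<le> E * T j"
    "\<And>i. i < n \<Longrightarrow> T i \<le> E * T j \<Longrightarrow> \<exists>l<buckets. T i \<le> R l \<and> R l \<le> (1 + e) * T i"
proof -
  define t0 where "t0 = T j"
  have t0: "t0 > 0" using pos[OF j] by (simp add: t0_def)
  define bucket where "bucket i = nat \<lfloor>(T i - t0) * E / t0\<rfloor>" for i
  define S where "S l = {i. i < n \<and> T i \<le> E * t0 \<and> bucket i = l}" for l
  define R where "R l = (if l < buckets \<and> S l \<noteq> {} then Max (T ` S l) else t0)" for l
  have finS: "finite (S l)" for l by (simp add: S_def)
  have Et0: "t0 \<le> E * t0" using t0 E_real_ge by simp
  have R_in: "R l \<in> T ` S l" if "l < buckets" "S l \<noteq> {}" for l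
    using Max_in[of "T ` S l"] finS that by (simp add: R_def)
  have R_cases: "R l = t0 \<or> (\<exists>i<n. R l = T i \<and> T i \<le> E * t0)" for l
  proof (cases "l < buckets \<and> S l \<noteq> {}")
    case True
    then show ?thesis using R_in[of l] by (auto simp: S_def)
  qed (auto simp: R_def)
  have near: "T i * 1 \<le> T i' + e * t0" if "i \<in> S l" "i' \<in> S l" for i i' l
  proof -
    have ge: "(T k - t0) * E / t0 \<ge> 0" if "k \<in> S l" for k
      using min[of k] that t0 by (simp add: S_def t0_def)
    have "nat \<lfloor>(T i - t0) * E / t0\<rfloor> = nat \<lfloor>(T i' - t0) * E / t0\<rfloor>"
      using that by (simp add: S_def bucket_def)
    then have "(T i - t0) * E / t0 \<le> (T i' - t0) * E / t0 + 1" using ge[OF that(1)] ge[OF that(2)] by linarith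
    then have "(T i - t0) * E \<le> (T i' - t0) * E + t0" using t0 by (simp add: field_simps)
    then show ?thesis using E_pos by (simp add: field_simps)
  qed
  show ?thesis
  proof (rule that[of R])
    show "R l \<in> T ` {..<n}" for l using R_cases[of l] j by (auto simp: t0_def)
    show "R buckets = T j" by (simp add: R_def t0_def)
    show "T j \<le> R l \<and> R l \<le> E * T j" for l
      using R_cases[of l] min Et0 by (auto simp: t0_def)
    fix i assume i: "i < n" "T i \<le> E * T j"
    have iS: "i \<in> S (bucket i)" using i by (simp add: S_def t0_def)
    have ti: "t0 \<le> T i" using min[OF i(1)] by (simp add: t0_def)
    \<comment> \<open>The last bucket index is at most \<open>E\<^sup>2 - E\<close>, hence below
      \<open>buckets\<close>.\<close>
    have "(T i - t0) * E / t0 \<le> (E * t0 - t0) * E / t0"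
      using i(2) t0 by (intro divide_right_mono mult_right_mono) (auto simp: t0_def)
    also have "\<dots> = real E * real E - real E" using t0 by (simp add: field_simps)
    also have "\<dots> < real buckets" using E_pos by (simp add: buckets_def power2_eq_square)
    finally have "(T i - t0) * E / t0 < real buckets" .
    moreover have "(T i - t0) * E / t0 \<ge> 0" using ti t0 by simp
    ultimately have lb: "bucket i < buckets" unfolding bucket_def by linarith
    have ne: "S (bucket i) \<noteq> {}" using iS by blast
    have "T i \<le> R (bucket i)"
      using lb ne iS finS by (simp add: R_def)
    moreover have "R (bucket i) \<le> (1 + e) * T i"
    proof -
      obtain i' where i': "i' \<in> S (bucket i)" "R (bucket i) = T i'" using R_in[OF lb ne] by blast
      have "T i' \<le> T i + e * t0" using near[OF i'(1) iS] by simp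
      also have "e * t0 \<le> e * T i" using ti e_pos by (intro mult_left_mono) auto
      finally show ?thesis unfolding i'(2) by (simp only: distrib_right mult_1_left)
    qed
    ultimately show "\<exists>l<buckets. T i \<le> R l \<and> R l \<le> (1 + e) * T i" using lb by blast
  qed
qed

lemma coeff_bound_pos: "coeff_bound > 0" using E_pos by (simp add: coeff_bound_def)

lemma denom_bound_pos: "denom_bound > 0" using coeff_bound_pos by (simp add: denom_bound_def)

text \<open>The step of the grid is \<open>e\<close> times the lower bound on the shortest period,
  so rounding \<open>x t\<close> up costs at most \<open>e t\<close>. The factor \<open>x\<close>
  leaves room for numerators that were rounded down.\<close>

lemma grid_point:
  assumes t: "base / (n * E ^ 2) \<le> t" "t \<le> n * E * base"
    and x: "1 \<le> x" "x \<le> 1 + e"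
  obtains k where "k > 0" "k < digit_base" "x * t \<le> grid_base k" "grid_base k \<le> (x + e) * t"
proof -
  define g where "g = base / (real n * real E ^ 3)"
  have n1: "real n \<ge> 1" and E1: "real E \<ge> 1" using n_pos E_pos by auto
  have g: "g > 0" unfolding g_def using base_pos n_pos E_pos by simp
  have ge: "g = e * (base / (n * E ^ 2))"
    unfolding g_def by (simp add: power2_eq_square power3_eq_cube)
  have gt: "g \<le> e * t" unfolding ge using t(1) e_pos by (intro mult_left_mono) auto
  have tpos: "t > 0" using g gt e_pos by (metis less_le_trans zero_less_mult_pos)
  define k where "k = nat \<lceil>x * t / g\<rceil>"
  have xtg: "x * t / g > 0" using x tpos g by simp
  have k1: "x * t / g \<le> real k" "real k < x * t / g + 1" unfolding k_def using xtg by linarith+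
  have gk: "grid_base k = real k * g" by (simp add: grid_base_def g_def)
  have 1: "x * t \<le> grid_base k" unfolding gk using k1(1) g by (simp add: field_simps)
  have "grid_base k \<le> x * t + g" unfolding gk using k1(2) g by (simp add: field_simps)
  also have "\<dots> \<le> x * t + e * t" using gt by simp
  finally have 2: "grid_base k \<le> (x + e) * t" by (simp only: distrib_right)
  have "x * t / g \<le> 2 * (n * E * base) / g"
    using x t(2) g e_le tpos by (intro divide_right_mono mult_mono) auto
  also have "\<dots> = 2 * real n ^ 2 * real E ^ 4"
    unfolding g_def using base_pos n_pos E_pos by (simp add: field_simps power2_eq_square eval_nat_numeral)
  finally have "real k < 2 * real n ^ 2 * real E ^ 4 + 1" using k1(2) by linarith
  also have "\<dots> = real (2 * n ^ 2 * E ^ 4 + 1)" by simp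
  finally have "k < 2 * n ^ 2 * E ^ 4 + 1" by (simp only: of_nat_less_iff)
  also have "\<dots> \<le> 4 * n ^ 2 * E ^ 4 * 1" using n_pos E_pos by (simp add: Suc_le_eq)
  also have "\<dots> \<le> digit_base"
    unfolding digit_base_def using denom_bound_pos by (intro mult_left_mono) auto
  finally have 3: "k < digit_base" .
  have "k > 0" using k1(1) xtg by (metis less_le_trans of_nat_0_less_iff)
  then show ?thesis using that 1 2 3 by blast
qed

lemma structured_policy:
  assumes "feasible I T"
  obtains A k c where
    "\<And>l. l \<le> buckets \<Longrightarrow> 0 < A l \<and> A l < digit_base" "0 < k" "k < digit_base"
    "\<And>i. i < n \<Longrightarrow> c i < choices"
    "\<And>i. i < n \<Longrightarrow> choice_value A (grid_base k) i (c i) > 0"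
    "\<And>d. d < D \<Longrightarrow> (\<Sum>i<n. alpha I i d / choice_value A (grid_base k) i (c i)) \<le> (1 + 2 * e) * beta I d"
    "estimate A (grid_base k) c \<le> (1 + 6 * e) * (1 + 2 * e) * cost I T"
proof -
  obtain T1 j where T1: "\<And>i. i < n \<Longrightarrow> T1 i > 0" "j < n" "\<And>i. i < n \<Longrightarrow> T1 j \<le> T1 i"
    "base / (n * E ^ 2) \<le> T1 j" "T1 j \<le> n * E * base"
    "\<And>d. d < D \<Longrightarrow> (\<Sum>i<n. alpha I i d / T1 i) \<le> (1 + e) * beta I d"
    "cost I T1 \<le> (1 + 2 * e) * cost I T"
    by (rule normalize_shortest[OF assms]) (rule that, assumption+)
  define t0 where "t0 = T1 j"
  have t0: "t0 > 0" using T1(1,2) by (simp add: t0_def)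
  obtain R where R: "\<And>l. l < buckets \<Longrightarrow> R l \<in> T1 ` {..<n}" "R buckets = T1 j"
    "\<And>l. l \<le> buckets \<Longrightarrow> T1 j \<le> R l \<and> R l \<le> E * T1 j"
    "\<And>i. i < n \<Longrightarrow> T1 i \<le> E * T1 j \<Longrightarrow> \<exists>l<buckets. T1 i \<le> R l \<and> R l \<le> (1 + e) * T1 i"
    by (rule bucket_representatives[of T1 j, OF T1(1-3)]) (assumption | (rule that, assumption+))+
  define N where "N = 2 * coeff_bound"
  have N0: "N > 0" using coeff_bound_pos by (simp add: N_def)
  define \<eta> where "\<eta> = 1 / real N"
  obtain q A where q: "0 < q" "q \<le> N ^ (buckets + 1)"
    and A: "\<And>l. l < buckets + 1 \<Longrightarrow> \<bar>real q * R l / t0 - real (A l)\<bar> < \<eta>"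
      "\<And>l. l < buckets + 1 \<Longrightarrow> A l > 0"
    and rel: "\<And>l l' i j. l < buckets + 1 \<Longrightarrow> l' < buckets + 1 \<Longrightarrow> i \<le> coeff_bound \<Longrightarrow> j \<le> coeff_bound \<Longrightarrow>
      real i * R l = real j * R l' \<Longrightarrow> i * A l = j * A l'"
  proof (rule simultaneous_rounding[of coeff_bound N t0 "buckets + 1" R])
    show "t0 \<le> R l" if "l < buckets + 1" for l using R(3)[of l] that by (simp add: t0_def)
  qed (use coeff_bound_pos t0 that in \<open>auto simp: N_def \<eta>_def\<close>)
  have N2E: "2 * real E \<le> real N"
  proof -
    have "E * 1 \<le> coeff_bound" unfolding coeff_bound_def by (intro mult_left_mono) auto
    then show ?thesis by (simp add: N_def)
  qed
  have \<eta>: "0 < \<eta>" "\<eta> \<le> 1 / 2 * e"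
  proof -
    show "0 < \<eta>" using N0 by (simp add: \<eta>_def)
    have "\<eta> \<le> 1 / (2 * real E)" unfolding \<eta>_def using N2E E_pos N0 by (intro divide_left_mono) auto
    then show "\<eta> \<le> 1 / 2 * e" by simp
  qed
  have eta1: "\<eta> \<le> 1 / 8" using \<eta>(2) e_le by linarith
  \<comment> \<open>\<open>A l\<close> may fall short of \<open>q R l / t0\<close> by a factor
    \<open>1 - \<eta>\<close>. Enlarging \<open>B\<close> by the inverse factor makes every rounded
    period at least the original one, as \<open>density_transfer\<close> and the capacities
    require.\<close>
  define x where "x = 1 / (1 - \<eta>)"
  have x: "1 \<le> x" "x \<le> 1 + e"
  proof -
    show "1 \<le> x" unfolding x_def using \<eta>(1) eta1 by simp
    have "1 \<le> (1 + 2 * \<eta>) * (1 - \<eta>)"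
      using mult_left_mono[of \<eta> "1 / 2" "\<eta>"] \<eta>(1) eta1 by (simp add: algebra_simps)
    then have "x \<le> 1 + 2 * \<eta>" unfolding x_def using eta1 by (simp add: field_simps)
    then show "x \<le> 1 + e" using \<eta>(2) by linarith
  qed
  have t0b: "base / (n * E ^ 2) \<le> t0" "t0 \<le> n * E * base" using T1(4,5) by (simp_all add: t0_def)
  obtain k where k: "k > 0" "k < digit_base" "x * t0 \<le> grid_base k" "grid_base k \<le> (x + e) * t0"
    by (rule grid_point[OF t0b x]) (rule that, assumption+)
  define B where "B = grid_base k"
  have ee: "e * e \<le> 1 / 4 * e" using e_le e_pos by (intro mult_right_mono) auto
  have Bt: "t0 \<le> B"
  proof -
    have "1 * t0 \<le> x * t0" using x(1) t0 by (intro mult_right_mono) auto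
    then show ?thesis using k(3) by (simp add: B_def)
  qed
  have B2: "B \<le> (1 + 2 * e) * t0"
  proof -
    have "(x + e) * t0 \<le> (1 + 2 * e) * t0" using x(2) t0 by (intro mult_right_mono; linarith)
    then show ?thesis using k(4) by (simp add: B_def)
  qed
  have Bpos: "B > 0" using Bt t0 by linarith
  \<comment> \<open>Since \<open>R buckets = t0\<close>, the last numerator approximates the integer
    \<open>q\<close> with error below 1. The denominator is thus itself one of the enumerated
    numerators.\<close>
  have Aq: "A buckets = q"
  proof -
    have "\<bar>real q - real (A buckets)\<bar> < 1"
      using A(1)[of buckets] R(2) t0 eta1 by (simp add: t0_def)
    then show ?thesis by linarith
  qed
  define R' where "R' l = real (A l) * (B / A buckets)" for l
  have q0: "real q > 0" using q by simp
  have R'_bounds: "R l \<le> R' l \<and> R' l \<le> (1 + 4 * e) * R l" if l: "l \<le> buckets" for l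
  proof -
    let ?\<theta> = "real q * R l / t0"
    have Rl: "t0 \<le> R l" using R(3)[OF l] by (simp add: t0_def)
    have "1 \<le> R l / t0" using Rl t0 by simp
    then have "1 * 1 \<le> real q * (R l / t0)" using q by (intro mult_mono) auto
    then have th: "1 \<le> ?\<theta>" by simp
    have "\<bar>?\<theta> - real (A l)\<bar> < \<eta>" using A(1)[of l] l by simp
    then have a: "?\<theta> - \<eta> < real (A l)" "real (A l) < ?\<theta> + \<eta>" unfolding abs_less_iff by linarith+
    have \<eta>\<theta>: "\<eta> \<le> \<eta> * ?\<theta>" using mult_left_mono[OF th, of \<eta>] \<eta>(1) by simp
    have lo: "(1 - \<eta>) * ?\<theta> \<le> real (A l)" using a \<eta>\<theta> unfolding left_diff_distrib mult_1_left by linarith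
    have hi: "real (A l) \<le> (1 + \<eta>) * ?\<theta>" using a \<eta>\<theta> unfolding distrib_right mult_1_left by linarith
    have Bq: "B / q > 0" using Bpos q0 by simp
    have "R l = ((1 - \<eta>) * ?\<theta>) * ((x * t0) / q)"
      unfolding x_def using eta1 q0 t0 by (simp add: field_simps)
    also have "\<dots> \<le> real (A l) * (B / q)"
      using lo k(3) x t0 q0 eta1 th by (intro mult_mono divide_right_mono) (auto simp: B_def)
    finally have 1: "R l \<le> R' l" by (simp add: R'_def Aq)
    have "R' l \<le> ((1 + \<eta>) * ?\<theta>) * (((1 + 2 * e) * t0) / q)"
      unfolding R'_def Aq using hi B2 q0 Bpos th \<eta>(1)
      by (intro mult_mono divide_right_mono) auto
    also have "\<dots> = ((1 + \<eta>) * (1 + 2 * e)) * R l" using q0 t0 by simp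
    also have "\<dots> \<le> (1 + 4 * e) * R l"
    proof (rule mult_right_mono)
      have "(1 + \<eta>) * (1 + 2 * e) \<le> (1 + 1 / 2 * e) * (1 + 2 * e)"
        using \<eta>(2) e_pos by (intro mult_right_mono) auto
      also have "\<dots> = 1 + 5 / 2 * e + e * e"
      proof -
        have "(1 + 1 / 2 * y) * (1 + 2 * y) = 1 + 5 / 2 * y + y * y" for y :: real
          by (simp add: algebra_simps)
        then show ?thesis .
      qed
      also have "\<dots> \<le> 1 + 4 * e" using ee e_pos by linarith
      finally show "(1 + \<eta>) * (1 + 2 * e) \<le> 1 + 4 * e" .
    qed (use Rl t0 in linarith)
    finally show ?thesis using 1 by blast
  qed
  have A_lt: "A l < digit_base" if l: "l \<le> buckets" for l
  proof -
    have "\<bar>real q * R l / t0 - real (A l)\<bar> < \<eta>" using A(1)[of l] l by simp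
    then have "real (A l) \<le> real q * R l / t0 + \<eta>" unfolding abs_less_iff by linarith
    moreover have "real q * R l / t0 \<le> real q * real E"
    proof -
      have "R l \<le> E * t0" using R(3)[OF l] by (simp add: t0_def)
      then have "real q * R l \<le> real q * (E * t0)" by (intro mult_left_mono) auto
      then show ?thesis using t0 by (simp add: field_simps)
    qed
    moreover have "real q * real E = real (q * E)" by simp
    ultimately have "real (A l) < real (q * E) + 1" using eta1 by linarith
    then have "A l < q * E + 1" by linarith
    also have "\<dots> \<le> denom_bound * E + 1" using q(2) by (simp add: denom_bound_def N_def)
    also have "\<dots> \<le> digit_base"
    proof -
      have "E * 1 \<le> E ^ 4" using E_pos self_le_power[of E 4] by simp
      then have le: "2 * (1 * E) \<le> 4 * (n ^ 2 * E ^ 4)" using n_pos by (intro mult_mono) auto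
      have "1 \<le> denom_bound * E" using denom_bound_pos E_pos by (simp add: Suc_le_eq)
      then have "denom_bound * E + 1 \<le> 2 * (1 * E) * denom_bound" by simp
      also have "\<dots> \<le> 4 * (n ^ 2 * E ^ 4) * denom_bound" using le by (intro mult_right_mono) auto
      finally show ?thesis unfolding digit_base_def by (simp only: mult.assoc)
    qed
    finally show ?thesis .
  qed
  have "\<exists>c<choices. item_cost i (choice_value A B i c) \<le> (1 + 6 * e) * item_cost i (T1 i) \<and>
    choice_value A B i c > 0 \<and>
    (\<forall>d<D. alpha I i d / choice_value A B i c \<le> alpha I i d / T1 i + e * beta I d / n)" if i: "i < n" for i
  proof (rule item_choice[OF i t0 _ Bt B2])
    show "t0 \<le> T1 i" using T1(3)[OF i] by (simp add: t0_def)
    show "bottleneck i \<le> (1 + e) * T1 i"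
      using e_pos by (intro bottleneck_le[OF i T1(1) _ T1(6)]) auto
    assume "T1 i \<le> E * t0"
    then obtain l where l: "l < buckets" "T1 i \<le> R l" "R l \<le> (1 + e) * T1 i"
      using R(4)[OF i] by (auto simp: t0_def)
    have b: "R l \<le> R' l" "R' l \<le> (1 + 4 * e) * R l" using R'_bounds[of l] l(1) by auto
    have "R' l \<le> (1 + 4 * e) * ((1 + e) * T1 i)"
      using b(2) mult_left_mono[OF l(3), of "1 + 4 * e"] e_pos by linarith
    also have "\<dots> = (1 + 5 * e + 4 * (e * e)) * T1 i" by (simp add: algebra_simps)
    also have "\<dots> \<le> (1 + 6 * e) * T1 i" using ee T1(1)[OF i] by (intro mult_right_mono) linarith+
    finally have "T1 i \<le> R' l" "R' l \<le> (1 + 6 * e) * T1 i" using l b by linarith+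
    then show "\<exists>l<buckets. T1 i \<le> A l * B / A buckets \<and> A l * B / A buckets \<le> (1 + 6 * e) * T1 i"
      using l(1) by (auto simp: R'_def)
  qed
  then obtain c where c: "\<And>i. i < n \<Longrightarrow> c i < choices"
    "\<And>i. i < n \<Longrightarrow> item_cost i (choice_value A B i (c i)) \<le> (1 + 6 * e) * item_cost i (T1 i)"
    "\<And>i. i < n \<Longrightarrow> choice_value A B i (c i) > 0"
    "\<And>i d. i < n \<Longrightarrow> d < D \<Longrightarrow>
      alpha I i d / choice_value A B i (c i) \<le> alpha I i d / T1 i + e * beta I d / n"
    by metis
  have usage: "(\<Sum>i<n. alpha I i d / choice_value A B i (c i)) \<le> (1 + 2 * e) * beta I d" if d: "d < D" for d
  proof -
    have "(\<Sum>i<n. alpha I i d / choice_value A B i (c i)) \<le> (\<Sum>i<n. alpha I i d / T1 i + e * beta I d / n)"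
      using c(4)[OF _ d] by (intro sum_mono) auto
    also have "\<dots> = (\<Sum>i<n. alpha I i d / T1 i) + e * beta I d" using n_pos by (simp add: sum.distrib)
    also have "\<dots> \<le> (1 + e) * beta I d + e * beta I d" using T1(6)[OF d] by simp
    also have "\<dots> = (1 + 2 * e) * beta I d" by (simp add: algebra_simps)
    finally show ?thesis .
  qed
  have dens: "order_density (buckets + 1) R' \<le> (1 + e) * order_density n T1"
  proof -
    have 1: "order_density (buckets + 1) R' \<le>
        order_density (buckets + 1) R + real (buckets + 1) ^ 2 / (real coeff_bound * t0)"
    proof (rule density_transfer[OF t0])
      fix l assume l: "l < buckets + 1"
      show "t0 \<le> R l" using R(3)[of l] l by (simp add: t0_def)
      show "R l \<le> R' l" using R'_bounds[of l] l by simp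
    next
      fix l l' i j assume a: "l < buckets + 1" "l' < buckets + 1" "i \<le> coeff_bound" "j \<le> coeff_bound"
        "real i * R l = real j * R l'"
      have "real (i * A l) = real (j * A l')" using rel[OF a] by simp
      then have "real (i * A l) * (B / A buckets) = real (j * A l') * (B / A buckets)" by simp
      then show "real i * R' l = real j * R' l'" by (simp add: R'_def mult.assoc)
    qed (rule coeff_bound_pos)
    have 2: "real (buckets + 1) ^ 2 / (real coeff_bound * t0) = e * (1 / t0)"
      using E_pos by (simp add: coeff_bound_def del: of_nat_add)
    have 3: "order_density (buckets + 1) R \<le> order_density n T1"
    proof (rule density_mono[OF _ T1(1)])
      show "0 < R l" if "l < buckets + 1" for l using R(3)[of l] that t0 by (simp add: t0_def)
      have "R l \<in> T1 ` {..<n}" if "l < buckets + 1" for l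
        using R(1)[of l] R(2) T1(2) that by (cases "l = buckets") auto
      then show "(\<Union>l<buckets + 1. progression (R l)) \<subseteq> (\<Union>i<n. progression (T1 i))"
        by fastforce
    qed
    \<comment> \<open>The period \<open>t0\<close> occurs in the policy, and its density pays for
      the loss \<open>e / t0\<close>.\<close>
    have "1 / t0 \<le> order_density n T1" unfolding t0_def by (rule density_ge_inverse[OF T1(1,2)])
    then have "e * (1 / t0) \<le> e * order_density n T1" using e_pos by (intro mult_left_mono) auto
    then show ?thesis using 1 3 unfolding 2 distrib_right mult_1_left by linarith
  qed
  have "K0 * order_density (buckets + 1) R' \<le> (1 + 6 * e) * (K0 * order_density n T1)"
  proof -
    have "order_density n T1 \<ge> 0" by (rule order_density_nonneg[OF T1(1)])
    then have "(1 + e) * order_density n T1 \<le> (1 + 6 * e) * order_density n T1"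
      using e_pos by (intro mult_right_mono; linarith)
    then have "K0 * order_density (buckets + 1) R' \<le> K0 * ((1 + 6 * e) * order_density n T1)"
      using dens K0_pos by (intro mult_left_mono) auto
    then show ?thesis by (simp only: mult.left_commute)
  qed
  moreover have "(\<Sum>i<n. item_cost i (choice_value A B i (c i))) \<le> (1 + 6 * e) * (\<Sum>i<n. item_cost i (T1 i))"
    unfolding sum_distrib_left using c(2) by (intro sum_mono) auto
  moreover have "cost I T1 = K0 * order_density n T1 + (\<Sum>i<n. item_cost i (T1 i))"
    by (rule cost_eq[OF T1(1)])
  ultimately have "estimate A B c \<le> (1 + 6 * e) * cost I T1"
    unfolding estimate_def R'_def[abs_def, symmetric] by (simp only: distrib_left add_mono)
  also have "\<dots> \<le> (1 + 6 * e) * ((1 + 2 * e) * cost I T)"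
    using T1(7) e_pos by (intro mult_left_mono) auto
  finally have "estimate A B c \<le> (1 + 6 * e) * (1 + 2 * e) * cost I T" by simp
  then show ?thesis
    using that[of A k c] A(2) A_lt k(1,2) c usage unfolding B_def by simp
qed

end

section \<open>Candidate policies and rounded resource consumption\<close>

text \<open>The number in base \<open>b\<close> with digits \<open>f\<close>, entry 0 being the most
  significant. It is additive in \<open>f\<close>, so vectors of digits can be summed as single
  integers and recovered as long as no carry occurs.\<close>

primrec horner :: "(nat \<Rightarrow> nat) \<Rightarrow> nat \<Rightarrow> nat \<Rightarrow> nat" where
  "horner f b 0 = 0"
| "horner f b (Suc m) = horner f b m * b + f m"

lemma horner_sum: "(\<Sum>i\<in>S. horner (f i) b m) = horner (\<lambda>d. \<Sum>i\<in>S. f i d) b m"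
  by (induction m) (simp_all add: sum.distrib flip: sum_distrib_right)

lemma horner_less: "(\<And>d. d < m \<Longrightarrow> f d < b) \<Longrightarrow> horner f b m < b ^ m"
proof (induction m)
  case (Suc m)
  then have "horner f b m + 1 \<le> b ^ m" "f m < b" by (simp_all add: Suc_le_eq)
  then have "horner f b m * b + f m < (horner f b m + 1) * b" by simp
  also have "\<dots> \<le> b ^ m * b" using \<open>horner f b m + 1 \<le> b ^ m\<close> by (intro mult_right_mono) simp_all
  finally show ?case by (simp add: mult.commute)
qed simp

lemma horner_inj:
  assumes "\<And>d. d < m \<Longrightarrow> f d < b" "\<And>d. d < m \<Longrightarrow> g d < b" "horner f b m = horner g b m" "d < m"
  shows "f d = g d"
  using assms
proof (induction m)
  case (Suc m)
  have f: "f m < b" and g: "g m < b" using Suc.prems by simp_all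
  have eq: "horner f b m * b + f m = horner g b m * b + g m" using Suc.prems(3) by simp
  have "f m = (horner f b m * b + f m) mod b" using f by simp
  also have "\<dots> = g m" unfolding eq using g by simp
  finally have fm: "f m = g m" .
  have "horner f b m = horner g b m" using eq fm f by simp
  then show ?case using Suc fm by (cases "d = m") auto
qed simp

context instance_with_accuracy
begin

lemma choice_value_cases:
  assumes "c < choices"
  obtains "c < buckets" "choice_value A B i c = A c * B / A buckets"
  | k where "choice_value A B i c = real (Suc k) * B"
  | k where "c \<ge> buckets + n * E" "choice_value A B i c = personal B i * (1 + real k / E)"
proof -
  consider "c < buckets" | "\<not> c < buckets" "c < buckets + n * E" | "buckets + n * E \<le> c" by linarith
  then show ?thesis
  proof cases
    case 1
    then show ?thesis using that(1) by (simp add: choice_value_def)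
  next
    case 2
    then show ?thesis using that(2)[of "c - buckets"] by (simp add: choice_value_def)
  next
    case 3
    then show ?thesis using that(3)[of "c - (buckets + n * E)"] by (simp add: choice_value_def)
  qed
qed

lemma personal_pos: "i < n \<Longrightarrow> personal B i > 0"
  using eoq_pos[of i] by (simp add: personal_def)

lemma personal_ge: "real (n * E) * B \<le> personal B i"
  by (simp add: personal_def)

lemma choice_value_pos:
  assumes "i < n" "B > 0" "\<And>l. l \<le> buckets \<Longrightarrow> A l > 0" "c < choices"
  shows "choice_value A B i c > 0"
  using assms(4)
proof (cases rule: choice_value_cases[of c A B i])
  case 1
  then show ?thesis using assms by simp
next
  case (2 k)
  then show ?thesis using assms by simp
next
  case (3 k)
  show ?thesis using 3 personal_pos[OF assms(1), of B] by (simp add: add_pos_nonneg)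
qed

text \<open>Orders at multiples of \<open>B\<close> belong to the progression of \<open>B\<close>.
  At most \<open>n\<close> long periods contribute at most \<open>1 / (n E B)\<close> each, together
  \<open>e / B\<close>, which is an \<open>e\<close> fraction of a density that includes the
  progression of \<open>B\<close>. Stretching by \<open>x\<close> divides the density by
  \<open>x\<close> and multiplies item costs by at most \<open>x\<close>.\<close>

lemma candidate_cost:
  assumes A: "\<And>l. l \<le> buckets \<Longrightarrow> A l > 0" and B: "B > 0" and c: "\<And>i. i < n \<Longrightarrow> c i < choices"
    and x: "x \<ge> 1"
  shows "cost I (\<lambda>i. x * choice_value A B i (c i)) \<le> x * (1 + e) * estimate A B c"
proof -
  define T where "T i = choice_value A B i (c i)" for i
  define R where "R l = real (A l) * (B / A buckets)" for l
  have Tpos: "T i > 0" if "i < n" for i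
    unfolding T_def using choice_value_pos that A B c by blast
  have Rpos: "R l > 0" if "l < buckets + 1" for l using A[of l] A[of buckets] B that by (simp add: R_def)
  have RB: "R buckets = B" using A[of buckets] by (simp add: R_def)
  define S where "S = {i. i < n \<and> c i \<ge> buckets + n * E}"
  have S: "finite S" "card S \<le> n"
  proof -
    have "S \<subseteq> {..<n}" by (auto simp: S_def)
    then show "finite S" "card S \<le> n" using finite_subset card_mono[of "{..<n}" S] by auto
  qed
  have "order_density n T \<le> order_density (buckets + 1) R + (\<Sum>i\<in>S. 1 / T i)"
  proof (rule density_le_add[OF Tpos Rpos])
    show "(\<Union>i<n. progression (T i)) \<subseteq> (\<Union>l<buckets + 1. progression (R l)) \<union> (\<Union>i\<in>S. progression (T i))"
    proof
      fix y assume "y \<in> (\<Union>i<n. progression (T i))"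
      then obtain i where i: "i < n" "y \<in> progression (T i)" by blast
      show "y \<in> (\<Union>l<buckets + 1. progression (R l)) \<union> (\<Union>i\<in>S. progression (T i))"
        using c[OF i(1)]
      proof (cases rule: choice_value_cases[of "c i" A B i])
        case 1
        then have "T i = R (c i)" by (simp add: T_def R_def)
        moreover have "c i < buckets + 1" using 1 by simp
        ultimately show ?thesis using i(2) by auto
      next
        case (2 k)
        obtain j where "y = real j * T i" using i(2) by (auto simp: progression_def)
        then have "y = real (j * Suc k) * R buckets"
          using 2 by (simp only: T_def RB of_nat_mult mult.assoc)
        then have "y \<in> progression (R buckets)" by (simp only: multiple_in_progression)
        then show ?thesis by auto
      next
        case (3 k)
        then have "i \<in> S" using i(1) by (simp add: S_def)
        then show ?thesis using i(2) by auto
      qed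
    qed
  qed (use S Tpos in \<open>auto simp: S_def\<close>)
  also have "(\<Sum>i\<in>S. 1 / T i) \<le> real (card S) * (1 / (n * E * B))"
  proof (rule sum_bounded_above)
    fix i assume i: "i \<in> S"
    have "personal B i * 1 \<le> T i"
    proof -
      have "T i = personal B i * (1 + real (c i - (buckets + n * E)) / E)"
        using i by (simp add: T_def S_def choice_value_def)
      moreover have "personal B i * 1 \<le> personal B i * (1 + real (c i - (buckets + n * E)) / E)"
        using personal_pos[of i B] i by (intro mult_left_mono) (simp_all add: S_def del: of_nat_diff)
      ultimately show ?thesis by simp
    qed
    then have "real (n * E) * B \<le> T i" using personal_ge[of B i] by linarith
    then show "1 / T i \<le> 1 / (n * E * B)"
      using B n_pos E_pos Tpos[of i] i by (intro divide_left_mono) (auto simp: S_def)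
  qed
  also have "\<dots> \<le> real n * (1 / (n * E * B))" using S B by (intro mult_right_mono) auto
  also have "\<dots> = e * (1 / B)" using n_pos by simp
  also have "\<dots> \<le> e * order_density (buckets + 1) R"
  proof -
    have "1 / R buckets \<le> order_density (buckets + 1) R" by (rule density_ge_inverse[OF Rpos]) auto
    then show ?thesis using e_pos by (intro mult_left_mono) (auto simp: RB)
  qed
  finally have dT: "order_density n T \<le> (1 + e) * order_density (buckets + 1) R"
    unfolding distrib_right mult_1_left by simp
  have dR: "order_density (buckets + 1) R \<ge> 0"
  proof -
    have "1 / R buckets \<le> order_density (buckets + 1) R" by (rule density_ge_inverse[OF Rpos]) auto
    moreover have "1 / R buckets \<ge> 0" using B by (simp add: RB)
    ultimately show ?thesis by linarith
  qed
  have xe: "1 + e \<le> x * (1 + e)" "x \<le> x * (1 + e)"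
  proof -
    have "1 * (1 + e) \<le> x * (1 + e)" using x e_pos by (intro mult_right_mono) auto
    then show "1 + e \<le> x * (1 + e)" by (simp only: mult_1_left)
    have "x * 1 \<le> x * (1 + e)" using x e_pos by (intro mult_left_mono) auto
    then show "x \<le> x * (1 + e)" by (simp only: mult_1_right)
  qed
  have "K0 * order_density n (\<lambda>i. x * T i) \<le> x * (1 + e) * (K0 * order_density (buckets + 1) R)"
  proof -
    have "order_density n (\<lambda>i. x * T i) = order_density n T / x"
      using x by (intro density_scale Tpos) auto
    also have "\<dots> \<le> order_density n T"
      using divide_left_mono[of 1 x "order_density n T"] order_density_nonneg[of T] Tpos x by simp
    also have "\<dots> \<le> (1 + e) * order_density (buckets + 1) R" by (rule dT)
    also have "\<dots> \<le> (x * (1 + e)) * order_density (buckets + 1) R" using dR xe(1) by (intro mult_right_mono)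
    finally have "K0 * order_density n (\<lambda>i. x * T i) \<le> K0 * ((x * (1 + e)) * order_density (buckets + 1) R)"
      using K0_pos by (intro mult_left_mono) auto
    then show ?thesis by (simp only: mult.left_commute)
  qed
  moreover have "(\<Sum>i<n. item_cost i (x * T i)) \<le> x * (1 + e) * (\<Sum>i<n. item_cost i (T i))"
    unfolding sum_distrib_left
  proof (rule sum_mono)
    fix i assume "i \<in> {..<n}"
    then have i: "i < n" by simp
    have "1 * T i \<le> x * T i" using x Tpos[OF i] by (intro mult_right_mono) auto
    then have "item_cost i (x * T i) \<le> x * item_cost i (T i)"
      using x by (intro item_cost_le_stretch[OF i Tpos[OF i]]) auto
    also have "\<dots> \<le> x * (1 + e) * item_cost i (T i)"
      using xe(2) item_cost_pos[OF i Tpos[OF i]] by (intro mult_right_mono) auto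
    finally show "item_cost i (x * T i) \<le> x * (1 + e) * item_cost i (T i)" .
  qed
  moreover have "cost I (\<lambda>i. x * T i) = K0 * order_density n (\<lambda>i. x * T i) + (\<Sum>i<n. item_cost i (x * T i))"
    using x Tpos by (intro cost_eq) (simp add: mult_pos_pos)
  moreover have "estimate A B c = K0 * order_density (buckets + 1) R + (\<Sum>i<n. item_cost i (T i))"
    by (simp add: estimate_def R_def[abs_def] T_def)
  ultimately show ?thesis
    unfolding T_def[symmetric] by (simp only: distrib_left add_mono)
qed

lemma estimate_period:
  assumes A: "\<And>l. l \<le> buckets \<Longrightarrow> A l > 0 \<and> A l dvd P" and P: "P > 0" and B: "B > 0"
  shows "estimate A B c = K0 * (real (period_count (buckets + 1) A P) / (real P * (B / A buckets)))
     + (\<Sum>i<n. item_cost i (choice_value A B i (c i)))"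
proof -
  have "order_density (buckets + 1) (\<lambda>l. real (A l) * (B / A buckets)) =
    real (period_count (buckets + 1) A P) / (real P * (B / A buckets))"
    using A A[of buckets] P B by (intro density_integral) auto
  then show ?thesis by (simp only: estimate_def)
qed

section \<open>Rounded resource consumption as one integer\<close>

definition cap :: nat where "cap = 2 * n * E"

text \<open>Digit sums over all commodities are at most \<open>n * cap\<close>, so adding keys never
  produces a carry.\<close>

definition key_base :: nat where "key_base = n * cap + 1"

definition key_count :: nat where "key_count = key_base ^ D"

text \<open>The consumption in units of \<open>beta / (n E)\<close>, rounded down and cut off at
  \<open>cap\<close>, which stands for twice the capacity. It is a count because the machine has no
  rounding, whereas a loop over \<open>x\<close> computes exactly this number.\<close>

definition digit :: "nat \<Rightarrow> real \<Rightarrow> nat \<Rightarrow> nat" where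
  "digit i t d = card {x. x < cap \<and> real (x + 1) * t * beta I d \<le> real (n * E) * alpha I i d}"

definition key :: "nat \<Rightarrow> real \<Rightarrow> nat" where
  "key i t = horner (digit i t) key_base D"

lemma digit_le_cap: "digit i t d \<le> cap"
  unfolding digit_def using card_mono[of "{..<cap}"] by (auto simp: subset_eq)

lemma digit_bounds:
  assumes d: "d < D" and t: "t > 0" and i: "i < n"
  shows "real (digit i t d) * beta I d \<le> real (n * E) * (alpha I i d / t)"
    "digit i t d < cap \<Longrightarrow> real (n * E) * (alpha I i d / t) \<le> (real (digit i t d) + 1) * beta I d"
proof -
  define u where "u = real (n * E) * (alpha I i d / t) / beta I d"
  have u0: "u \<ge> 0" unfolding u_def using t alpha_nonneg[OF i d] beta_pos[OF d] by simp
  have "(real (x + 1) * t * beta I d \<le> real (n * E) * alpha I i d) = (real (x + 1) \<le> u)" for x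
    unfolding u_def using t beta_pos[OF d] by (simp add: field_simps)
  also have "(real (x + 1) \<le> u) = (x < nat \<lfloor>u\<rfloor>)" for x using u0 by linarith
  finally have "digit i t d = card {x. x < cap \<and> x < nat \<lfloor>u\<rfloor>}" by (simp only: digit_def)
  also have "{x. x < cap \<and> x < nat \<lfloor>u\<rfloor>} = {..<min cap (nat \<lfloor>u\<rfloor>)}" by auto
  finally have dig: "digit i t d = min cap (nat \<lfloor>u\<rfloor>)" by simp
  have "real (digit i t d) \<le> u" unfolding dig using u0 by linarith
  then show "real (digit i t d) * beta I d \<le> real (n * E) * (alpha I i d / t)"
    unfolding u_def using beta_pos[OF d] by (simp only: pos_le_divide_eq)
  assume "digit i t d < cap"
  then have "u \<le> real (digit i t d) + 1" unfolding dig using u0 by linarith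
  then show "real (n * E) * (alpha I i d / t) \<le> (real (digit i t d) + 1) * beta I d"
    unfolding u_def using beta_pos[OF d] by (simp only: pos_divide_le_eq)
qed

lemma sum_digit_less: "m \<le> n \<Longrightarrow> (\<Sum>i<m. digit i (T i) d) < key_base"
proof -
  assume m: "m \<le> n"
  have "(\<Sum>i<m. digit i (T i) d) \<le> (\<Sum>i<m. cap)" by (intro sum_mono digit_le_cap)
  also have "\<dots> \<le> n * cap" using m by simp
  finally show ?thesis by (simp add: key_base_def)
qed

lemma sum_key_less: "m \<le> n \<Longrightarrow> (\<Sum>i<m. key i (T i)) < key_count"
  unfolding key_def horner_sum key_count_def by (intro horner_less sum_digit_less)

text \<open>Equal key sums mean equal digit sums for every resource. Rounding down hides at most one
  unit \<open>beta / (n E)\<close> per commodity, hence at most \<open>e beta\<close> in all. This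
  is why the dynamic program may replace a selection of periods by any other one with the same
  key.\<close>

lemma same_key_usage:
  assumes T: "\<And>i. i < n \<Longrightarrow> T i > 0" and T': "\<And>i. i < n \<Longrightarrow> T' i > 0"
    and eq: "(\<Sum>i<n. key i (T i)) = (\<Sum>i<n. key i (T' i))"
    and d: "d < D" and sum: "(\<Sum>i<n. alpha I i d / T' i) \<le> (1 + 2 * e) * beta I d"
  shows "(\<Sum>i<n. alpha I i d / T i) \<le> (1 + 3 * e) * beta I d"
proof -
  let ?s = "\<Sum>i<n. digit i (T i) d"
  have nE: "real (n * E) > 0" using n_pos E_pos by simp
  have "?s = (\<Sum>i<n. digit i (T' i) d)"
  proof (rule horner_inj[where f = "\<lambda>d. \<Sum>i<n. digit i (T i) d" and g = "\<lambda>d. \<Sum>i<n. digit i (T' i) d"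
        and b = key_base and m = D and d = d])
    show "horner (\<lambda>d. \<Sum>i<n. digit i (T i) d) key_base D = horner (\<lambda>d. \<Sum>i<n. digit i (T' i) d) key_base D"
      using eq by (simp only: key_def horner_sum)
  qed (rule sum_digit_less[OF order_refl] d)+
  then have "real ?s * beta I d = (\<Sum>i<n. real (digit i (T' i) d) * beta I d)"
    by (simp add: sum_distrib_right)
  also have "\<dots> \<le> (\<Sum>i<n. real (n * E) * (alpha I i d / T' i))"
    using digit_bounds(1)[OF d T'] by (intro sum_mono) auto
  also have "\<dots> = real (n * E) * (\<Sum>i<n. alpha I i d / T' i)" by (simp only: sum_distrib_left)
  also have "\<dots> \<le> real (n * E) * ((1 + 2 * e) * beta I d)" using sum nE by (intro mult_left_mono) auto
  also have "\<dots> = real (n * E + 2 * n) * beta I d" using E_pos by (simp add: field_simps)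
  finally have "real ?s \<le> real (n * E + 2 * n)" using beta_pos[OF d] by (simp only: mult_le_cancel_right_pos)
  then have s: "?s \<le> n * E + 2 * n" by (simp only: of_nat_le_iff)
  \<comment> \<open>The digit sum is at most \<open>n E + 2 n\<close>, below the cut-off
    \<open>2 n E\<close>. Only a digit that is not cut off bounds the consumption from
    above.\<close>
  have "2 * n < n * E" using n_pos E_ge by simp
  then have "n * E + 2 * n < cap" unfolding cap_def by simp
  have lt: "digit i (T i) d < cap" if "i < n" for i
  proof -
    have "digit i (T i) d \<le> ?s" using that by (intro member_le_sum) auto
    then show ?thesis using s \<open>n * E + 2 * n < cap\<close> by linarith
  qed
  have "real (n * E) * (\<Sum>i<n. alpha I i d / T i) = (\<Sum>i<n. real (n * E) * (alpha I i d / T i))"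
    by (simp only: sum_distrib_left)
  also have "\<dots> \<le> (\<Sum>i<n. (real (digit i (T i) d) + 1) * beta I d)"
    using digit_bounds(2)[OF d T _ lt] by (intro sum_mono) auto
  also have "\<dots> = real (?s + n) * beta I d" by (simp add: sum.distrib flip: sum_distrib_right)
  also have "\<dots> \<le> real (n * E + 3 * n) * beta I d"
  proof (rule mult_right_mono)
    have "?s + n \<le> n * E + 3 * n" using s by linarith
    then show "real (?s + n) \<le> real (n * E + 3 * n)" by (rule of_nat_mono)
  qed (use beta_pos[OF d] in simp)
  also have "\<dots> = real (n * E) * ((1 + 3 * e) * beta I d)" using E_pos by (simp add: field_simps)
  finally show ?thesis using nE by (simp only: mult_le_cancel_left_pos)
qed

end

section \<open>A program logic with running times\<close>

text \<open>A loop adds 2 to its body: one test in every pass, and the test that ends the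
  loop.\<close>

primrec weight :: "com \<Rightarrow> nat" where
  "weight Skip = 1"
| "weight (NStore a i e) = 1"
| "weight (RStore a i e) = 1"
| "weight (Seq c d) = weight c + weight d"
| "weight (Cond b c d) = weight c + weight d + 1"
| "weight (Loop b c) = weight c + 2"

primrec depth :: "com \<Rightarrow> nat" where
  "depth Skip = 0"
| "depth (NStore a i e) = 0"
| "depth (RStore a i e) = 0"
| "depth (Seq c d) = max (depth c) (depth d)"
| "depth (Cond b c d) = max (depth c) (depth d)"
| "depth (Loop b c) = Suc (depth c)"

primrec writes :: "com \<Rightarrow> nat set" where
  "writes Skip = {}"
| "writes (NStore a i e) = {a}"
| "writes (RStore a i e) = {a}"
| "writes (Seq c d) = writes c \<union> writes d"
| "writes (Cond b c d) = writes c \<union> writes d"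
| "writes (Loop b c) = writes c"

text \<open>When every executed loop makes at most \<open>Y\<close> iterations, the running time is bounded by a
  polynomial in \<open>Y\<close> that depends on the program text only; \<open>run\<close> has this bound built in.\<close>

definition run :: "nat \<Rightarrow> com \<Rightarrow> state \<Rightarrow> (state \<Rightarrow> bool) \<Rightarrow> bool" where
  "run Y c s Q \<longleftrightarrow> (\<exists>t s'. exec c s t s' \<and> t \<le> weight c * Suc Y ^ depth c \<and> Q s')"

definition same :: "nat set \<Rightarrow> state \<Rightarrow> state \<Rightarrow> bool" where
  "same W s s' \<longleftrightarrow> (\<forall>a. a \<notin> W \<longrightarrow> nmem s' a = nmem s a \<and> rmem s' a = rmem s a)"

lemma mem_nstore [simp]:
  "nmem (nstore s a j v) = (nmem s)(a := (nmem s a)(j := v))" "rmem (nstore s a j v) = rmem s"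
  by (simp_all add: nstore_def)

lemma mem_rstore [simp]:
  "rmem (rstore s a j v) = (rmem s)(a := (rmem s a)(j := v))" "nmem (rstore s a j v) = nmem s"
  by (simp_all add: rstore_def)

lemma same_refl [simp]: "same W s s"
  by (simp add: same_def)

lemma same_trans: "same W s s' \<Longrightarrow> same W s' s'' \<Longrightarrow> same W s s''"
  by (simp add: same_def)

lemma same_mono: "same W s s' \<Longrightarrow> W \<subseteq> W' \<Longrightarrow> same W' s s'"
  by (auto simp: same_def)

lemma exec_same: "exec c s t s' \<Longrightarrow> same (writes c) s s'"
  by (induction rule: exec.induct) (auto simp: same_def)

lemma run_conseq: "run Y c s P \<Longrightarrow> (\<And>s'. P s' \<Longrightarrow> Q s') \<Longrightarrow> run Y c s Q"
  unfolding run_def by blast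

text \<open>Makes available that arrays outside \<open>writes c\<close> are unchanged, so the lemmas
  about commands can state just what is computed.\<close>

lemma run_frame:
  assumes "run Y c s P" "\<And>s'. same (writes c) s s' \<Longrightarrow> P s' \<Longrightarrow> Q s'"
  shows "run Y c s Q"
  using assms exec_same unfolding run_def by blast

lemma run_Skip: "Q s \<Longrightarrow> run Y Skip s Q"
  unfolding run_def using exec.Skip by fastforce

lemma run_NStore: "Q (nstore s a (nval i s) (nval e s)) \<Longrightarrow> run Y (NStore a i e) s Q"
  unfolding run_def using exec.NStore by fastforce

lemma run_RStore: "Q (rstore s a (nval i s) (rval e s)) \<Longrightarrow> run Y (RStore a i e) s Q"
  unfolding run_def using exec.RStore by fastforce

lemma power_Suc_mono: "i \<le> j \<Longrightarrow> Suc Y ^ i \<le> Suc Y ^ j"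
  by (intro power_increasing) auto

lemma run_Seq:
  assumes "run Y c s (\<lambda>s'. run Y d s' Q)"
  shows "run Y (Seq c d) s Q"
proof -
  obtain t s' u s'' where x: "exec c s t s'" "t \<le> weight c * Suc Y ^ depth c"
    "exec d s' u s''" "u \<le> weight d * Suc Y ^ depth d" "Q s''"
    using assms unfolding run_def by blast
  have "t \<le> weight c * Suc Y ^ max (depth c) (depth d)" "u \<le> weight d * Suc Y ^ max (depth c) (depth d)"
    using x(2,4) power_Suc_mono[of "depth c" "max (depth c) (depth d)" Y]
      power_Suc_mono[of "depth d" "max (depth c) (depth d)" Y]
    by (meson le_trans max.cobounded1 max.cobounded2 mult_le_mono2)+
  then have "t + u \<le> weight (Seq c d) * Suc Y ^ depth (Seq c d)"
    by (simp only: weight.simps depth.simps add_mult_distrib add_mono)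
  then show ?thesis unfolding run_def using exec.Seq[OF x(1,3)] x(5) by blast
qed

lemma run_Cond:
  assumes "bval b s \<Longrightarrow> run Y c s Q" "\<not> bval b s \<Longrightarrow> run Y d s Q"
  shows "run Y (Cond b c d) s Q"
proof -
  let ?m = "max (depth c) (depth d)"
  have m: "weight c * Suc Y ^ depth c \<le> weight c * Suc Y ^ ?m" "weight d * Suc Y ^ depth d \<le> weight d * Suc Y ^ ?m"
    "1 \<le> Suc Y ^ ?m"
    by (intro mult_le_mono2 power_Suc_mono; simp)+ (rule one_le_power, simp)
  have w: "weight (Cond b c d) * Suc Y ^ depth (Cond b c d)
      = weight c * Suc Y ^ ?m + weight d * Suc Y ^ ?m + Suc Y ^ ?m"
    by (simp only: weight.simps depth.simps add_mult_distrib mult_1)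
  show ?thesis
  proof (cases "bval b s")
    case True
    then obtain t s' where x: "exec c s t s'" "t \<le> weight c * Suc Y ^ depth c" "Q s'"
      using assms(1) unfolding run_def by blast
    have "t + 1 \<le> weight (Cond b c d) * Suc Y ^ depth (Cond b c d)"
      unfolding w using x(2) m by linarith
    then show ?thesis unfolding run_def using exec.CondTrue[OF True x(1)] x(3) by blast
  next
    case False
    then obtain t s' where x: "exec d s t s'" "t \<le> weight d * Suc Y ^ depth d" "Q s'"
      using assms(2) unfolding run_def by blast
    have "t + 1 \<le> weight (Cond b c d) * Suc Y ^ depth (Cond b c d)"
      unfolding w using x(2) m by linarith
    then show ?thesis unfolding run_def using exec.CondFalse[OF False x(1)] x(3) by blast
  qed
qed

text \<open>The index of \<open>Inv\<close> bounds the number of remaining passes, so a single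
  invariant yields correctness, termination and the time bound.\<close>

lemma run_Loop:
  assumes init: "Inv N s" and N: "N \<le> Y"
    and step: "\<And>m s. Inv m s \<Longrightarrow> bval b s \<Longrightarrow> \<exists>m'. m = Suc m' \<and> run Y c s (Inv m')"
    and fin: "\<And>m s. Inv m s \<Longrightarrow> \<not> bval b s \<Longrightarrow> Q s"
  shows "run Y (Loop b c) s Q"
proof -
  let ?w = "weight c * Suc Y ^ depth c"
  have "\<exists>t s'. exec (Loop b c) s t s' \<and> t \<le> N * (?w + 1) + 1 \<and> Q s'"
    using init
  proof (induction N arbitrary: s)
    case 0
    then have "\<not> bval b s" using step by blast
    then show ?case using exec.LoopFalse fin[OF 0] by fastforce
  next
    case (Suc N)
    show ?case
    proof (cases "bval b s")
      case False
      then show ?thesis using exec.LoopFalse fin[OF Suc.prems] by fastforce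
    next
      case True
      then obtain t s' where x: "exec c s t s'" "t \<le> ?w" "Inv N s'"
        using step[OF Suc.prems] unfolding run_def by blast
      obtain u s'' where y: "exec (Loop b c) s' u s''" "u \<le> N * (?w + 1) + 1" "Q s''"
        using Suc.IH[OF x(3)] by blast
      have "t + u + 1 \<le> Suc N * (?w + 1) + 1" using x(2) y(2) by simp
      then show ?thesis using exec.LoopTrue[OF True x(1) y(1)] y(3) by blast
    qed
  qed
  moreover have "N * (?w + 1) + 1 \<le> weight (Loop b c) * Suc Y ^ depth (Loop b c)"
  proof -
    have p: "1 \<le> Suc Y ^ depth c" "1 \<le> Suc Y ^ Suc (depth c)" by (rule one_le_power; simp)+
    have "N * (?w + 1) \<le> Suc Y * (?w + Suc Y ^ depth c)" using N p by (intro mult_le_mono) auto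
    also have "\<dots> = (weight c + 1) * Suc Y ^ Suc (depth c)" by (simp add: algebra_simps)
    finally have "N * (?w + 1) + 1 \<le> (weight c + 1) * Suc Y ^ Suc (depth c) + Suc Y ^ Suc (depth c)"
      using p(2) by linarith
    then show ?thesis by (simp only: weight.simps depth.simps add_mult_distrib)
  qed
  ultimately show ?thesis unfolding run_def by (meson order_trans)
qed

section \<open>Derived commands: maxima, counting loops, integer arithmetic\<close>

abbreviation seq (infixr ";;" 60) where "c ;; d \<equiv> Seq c d"

abbreviation NV :: "nat \<Rightarrow> nexp" where "NV a \<equiv> NArr a (NLit 0)"
abbreviation RV :: "nat \<Rightarrow> rexp" where "RV a \<equiv> RArr a (NLit 0)"
abbreviation NSet :: "nat \<Rightarrow> nexp \<Rightarrow> com" where "NSet a e \<equiv> NStore a (NLit 0) e"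
abbreviation RSet :: "nat \<Rightarrow> rexp \<Rightarrow> com" where "RSet a e \<equiv> RStore a (NLit 0) e"

text \<open>Half of \<open>x + y + \<bar>x - y\<bar>\<close>, the absolute value being the root of a
  square. Maxima and minima are thus expressions without branching.\<close>

definition RMax :: "rexp \<Rightarrow> rexp \<Rightarrow> rexp" where
  "RMax x y = RDiv (RAdd (RAdd x y) (RSqrt (RMul (RSub x y) (RSub x y)))) (ROfNat (NLit 2))"

definition RMin :: "rexp \<Rightarrow> rexp \<Rightarrow> rexp" where
  "RMin x y = RSub (RAdd x y) (RMax x y)"

lemma rval_RMax [simp]: "rval (RMax x y) s = max (rval x s) (rval y s)"
  by (simp add: RMax_def max_def abs_if flip: power2_eq_square)

lemma rval_RMin [simp]: "rval (RMin x y) s = min (rval x s) (rval y s)"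
  by (simp add: RMin_def max_def min_def)

definition For :: "nat \<Rightarrow> nexp \<Rightarrow> com \<Rightarrow> com" where
  "For v e c = NSet v (NLit 0) ;; Loop (NLess (NV v) e) (c ;; NSet v (NAdd (NV v) (NLit 1)))"

lemma writes_For [simp]: "writes (For v e c) = insert v (writes c)"
  by (auto simp: For_def)

text \<open>The counter advances after the body, so the step proves \<open>Inv (Suc j)\<close> for
  the state with the counter already increased. The limit is evaluated anew in every pass; its value
  must therefore survive any change to the written arrays.\<close>

lemma run_For:
  assumes v: "v \<notin> writes c" and e: "\<And>s'. same (insert v (writes c)) s s' \<Longrightarrow> nval e s' = N"
    and N: "N \<le> Y" and init: "Inv 0 (nstore s v 0 0)"
    and step: "\<And>j s'. j < N \<Longrightarrow> same (insert v (writes c)) s s' \<Longrightarrow> nmem s' v 0 = j \<Longrightarrow> Inv j s' \<Longrightarrow>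
      run Y c s' (\<lambda>s''. Inv (Suc j) (nstore s'' v 0 (Suc j)))"
    and fin: "\<And>s'. same (insert v (writes c)) s s' \<Longrightarrow> nmem s' v 0 = N \<Longrightarrow> Inv N s' \<Longrightarrow> Q s'"
  shows "run Y (For v e c) s Q"
proof -
  let ?I = "\<lambda>m s'. same (insert v (writes c)) s s' \<and> m \<le> N \<and> nmem s' v 0 = N - m \<and> Inv (N - m) s'"
  have "run Y (Loop (NLess (NV v) e) (c ;; NSet v (NAdd (NV v) (NLit 1)))) (nstore s v 0 0) Q"
  proof (rule run_Loop[where Inv = ?I and N = N])
    show "?I N (nstore s v 0 0)" using init by (simp add: same_def)
    show "N \<le> Y" by (rule N)
  next
    fix m s' assume I: "?I m s'" and b: "bval (NLess (NV v) e) s'"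
    have "nval e s' = N" using e I by blast
    then obtain m' where m: "m = Suc m'" using I b by (cases m) auto
    define j where "j = N - m"
    have j: "j < N" "N - m' = Suc j" using m I by (auto simp: j_def)
    have "run Y c s' (\<lambda>s''. Inv (Suc j) (nstore s'' v 0 (Suc j)))"
      using I j by (intro step) (auto simp: j_def)
    then have "run Y c s' (\<lambda>s''. ?I m' (nstore s'' v 0 (nmem s'' v 0 + 1)))"
    proof (rule run_frame)
      fix s'' assume s'': "same (writes c) s' s''" "Inv (Suc j) (nstore s'' v 0 (Suc j))"
      have "nmem s'' v 0 = j" using s''(1) v I by (simp add: same_def j_def)
      moreover have "same (insert v (writes c)) s (nstore s'' v 0 (Suc j))"
        using s''(1) I by (auto simp: same_def)
      ultimately show "?I m' (nstore s'' v 0 (nmem s'' v 0 + 1))"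
        using s''(2) I m j by auto
    qed
    then have "run Y (c ;; NSet v (NAdd (NV v) (NLit 1))) s' (?I m')"
      by (intro run_Seq) (erule run_conseq, rule run_NStore, simp only: nval.simps)
    then show "\<exists>m'. m = Suc m' \<and> run Y (c ;; NSet v (NAdd (NV v) (NLit 1))) s' (?I m')" using m by blast
  next
    fix m s' assume I: "?I m s'" and b: "\<not> bval (NLess (NV v) e) s'"
    have "nval e s' = N" using e I by blast
    then have "N - m = N" using I b by auto
    then show "Q s'" using I fin[of s'] by auto
  qed
  then show ?thesis
    unfolding For_def by (intro run_Seq run_NStore) simp
qed

text \<open>A product as a repeated sum, since the machine only adds and subtracts natural numbers.
  The passes are counted by \<open>y\<close>, so \<open>run_Mul\<close> bounds only this
  factor.\<close>

definition Mul :: "nat \<Rightarrow> nat \<Rightarrow> nexp \<Rightarrow> nexp \<Rightarrow> com" where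
  "Mul v d x y = NSet d (NLit 0) ;; For v y (NSet d (NAdd (NV d) x))"

lemma writes_Mul [simp]: "writes (Mul v d x y) = {v, d}"
  by (auto simp: Mul_def)

lemma run_Mul:
  assumes vd: "v \<noteq> d" and x: "\<And>s'. same {v, d} s s' \<Longrightarrow> nval x s' = a"
    and y: "\<And>s'. same {v, d} s s' \<Longrightarrow> nval y s' = b" and b: "b \<le> Y" and c: "a * b = c"
    and Q: "\<And>s'. same {v, d} s s' \<Longrightarrow> nmem s' d 0 = c \<Longrightarrow> Q s'"
  shows "run Y (Mul v d x y) s Q"
  unfolding Mul_def
proof (intro run_Seq run_NStore)
  let ?s = "nstore s d (nval (NLit 0) s) (nval (NLit 0) s)"
  have s: "same {v, d} s s'" if "same {v, d} ?s s'" for s'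
    using that by (auto simp: same_def)
  show "run Y (For v y (NSet d (NAdd (NV d) x))) ?s Q"
  proof (rule run_For[where Inv = "\<lambda>j s'. nmem s' d 0 = a * j"])
    fix j s' assume "same (insert v (writes (NSet d (NAdd (NV d) x)))) ?s s'" "nmem s' d 0 = a * j"
    then show "run Y (NSet d (NAdd (NV d) x)) s' (\<lambda>s''. nmem (nstore s'' v 0 (Suc j)) d 0 = a * Suc j)"
      using vd s x by (intro run_NStore) simp
  qed (use vd y s b Q[folded c] in auto)
qed

text \<open>The inner multiplication counts up to the base. So base and exponent have to be at most
  \<open>Y\<close>, while the power itself may be larger.\<close>

definition Expt :: "nat \<Rightarrow> nat \<Rightarrow> nat \<Rightarrow> nat \<Rightarrow> nexp \<Rightarrow> nexp \<Rightarrow> com" where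
  "Expt v w u d x y = NSet d (NLit 1) ;; For v y (Mul w u (NV d) x ;; NSet d (NV u))"

lemma writes_Expt [simp]: "writes (Expt v w u d x y) = {v, w, u, d}"
  by (auto simp: Expt_def)

lemma run_Expt:
  assumes dist: "distinct [v, w, u, d]" and x: "\<And>s'. same {v, w, u, d} s s' \<Longrightarrow> nval x s' = a"
    and y: "\<And>s'. same {v, w, u, d} s s' \<Longrightarrow> nval y s' = b" and ab: "a \<le> Y" "b \<le> Y" and c: "a ^ b = c"
    and Q: "\<And>s'. same {v, w, u, d} s s' \<Longrightarrow> nmem s' d 0 = c \<Longrightarrow> Q s'"
  shows "run Y (Expt v w u d x y) s Q"
  unfolding Expt_def
proof (intro run_Seq run_NStore)
  let ?s = "nstore s d (nval (NLit 0) s) (nval (NLit 1) s)"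
  have s: "same {v, w, u, d} s s'"
    if "same (insert v (writes (Mul w u (NV d) x ;; NSet d (NV u)))) ?s s'" for s'
    using that by (auto simp: same_def)
  show "run Y (For v y (Mul w u (NV d) x ;; NSet d (NV u))) ?s Q"
  proof (rule run_For[where Inv = "\<lambda>j s'. nmem s' d 0 = a ^ j" and N = b])
    fix j s' assume "same (insert v (writes (Mul w u (NV d) x ;; NSet d (NV u)))) ?s s'" and I: "nmem s' d 0 = a ^ j"
    then have s': "same {v, w, u, d} s s'" using s by blast
    have x': "nval x s'' = a" if "same {w, u} s' s''" for s''
      using x[OF same_trans[OF s' same_mono[OF that]]] by auto
    show "run Y (Mul w u (NV d) x ;; NSet d (NV u)) s' (\<lambda>s''. nmem (nstore s'' v 0 (Suc j)) d 0 = a ^ Suc j)"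
      using dist I ab x'
      by (intro run_Seq run_Mul[where a = "a ^ j" and b = a and c = "a ^ Suc j"] run_NStore) (auto simp: same_def)
  qed (use dist y[OF s] ab Q[folded c, OF s] in auto)
qed

text \<open>For a divisor \<open>0\<close> the loop would not end.\<close>

definition DivMod :: "nat \<Rightarrow> nat \<Rightarrow> nexp \<Rightarrow> com" where
  "DivMod q r m = NSet q (NLit 0) ;;
     Loop (BNot (NLess (NV r) m)) (NSet r (NSub (NV r) m) ;; NSet q (NAdd (NV q) (NLit 1)))"

lemma writes_DivMod [simp]: "writes (DivMod q r m) = {q, r}"
  by (auto simp: DivMod_def)

lemma run_DivMod:
  assumes qr: "q \<noteq> r" and m: "\<And>s'. same {q, r} s s' \<Longrightarrow> nval m s' = a" and a: "a > 0"
    and x: "nmem s r 0 = x" "x \<le> Y"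
    and Q: "\<And>s'. same {q, r} s s' \<Longrightarrow> nmem s' q 0 = x div a \<Longrightarrow> nmem s' r 0 = x mod a \<Longrightarrow> Q s'"
  shows "run Y (DivMod q r m) s Q"
  unfolding DivMod_def
proof (intro run_Seq run_NStore)
  let ?s = "nstore s q (nval (NLit 0) s) (nval (NLit 0) s)"
  \<comment> \<open>The current remainder bounds the passes left, because each of them subtracts
    \<open>a > 0\<close>.\<close>
  show "run Y (Loop (BNot (NLess (NV r) m)) (NSet r (NSub (NV r) m) ;; NSet q (NAdd (NV q) (NLit 1)))) ?s Q"
  proof (rule run_Loop[where Inv = "\<lambda>k s'. same {q, r} s s' \<and> nmem s' r 0 \<le> k \<and> nmem s' q 0 * a + nmem s' r 0 = x" and N = x])
    fix k s' assume I: "same {q, r} s s' \<and> nmem s' r 0 \<le> k \<and> nmem s' q 0 * a + nmem s' r 0 = x"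
    have ma: "nval m s' = a" using m I by blast
    {
      assume b: "bval (BNot (NLess (NV r) m)) s'"
      then have ar: "a \<le> nmem s' r 0" using ma by simp
      obtain k' where k': "k = Suc k'" using I ar a by (cases k) auto
      have "run Y (NSet r (NSub (NV r) m) ;; NSet q (NAdd (NV q) (NLit 1))) s'
        (\<lambda>s'. same {q, r} s s' \<and> nmem s' r 0 \<le> k' \<and> nmem s' q 0 * a + nmem s' r 0 = x)"
        using I ar a qr k' ma by (intro run_Seq run_NStore) (auto simp: same_def)
      then show "\<exists>k'. k = Suc k' \<and> run Y (NSet r (NSub (NV r) m) ;; NSet q (NAdd (NV q) (NLit 1))) s'
        (\<lambda>s'. same {q, r} s s' \<and> nmem s' r 0 \<le> k' \<and> nmem s' q 0 * a + nmem s' r 0 = x)"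
        using k' by blast
    next
      assume b: "\<not> bval (BNot (NLess (NV r) m)) s'"
      then have ra: "nmem s' r 0 < a" using ma by simp
      have "x = nmem s' q 0 * a + nmem s' r 0" using I by simp
      then have "nmem s' q 0 = x div a" "nmem s' r 0 = x mod a" using ra by simp_all
      then show "Q s'" using Q I by blast
    }
  qed (use qr x in \<open>auto simp: same_def\<close>)
qed

section \<open>Parameters of the search\<close>

text \<open>
  Memory layout. Parameters: \<open>n, D, E\<close> in 10--12, number of buckets 13, \<open>n E\<close> 17, \<open>n E\<^sup>2\<close> 18, base and
  number of the enumerated codes 21 and 22, digit bound 23, base and number of the keys 25 and 26, number of choices
  27, table size 28. Thresholds (real): 30--32. Current code: 50; its digits \<open>A\<^sub>0, \<dots>, A\<^sub>L = q\<close> and the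
  grid index \<open>k\<close> of \<open>B\<close>: 55; their product: 56; number of orders in one period: 60; \<open>B\<close> and the joint cost:
  65, 66. Table of the dynamic program: entry present 68, cost 69, period 70, predecessor 71. Candidate policy: 93.
  Best policy: 5, present 100, estimated cost 101. All other arrays are scratch space. Nat and real arrays
  that are written have distinct numbers, so that one set describes what a command writes.
\<close>

definition read_input :: com where
  "read_input = NSet 10 (NArr 0 (NLit 0)) ;; NSet 11 (NArr 0 (NLit 1)) ;; NSet 12 (NLit 60) ;;
     Loop (RLess (RMul (ROfNat (NV 12)) (RArr 0 (NLit 1))) (ROfNat (NLit 60))) (NSet 12 (NAdd (NV 12) (NLit 1)))"

definition set_parameters :: com where
  "set_parameters =
     Mul 40 13 (NV 12) (NV 12) ;;
     Mul 40 14 (NAdd (NV 13) (NLit 1)) (NAdd (NV 13) (NLit 1)) ;;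
     Mul 40 15 (NV 14) (NV 12) ;;
     Expt 40 41 42 16 (NAdd (NV 15) (NV 15)) (NAdd (NV 13) (NLit 1)) ;;
     Mul 40 17 (NV 10) (NV 12) ;;
     Mul 40 18 (NV 17) (NV 12) ;;
     Mul 40 19 (NV 18) (NV 18) ;;
     Mul 40 20 (NV 16) (NV 19) ;;
     NSet 21 (NAdd (NAdd (NV 20) (NV 20)) (NAdd (NV 20) (NV 20))) ;;
     Expt 40 41 42 22 (NV 21) (NAdd (NV 13) (NLit 2)) ;;
     NSet 23 (NAdd (NV 17) (NV 17)) ;;
     Mul 40 24 (NV 10) (NV 23) ;;
     NSet 25 (NAdd (NV 24) (NLit 1)) ;;
     Expt 40 41 42 26 (NV 25) (NV 11) ;;
     NSet 27 (NAdd (NAdd (NV 13) (NV 17)) (NAdd (NV 18) (NLit 1))) ;;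
     Mul 40 28 (NV 26) (NAdd (NV 10) (NLit 1))"

definition set_bottleneck :: com where
  "set_bottleneck = Mul 42 43 (NV 40) (NV 11) ;;
     RStore 30 (NV 40) (ROfNat (NLit 0)) ;;
     For 41 (NV 11) (RStore 30 (NV 40)
       (RMax (RArr 30 (NV 40)) (RDiv (RArr 3 (NAdd (NV 43) (NV 41))) (RArr 4 (NV 41)))))"

definition update_base :: com where
  "update_base =
     RStore 31 (NV 40) (RSqrt (RDiv (RArr 1 (NV 40)) (RArr 2 (NV 40)))) ;;
     RSet 33 (RMax (RSqrt (RDiv (RAdd (RV 0) (RArr 1 (NV 40))) (RArr 2 (NV 40)))) (RArr 30 (NV 40))) ;;
     Cond (NLess (NV 40) (NLit 1)) (RSet 32 (RV 33)) (RSet 32 (RMin (RV 32) (RV 33)))"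

definition set_thresholds :: com where
  "set_thresholds = For 40 (NV 10) (set_bottleneck ;; update_base)"

lemma writes_set_thresholds [simp]:
  "writes set_bottleneck = {30, 41, 42, 43}" "writes update_base = {31, 32, 33}"
  "writes set_thresholds = {30, 31, 32, 33, 40, 41, 42, 43}"
  by (auto simp: set_thresholds_def set_bottleneck_def update_base_def)

text \<open>Found by counting upwards, as reals cannot be rounded to naturals. The value 60 gives
  \<open>e \<le> 1 / 60\<close> and \<open>60 e \<le> \<epsilon>\<close>, which absorbs the product
  of all error factors.\<close>

definition accuracy :: "real \<Rightarrow> nat" where
  "accuracy \<epsilon> = (LEAST m. 60 \<le> m \<and> 60 \<le> real m * \<epsilon>)"

lemma accuracy:
  assumes "\<epsilon> > 0"
  shows "60 \<le> accuracy \<epsilon>" "60 \<le> real (accuracy \<epsilon>) * \<epsilon>"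
    "60 \<le> m \<Longrightarrow> 60 \<le> real m * \<epsilon> \<Longrightarrow> accuracy \<epsilon> \<le> m"
proof -
  obtain k :: nat where "60 / \<epsilon> \<le> real k" using real_arch_simple by blast
  then have "60 \<le> real k * \<epsilon>" using assms by (simp add: field_simps)
  also have "\<dots> \<le> real (max 60 k) * \<epsilon>" using assms by (intro mult_right_mono) auto
  finally have "60 \<le> max 60 k \<and> 60 \<le> real (max 60 k) * \<epsilon>" by simp
  from LeastI[of "\<lambda>m. 60 \<le> m \<and> 60 \<le> real m * \<epsilon>", OF this]
  show "60 \<le> accuracy \<epsilon>" "60 \<le> real (accuracy \<epsilon>) * \<epsilon>" by (simp_all add: accuracy_def)
  assume "60 \<le> m" "60 \<le> real m * \<epsilon>"
  then show "accuracy \<epsilon> \<le> m" unfolding accuracy_def by (intro Least_le) simp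
qed

lemma writes_read_input [simp]: "writes read_input = {10, 11, 12}"
  by (auto simp: read_input_def)

lemma run_read_input:
  assumes \<epsilon>: "rmem s 0 1 > 0" and Y: "accuracy (rmem s 0 1) \<le> Y"
    and Q: "\<And>s'. same {10, 11, 12} s s' \<Longrightarrow> nmem s' 10 0 = nmem s 0 0 \<Longrightarrow> nmem s' 11 0 = nmem s 0 1 \<Longrightarrow>
      nmem s' 12 0 = accuracy (rmem s 0 1) \<Longrightarrow> Q s'"
  shows "run Y read_input s Q"
proof -
  let ?\<epsilon> = "rmem s 0 1"
  let ?I = "\<lambda>m s'. same {10, 11, 12} s s' \<and> nmem s' 10 0 = nmem s 0 0 \<and> nmem s' 11 0 = nmem s 0 1 \<and>
    60 \<le> nmem s' 12 0 \<and> nmem s' 12 0 + m = accuracy ?\<epsilon>"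
  note acc = accuracy[OF \<epsilon>]
  show ?thesis
    unfolding read_input_def
  proof (intro run_Seq run_NStore, rule run_Loop[where Inv = ?I and N = "accuracy ?\<epsilon> - 60"])
    fix m s' assume I: "?I m s'"
    have e: "rmem s' 0 1 = ?\<epsilon>" using I by (simp add: same_def)
    {
      assume "bval (RLess (RMul (ROfNat (NV 12)) (RArr 0 (NLit 1))) (ROfNat (NLit 60))) s'"
      then have "nmem s' 12 0 \<noteq> accuracy ?\<epsilon>" using acc(2) e by auto
      then obtain m' where "m = Suc m'" using I by (cases m) auto
      then show "\<exists>m'. m = Suc m' \<and> run Y (NSet 12 (NAdd (NV 12) (NLit 1))) s' (?I m')"
        using I by (intro exI[of _ m'] conjI run_NStore) (auto simp: same_def)
    next
      assume "\<not> bval (RLess (RMul (ROfNat (NV 12)) (RArr 0 (NLit 1))) (ROfNat (NLit 60))) s'"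
      then have "accuracy ?\<epsilon> \<le> nmem s' 12 0" using I e by (intro acc(3)) auto
      then show "Q s'" using I by (intro Q) auto
    }
  qed (use acc Y in \<open>auto simp: same_def\<close>)
qed

context instance_with_accuracy
begin

text \<open>The number of codes times the number of keys, a common bound on the passes of all loops
  of the search. A crude bound is harmless, since the time is a polynomial in it of a degree fixed
  by the program text.\<close>

definition work_bound :: nat where
  "work_bound = digit_base ^ (buckets + 2) * key_count"

lemma parameter_sizes:
  "n \<le> digit_base" "E \<le> digit_base" "buckets + 2 \<le> digit_base" "2 * coeff_bound \<le> digit_base"
  "n * E \<le> digit_base" "n * E ^ 2 \<le> digit_base" "n ^ 2 * E ^ 4 \<le> digit_base" "cap \<le> digit_base"
  "key_base \<le> digit_base" "choices \<le> digit_base" "n + 1 \<le> digit_base"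
proof -
  \<comment> \<open>All parameters but \<open>coeff_bound\<close> are compared with
    \<open>a\<close>, and \<open>4 * a \<le> digit_base\<close>.\<close>
  define a where "a = n ^ 2 * E ^ 4"
  have n1: "1 \<le> n" and E1: "4 \<le> E" using n_pos E_ge by auto
  have E4: "E ^ 4 = E * E * (E * E)" by (simp add: eval_nat_numeral)
  have pE: "E \<le> E * E" "E * E \<le> E * E * (E * E)" "1 \<le> E * E" "4 * E \<le> E * E" using E1 by simp_all
  have pn: "n \<le> n * n" "1 \<le> n * n" using n1 by simp_all
  have aa: "a = (n * n) * (E * E * (E * E))" by (simp add: a_def E4 power2_eq_square)
  have m: "x * y \<le> a" if "x \<le> n * n" "y \<le> E * E * (E * E)" for x y
    unfolding aa using that by (rule mult_le_mono)
  have "4 * a * 1 \<le> digit_base"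
    unfolding digit_base_def a_def using denom_bound_pos by (simp add: mult.assoc)
  then have d: "4 * a \<le> digit_base" by simp
  have "n * 1 \<le> a" "1 * E \<le> a" "1 * (E * E) \<le> a" "n * E \<le> a" "n * (E * E) \<le> a" "1 * 1 \<le> a" "n * n * E \<le> a"
    "1 * 16 \<le> a"
    using pn pE E1 by (intro m; linarith)+
  then have b: "n \<le> a" "E \<le> a" "E ^ 2 \<le> a" "n * E \<le> a" "n * E ^ 2 \<le> a" "1 \<le> a" "n * n * E \<le> a" "16 \<le> a"
    by (simp_all add: power2_eq_square)
  show "n \<le> digit_base" "E \<le> digit_base" "buckets + 2 \<le> digit_base" "n * E \<le> digit_base"
    "n * E ^ 2 \<le> digit_base" "n + 1 \<le> digit_base" "choices \<le> digit_base" "n ^ 2 * E ^ 4 \<le> digit_base"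
    using b d by (simp_all add: buckets_def choices_def flip: a_def)
  show "cap \<le> digit_base" using b d by (simp add: cap_def)
  have "n * cap = 2 * (n * n * E)" by (simp add: cap_def)
  then show "key_base \<le> digit_base" using b(7,8) d unfolding key_base_def by linarith
  have "(2 * coeff_bound) ^ 1 \<le> (2 * coeff_bound) ^ (buckets + 1)"
    using coeff_bound_pos by (intro power_increasing) auto
  then have "1 * (2 * coeff_bound) \<le> 4 * a * denom_bound"
    unfolding denom_bound_def using b(6) by (intro mult_le_mono) auto
  then show "2 * coeff_bound \<le> digit_base" unfolding digit_base_def a_def by (simp add: mult.assoc)
qed

lemma work_bound_ge:
  "x \<le> digit_base ^ (buckets + 2) \<Longrightarrow> x \<le> work_bound" "x \<le> key_count \<Longrightarrow> x \<le> work_bound"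
  "x \<le> digit_base \<Longrightarrow> x \<le> work_bound" "key_count * (n + 1) \<le> work_bound" "D \<le> work_bound"
  "denom_bound \<le> work_bound"
proof -
  have d: "digit_base \<ge> 1" using parameter_sizes(11) by linarith
  have k: "key_count \<ge> 1" by (simp add: key_count_def key_base_def)
  have z: "digit_base ^ 1 \<le> digit_base ^ (buckets + 2)" using d by (intro power_increasing) auto
  have zw: "digit_base ^ (buckets + 2) * 1 \<le> work_bound"
    unfolding work_bound_def using k by (intro mult_le_mono2)
  have kw: "1 * key_count \<le> work_bound"
    unfolding work_bound_def using z d by (intro mult_le_mono1) simp
  show "x \<le> digit_base ^ (buckets + 2) \<Longrightarrow> x \<le> work_bound" using zw by simp
  show "x \<le> key_count \<Longrightarrow> x \<le> work_bound" using kw by simp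
  show "x \<le> digit_base \<Longrightarrow> x \<le> work_bound" using z zw unfolding power_one_right by linarith
  have "(n + 1) * key_count \<le> work_bound"
    unfolding work_bound_def using z parameter_sizes(11) unfolding power_one_right by (intro mult_le_mono1) linarith
  then show "key_count * (n + 1) \<le> work_bound" by (simp only: mult.commute)
  have "D < 2 ^ D" by simp
  also have "2 ^ D \<le> key_count"
    unfolding key_count_def using n_pos E_pos by (intro power_mono) (auto simp: key_base_def cap_def)
  finally show "D \<le> work_bound" using kw by simp
  have "1 * denom_bound \<le> 4 * n ^ 2 * E ^ 4 * denom_bound"
    using n_pos E_pos by (intro mult_le_mono1) (simp add: Suc_le_eq)
  then have "denom_bound \<le> digit_base" by (simp only: digit_base_def mult_1)
  then show "denom_bound \<le> work_bound" using z zw unfolding power_one_right by linarith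
qed

lemmas parameter_bounds = parameter_sizes[THEN work_bound_ge(3)] work_bound_ge(4-)

section \<open>Memory invariants and their initialisation\<close>

definition has_input :: "state \<Rightarrow> bool" where
  "has_input s \<longleftrightarrow> rmem s 0 0 = K0 \<and> (\<forall>i<n. rmem s 1 i = K i \<and> rmem s 2 i = H i) \<and>
     (\<forall>i<n. \<forall>d<D. rmem s 3 (i * D + d) = alpha I i d) \<and> (\<forall>d<D. rmem s 4 d = beta I d)"

definition has_parameters :: "state \<Rightarrow> bool" where
  "has_parameters s \<longleftrightarrow> has_input s \<and> nmem s 10 0 = n \<and> nmem s 11 0 = D \<and> nmem s 12 0 = E \<and>
     nmem s 13 0 = buckets \<and> nmem s 17 0 = n * E \<and> nmem s 21 0 = digit_base \<and>
     nmem s 22 0 = digit_base ^ (buckets + 2) \<and> nmem s 23 0 = cap \<and> nmem s 25 0 = key_base \<and>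
     nmem s 26 0 = key_count \<and> nmem s 27 0 = choices \<and> nmem s 28 0 = key_count * (n + 1)"

definition has_thresholds :: "state \<Rightarrow> bool" where
  "has_thresholds s \<longleftrightarrow> has_parameters s \<and> (\<forall>i<n. rmem s 30 i = bottleneck i \<and> rmem s 31 i = eoq i) \<and>
     rmem s 32 0 = base"

lemma has_input_same: "has_input s \<Longrightarrow> same W s s' \<Longrightarrow> \<forall>a\<in>W. 5 \<le> a \<Longrightarrow> has_input s'"
proof -
  assume a: "has_input s" "same W s s'" "\<forall>a\<in>W. 5 \<le> a"
  have "a \<notin> W" if "a < 5" for a using a(3) that by auto
  then have "rmem s' 0 = rmem s 0" "rmem s' 1 = rmem s 1" "rmem s' 2 = rmem s 2"
    "rmem s' 3 = rmem s 3" "rmem s' 4 = rmem s 4"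
    using a(2) by (simp_all add: same_def)
  then show "has_input s'" using a(1) by (simp add: has_input_def)
qed

text \<open>All arrays the invariant mentions have numbers below 30, and the output array 5 is not
  among them. So the numbers of the written arrays decide whether it survives; for
  \<open>has_thresholds\<close> the limit is 40.\<close>

lemma has_parameters_same:
  assumes "has_parameters s" "same W s s'" "\<forall>a\<in>W. a = 5 \<or> 30 \<le> a"
  shows "has_parameters s'"
proof -
  have n: "a \<notin> W" if "a < 30" "a \<noteq> 5" for a using assms(3) that by auto
  have "has_input s'" using assms has_input_same[OF _ assms(2)] by (force simp: has_parameters_def)
  moreover have "nmem s' a = nmem s a" if "a < 30" "a \<noteq> 5" for a
    using assms(2) n[OF that] by (simp add: same_def)
  ultimately show ?thesis using assms(1) by (simp add: has_parameters_def)
qed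

lemma has_thresholds_same:
  assumes "has_thresholds s" "same W s s'" "\<forall>a\<in>W. a = 5 \<or> 40 \<le> a"
  shows "has_thresholds s'"
proof -
  have n: "a \<notin> W" if "a < 40" "a \<noteq> 5" for a using assms(3) that by auto
  have "has_parameters s'" using assms has_parameters_same[OF _ assms(2)] by (force simp: has_thresholds_def)
  moreover have "rmem s' a = rmem s a" if "a < 40" "a \<noteq> 5" for a
    using assms(2) n[OF that] by (simp add: same_def)
  ultimately show ?thesis using assms(1) by (simp add: has_thresholds_def)
qed

lemma run_set_parameters:
  assumes s: "has_input s" "nmem s 10 0 = n" "nmem s 11 0 = D" "nmem s 12 0 = E"
    and Q: "\<And>s'. same ({13..28} \<union> {40, 41, 42}) s s' \<Longrightarrow> has_parameters s' \<Longrightarrow> Q s'"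
  shows "run work_bound set_parameters s Q"
proof -
  note b = parameter_bounds
  \<comment> \<open>Every product receives a name, so that symbolic execution meets atoms only and
    each multiplication matches one of the equations \<open>x\<close>.\<close>
  define b2 where "b2 = Suc buckets * Suc buckets"
  define nE where "nE = n * E"
  define nEE where "nEE = n * E ^ 2"
  define x4 where "x4 = n ^ 2 * E ^ 4"
  define x5 where "x5 = denom_bound * x4"
  define Z where "Z = digit_base ^ (buckets + 2)"
  have x: "E * E = buckets" "Suc buckets * Suc buckets = b2" "b2 * E = coeff_bound"
    "(2 * coeff_bound) ^ Suc buckets = denom_bound" "n * E = nE" "nE * E = nEE" "nEE * nEE = x4"
    "denom_bound * x4 = x5" "digit_base ^ Suc (Suc buckets) = Z" "key_base ^ D = key_count"
    by (simp_all add: b2_def nE_def nEE_def x4_def x5_def Z_def buckets_def coeff_bound_def denom_bound_def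
      digit_base_def key_count_def power2_eq_square eval_nat_numeral)
  have y: "4 * x5 = digit_base" "2 * nE = cap" "buckets + nE + (nEE + 1) = choices" "n * cap + 1 = key_base"
    by (simp_all add: nE_def nEE_def x4_def x5_def cap_def choices_def key_base_def digit_base_def)
  have z: "Suc buckets \<le> work_bound" "Suc (Suc buckets) \<le> work_bound" "nEE \<le> work_bound" "x4 \<le> work_bound"
    "Suc n \<le> work_bound" "digit_base \<le> work_bound"
    using b work_bound_ge(3)[OF order_refl] by (simp_all add: nEE_def x4_def)
  have w: "x5 + x5 + (x5 + x5) = digit_base" "coeff_bound + coeff_bound = 2 * coeff_bound" "nE + nE = cap"
    "Suc (buckets + nE + nEE) = choices" "Suc (n * cap) = key_base"
    using y by simp_all
  have "run work_bound set_parameters s (\<lambda>s'. nmem s' 10 0 = n \<and> nmem s' 11 0 = D \<and> nmem s' 12 0 = E \<and>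
     nmem s' 13 0 = buckets \<and> nmem s' 17 0 = nE \<and> nmem s' 21 0 = digit_base \<and>
     nmem s' 22 0 = Z \<and> nmem s' 23 0 = cap \<and> nmem s' 25 0 = key_base \<and>
     nmem s' 26 0 = key_count \<and> nmem s' 27 0 = choices \<and> nmem s' 28 0 = key_count * Suc n)"
    unfolding set_parameters_def
    by (rule run_Seq run_NStore run_Mul[where d = 13, OF _ _ _ _ x(1)] run_Mul[where d = 14, OF _ _ _ _ x(2)]
        run_Mul[where d = 15, OF _ _ _ _ x(3)] run_Expt[where d = 16, OF _ _ _ _ _ x(4)]
        run_Mul[where d = 17, OF _ _ _ _ x(5)] run_Mul[where d = 18, OF _ _ _ _ x(6)]
        run_Mul[where d = 19, OF _ _ _ _ x(7)] run_Mul[where d = 20, OF _ _ _ _ x(8)]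
        run_Expt[where d = 22, OF _ _ _ _ _ x(9)] run_Mul[where d = 24 and a = n and b = cap, OF _ _ _ _ refl]
        run_Expt[where d = 26, OF _ _ _ _ _ x(10)]
        run_Mul[where d = 28 and a = key_count and b = "Suc n", OF _ _ _ _ refl] b z
      | (simp add: same_def s w; fail))+
  then show ?thesis
  proof (rule run_frame)
    fix s'
    assume a: "same (writes set_parameters) s s'" and v: "nmem s' 10 0 = n \<and> nmem s' 11 0 = D \<and> nmem s' 12 0 = E \<and>
     nmem s' 13 0 = buckets \<and> nmem s' 17 0 = nE \<and> nmem s' 21 0 = digit_base \<and>
     nmem s' 22 0 = Z \<and> nmem s' 23 0 = cap \<and> nmem s' 25 0 = key_base \<and>
     nmem s' 26 0 = key_count \<and> nmem s' 27 0 = choices \<and> nmem s' 28 0 = key_count * Suc n"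
    have "same ({13..28} \<union> {40, 41, 42}) s s'" by (rule same_mono[OF a]) (auto simp: set_parameters_def)
    moreover have "has_input s'" using has_input_same[OF s(1) a] by (simp add: set_parameters_def)
    ultimately show "Q s'" using v by (intro Q) (simp_all add: has_parameters_def nE_def Z_def)
  qed
qed

lemma bottleneck_Suc:
  "Max (insert 0 ((\<lambda>d. alpha I i d / beta I d) ` {..<Suc j})) =
    max (Max (insert 0 ((\<lambda>d. alpha I i d / beta I d) ` {..<j}))) (alpha I i j / beta I j)"
  by (simp add: lessThan_Suc insert_commute[of 0] max.commute)

text \<open>At \<open>i = 0\<close> this is a minimum over the empty set. Accordingly the program
  assigns instead of comparing at the first commodity, and the loop invariant speaks about it for
  \<open>i > 0\<close>.\<close>

definition partial_base :: "nat \<Rightarrow> real" where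
  "partial_base i = Min ((\<lambda>i. max (joint_eoq i) (bottleneck i)) ` {..<i})"

lemma partial_base_Suc:
  "partial_base (Suc i) = (if i = 0 then max (joint_eoq i) (bottleneck i)
    else min (partial_base i) (max (joint_eoq i) (bottleneck i)))"
proof (cases "i = 0")
  case False
  then have "{..<i} \<noteq> {}" by (simp add: lessThan_empty_iff)
  then show ?thesis using False by (simp add: partial_base_def lessThan_Suc min.commute)
qed (simp add: partial_base_def lessThan_Suc)

lemma run_set_bottleneck:
  assumes s: "has_parameters s" "nmem s 40 0 = i" and i: "i < n"
  shows "run work_bound set_bottleneck s (\<lambda>s'. rmem s' 30 = (rmem s 30)(i := bottleneck i))"
  unfolding set_bottleneck_def
proof (rule run_Seq, rule run_Mul[where a = i and b = D, OF _ _ _ _ refl], goal_cases)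
  case (5 s2)
  have s2: "has_parameters s2" "nmem s2 40 0 = i" "rmem s2 30 = rmem s 30"
    using 5 s has_parameters_same[OF s(1) 5(1)] by (simp_all add: same_def)
  show ?case
  proof (rule run_Seq, rule run_RStore, rule run_For[where N = D and
      Inv = "\<lambda>j s'. rmem s' 30 = (rmem s 30)(i := Max (insert 0 ((\<lambda>d. alpha I i d / beta I d) ` {..<j})))"], goal_cases)
    case (5 j s3)
    have s3: "same {30, 41} s2 s3" using 5(2) by (simp add: same_def)
    have "has_input s3" using has_input_same[OF _ s3] s2(1) by (simp add: has_parameters_def)
    moreover have "nmem s3 40 0 = i" "nmem s3 43 0 = i * D"
      using s3 s2 \<open>nmem s2 43 0 = i * D\<close> by (simp_all add: same_def)
    ultimately show ?case
      using 5(1,3,4) i unfolding bottleneck_Suc by (intro run_RStore) (simp add: has_input_def)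
  qed (use parameter_bounds s2 in \<open>auto simp: same_def has_parameters_def bottleneck_def\<close>)
qed (use parameter_bounds s in \<open>auto simp: same_def has_parameters_def\<close>)

lemma run_set_thresholds:
  assumes s: "has_parameters s"
    and Q: "\<And>s'. same {30, 31, 32, 33, 40, 41, 42, 43} s s' \<Longrightarrow> has_thresholds s' \<Longrightarrow> Q s'"
  shows "run work_bound set_thresholds s Q"
  unfolding set_thresholds_def
proof (rule run_For[where N = n and Inv = "\<lambda>i s'. (\<forall>i'<i. rmem s' 30 i' = bottleneck i' \<and> rmem s' 31 i' = eoq i') \<and>
    (i > 0 \<longrightarrow> rmem s' 32 0 = partial_base i)"], goal_cases)
  case (5 i s1)
  have p1: "has_parameters s1" by (rule has_parameters_same[OF s 5(2)]) simp
  show ?case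
  proof (rule run_Seq, rule run_frame[OF run_set_bottleneck[OF p1 5(3,1)]])
    fix s2 assume s2: "same (writes set_bottleneck) s1 s2" "rmem s2 30 = (rmem s1 30)(i := bottleneck i)"
    have "has_input s2" using has_input_same[OF _ s2(1)] p1 by (simp add: has_parameters_def)
    moreover have "nmem s2 40 0 = i" "rmem s2 31 = rmem s1 31" "rmem s2 32 = rmem s1 32"
      using s2(1) 5(3) by (simp_all add: same_def)
    ultimately show "run work_bound update_base s2 (\<lambda>s'.
        (\<forall>i'<Suc i. rmem (nstore s' 40 0 (Suc i)) 30 i' = bottleneck i' \<and> rmem (nstore s' 40 0 (Suc i)) 31 i' = eoq i') \<and>
        (Suc i > 0 \<longrightarrow> rmem (nstore s' 40 0 (Suc i)) 32 0 = partial_base (Suc i)))"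
      using 5(1,4) s2(2) unfolding update_base_def
      by (intro run_Seq run_RStore run_Cond)
        (auto simp: has_input_def partial_base_Suc eoq_def joint_eoq_def less_Suc_eq)
  qed
next
  case (6 s')
  have "has_parameters s'" by (rule has_parameters_same[OF s 6(1)]) simp
  moreover have "same {30, 31, 32, 33, 40, 41, 42, 43} s s'" by (rule same_mono[OF 6(1)]) auto
  ultimately show ?case
    using 6(3) n_pos by (intro Q) (simp_all add: has_thresholds_def partial_base_def base_def)
qed (use parameter_bounds s in \<open>auto simp: same_def has_parameters_def\<close>)

end

section \<open>Decoding a code and counting orders over one period\<close>

definition decode_digit :: com where
  "decode_digit = NSet 54 (NV 52) ;; DivMod 53 54 (NV 21) ;; NStore 55 (NV 51) (NV 54) ;; NSet 52 (NV 53)"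

definition decode :: com where
  "decode = NSet 52 (NV 50) ;; For 51 (NAdd (NV 13) (NLit 2)) decode_digit"

text \<open>The product of all digits, including the grid index, is a common multiple of the
  \<open>A l\<close> and serves as the period. It is at most the number of codes, hence an
  admissible loop length, and it is 0 exactly if some digit is 0, so one test rejects the
  meaningless codes.\<close>

definition multiply_digits :: com where
  "multiply_digits = NSet 56 (NLit 1) ;;
     For 57 (NAdd (NV 13) (NLit 2)) (Mul 58 59 (NV 56) (NArr 55 (NV 57)) ;; NSet 56 (NV 59))"

definition test_divisor :: com where
  "test_divisor = NSet 64 (NV 61) ;; DivMod 46 64 (NArr 55 (NV 63)) ;;
     Cond (NLess (NV 64) (NLit 1)) (NSet 62 (NLit 1)) Skip"

definition test_multiple :: com where
  "test_multiple = NSet 62 (NLit 0) ;; For 63 (NAdd (NV 13) (NLit 1)) test_divisor"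

definition count_period :: com where
  "count_period = NSet 60 (NLit 0) ;; For 61 (NV 56) (test_multiple ;; NSet 60 (NAdd (NV 60) (NV 62)))"

definition set_grid :: com where
  "set_grid =
     RSet 65 (RDiv (RMul (RV 32) (ROfNat (NArr 55 (NAdd (NV 13) (NLit 1)))))
       (RMul (ROfNat (NV 10)) (RMul (ROfNat (NV 12)) (RMul (ROfNat (NV 12)) (ROfNat (NV 12)))))) ;;
     RSet 66 (RMul (RV 0) (RDiv (ROfNat (NV 60))
       (RMul (ROfNat (NV 56)) (RDiv (RV 65) (ROfNat (NArr 55 (NV 13)))))))"

text \<open>Resetting the presence flags is enough, as the other data of absent entries have no
  influence. Entry 0 is the empty selection with cost 0.\<close>

definition clear_table :: com where
  "clear_table = For 67 (NV 28) (NStore 68 (NV 67) (NLit 0)) ;; NSet 68 (NLit 1) ;; RSet 69 (ROfNat (NLit 0))"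

lemma writes_decode [simp]:
  "writes decode_digit = {52, 53, 54, 55}" "writes decode = {51, 52, 53, 54, 55}"
  "writes multiply_digits = {56, 57, 58, 59}" "writes test_divisor = {46, 62, 64}"
  "writes test_multiple = {46, 62, 63, 64}" "writes count_period = {46, 60, 61, 62, 63, 64}"
  "writes set_grid = {65, 66}" "writes clear_table = {67, 68, 69}"
  by (auto simp: decode_digit_def decode_def multiply_digits_def test_divisor_def test_multiple_def
    count_period_def set_grid_def clear_table_def)

lemma period_count_Suc:
  "period_count m A (Suc x) = period_count m A x + (if \<exists>l<m. A l dvd x then 1 else 0)"
proof -
  have "{y. y < Suc x \<and> (\<exists>l<m. A l dvd y)} =
    (if \<exists>l<m. A l dvd x then insert x {y. y < x \<and> (\<exists>l<m. A l dvd y)} else {y. y < x \<and> (\<exists>l<m. A l dvd y)})"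
    by (auto simp: less_Suc_eq)
  then show ?thesis by (simp add: period_count_def)
qed

context instance_with_accuracy
begin

lemma digit_base_pos: "digit_base > 0"
  using parameter_sizes(11) by linarith

lemma bounds_buckets: "buckets + 2 \<le> work_bound" "buckets + 1 \<le> work_bound"
  using parameter_bounds(3) by simp_all

lemma run_decode:
  assumes s: "has_parameters s" and z: "nmem s 50 0 \<le> work_bound"
    and Q: "\<And>s'. same (writes decode) s s' \<Longrightarrow>
      (\<forall>j<buckets + 2. nmem s' 55 j = nmem s 50 0 div digit_base ^ j mod digit_base) \<Longrightarrow> Q s'"
  shows "run work_bound decode s Q"
  unfolding decode_def
proof (rule run_Seq, rule run_NStore, rule run_For[where N = "buckets + 2" and
    Inv = "\<lambda>j s'. nmem s' 52 0 = nmem s 50 0 div digit_base ^ j \<and>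
      (\<forall>i<j. nmem s' 55 i = nmem s 50 0 div digit_base ^ i mod digit_base)"], goal_cases)
  case (5 j s1)
  have s1: "same {50 + 1..59} s s1" using 5(2) by (auto simp: same_def)
  then have p: "has_parameters s1" using has_parameters_same[OF s s1] by simp
  have "nmem s 50 0 div digit_base ^ j \<le> nmem s 50 0" by (rule div_le_dividend)
  then have le: "nmem s1 52 0 \<le> work_bound" using 5(4) z by linarith
  show ?case
    unfolding decode_digit_def
  proof (rule run_Seq, rule run_NStore, rule run_Seq, rule run_DivMod[where a = digit_base and x = "nmem s1 52 0"], goal_cases)
    case (6 s2)
    have "nmem s2 51 0 = j" using 6(1) 5(3) by (simp add: same_def)
    moreover have "nmem s2 55 = nmem s1 55" using 6(1) by (simp add: same_def)
    moreover have "nmem s 50 0 div digit_base ^ Suc j = nmem s 50 0 div digit_base ^ j div digit_base"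
      by (simp only: power_Suc2 div_mult2_eq)
    ultimately show ?case
      using 5(4) 6(2,3) by (intro run_Seq run_NStore) (auto simp: less_Suc_eq)
  qed (use p le digit_base_pos in \<open>auto simp: has_parameters_def same_def\<close>)
next
  case (6 s')
  show ?case
  proof (rule Q)
    show "same (writes decode) s s'" using 6(1) by (auto simp: same_def)
  qed (use 6(3) in blast)
qed (use bounds_buckets s in \<open>auto simp: same_def has_parameters_def\<close>)

lemma run_multiply_digits:
  assumes s: "has_parameters s" and z: "\<And>j. j < buckets + 2 \<Longrightarrow> nmem s 55 j \<le> work_bound"
    and Q: "\<And>s'. same (writes multiply_digits) s s' \<Longrightarrow> nmem s' 56 0 = (\<Prod>j<buckets + 2. nmem s 55 j) \<Longrightarrow> Q s'"
  shows "run work_bound multiply_digits s Q"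
  unfolding multiply_digits_def
proof (rule run_Seq, rule run_NStore, rule run_For[where N = "buckets + 2" and
    Inv = "\<lambda>j s'. nmem s' 56 0 = (\<Prod>i<j. nmem s 55 i)"], goal_cases)
  case (5 j s1)
  have "nmem s1 55 = nmem s 55" using 5(2) by (simp add: same_def)
  then show ?case
    using 5 z[of j]
    by (intro run_Seq run_Mul[where a = "nmem s1 56 0" and b = "nmem s 55 j", OF _ _ _ _ refl] run_NStore)
      (auto simp: same_def lessThan_Suc mult.commute)
next
  case (6 s')
  show ?case
  proof (rule Q)
    show "same (writes multiply_digits) s s'" using 6(1) by (auto simp: same_def)
  qed (rule 6(3))
qed (use bounds_buckets s in \<open>auto simp: same_def has_parameters_def\<close>)

lemma run_test_multiple:
  assumes s: "has_parameters s" and A: "\<And>l. l \<le> buckets \<Longrightarrow> nmem s 55 l > 0" and x: "nmem s 61 0 \<le> work_bound"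
    and Q: "\<And>s'. same (writes test_multiple) s s' \<Longrightarrow>
      nmem s' 62 0 = (if \<exists>l<buckets + 1. nmem s 55 l dvd nmem s 61 0 then 1 else 0) \<Longrightarrow> Q s'"
  shows "run work_bound test_multiple s Q"
  unfolding test_multiple_def
proof (rule run_Seq, rule run_NStore, rule run_For[where N = "buckets + 1" and
    Inv = "\<lambda>j s'. nmem s' 62 0 = (if \<exists>l<j. nmem s 55 l dvd nmem s 61 0 then 1 else 0)"], goal_cases)
  case (5 j s1)
  have m: "nmem s1 55 = nmem s 55" "nmem s1 61 = nmem s 61" using 5(2) by (simp_all add: same_def)
  show ?case
    unfolding test_divisor_def
  proof (rule run_Seq, rule run_NStore, rule run_Seq,
      rule run_DivMod[where a = "nmem s 55 j" and x = "nmem s 61 0"], goal_cases)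
    case (6 s2)
    have "nmem s2 62 = nmem s1 62" using 6(1) by (simp add: same_def)
    moreover have "(nmem s2 64 0 < 1) = (nmem s 55 j dvd nmem s 61 0)"
      using 6(3) by (simp add: dvd_eq_mod_eq_0)
    ultimately show ?case
      using 5(4) by (intro run_Cond run_NStore run_Skip) (auto simp: less_Suc_eq)
  qed (use m 5 A[of j] x in \<open>auto simp: same_def\<close>)
next
  case (6 s')
  show ?case
  proof (rule Q)
    show "same (writes test_multiple) s s'" using 6(1) by (auto simp: same_def)
  qed (rule 6(3))
qed (use bounds_buckets s in \<open>auto simp: same_def has_parameters_def\<close>)

lemma run_count_period:
  assumes s: "has_parameters s" and A: "\<And>l. l \<le> buckets \<Longrightarrow> nmem s 55 l > 0" and P: "nmem s 56 0 \<le> work_bound"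
    and Q: "\<And>s'. same (writes count_period) s s' \<Longrightarrow>
      nmem s' 60 0 = period_count (buckets + 1) (nmem s 55) (nmem s 56 0) \<Longrightarrow> Q s'"
  shows "run work_bound count_period s Q"
  unfolding count_period_def
proof (rule run_Seq, rule run_NStore, rule run_For[where N = "nmem s 56 0" and
    Inv = "\<lambda>j s'. nmem s' 60 0 = period_count (buckets + 1) (nmem s 55) j"], goal_cases)
  case (5 j s1)
  have m: "nmem s1 55 = nmem s 55" using 5(2) by (simp add: same_def)
  have p: "has_parameters s1"
    by (rule has_parameters_same[OF s, of "{46, 60, 61, 62, 63, 64}"]) (use 5(2) in \<open>auto simp: same_def\<close>)
  show ?case
  proof (rule run_Seq, rule run_test_multiple[OF p], goal_cases)
    case (3 s2)
    have "nmem s2 60 = nmem s1 60" using 3(1) by (simp add: same_def)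
    then show ?case
      using 5(3,4) 3(2) m unfolding period_count_Suc by (intro run_NStore) simp
  qed (use m A 5 P in auto)
next
  case (6 s')
  show ?case
  proof (rule Q)
    show "same (writes count_period) s s'" using 6(1) by (auto simp: same_def)
  qed (rule 6(3))
qed (use P in \<open>auto simp: same_def period_count_def\<close>)

lemma run_set_grid:
  assumes s: "has_thresholds s"
    and Q: "\<And>s'. same (writes set_grid) s s' \<Longrightarrow> rmem s' 65 0 = grid_base (nmem s 55 (buckets + 1)) \<Longrightarrow>
      rmem s' 66 0 = K0 * (real (nmem s 60 0) /
        (real (nmem s 56 0) * (grid_base (nmem s 55 (buckets + 1)) / real (nmem s 55 buckets)))) \<Longrightarrow> Q s'"
  shows "run work_bound set_grid s Q"
  unfolding set_grid_def
  by (intro run_Seq run_RStore Q)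
    (use s in \<open>simp_all add: same_def has_thresholds_def has_parameters_def has_input_def grid_base_def power3_eq_cube mult.assoc\<close>)

lemma run_clear_table:
  assumes s: "has_parameters s"
    and Q: "\<And>s'. same (writes clear_table) s s' \<Longrightarrow> nmem s' 68 0 = 1 \<Longrightarrow> rmem s' 69 0 = 0 \<Longrightarrow>
      (\<forall>x. 0 < x \<longrightarrow> x < key_count * (n + 1) \<longrightarrow> nmem s' 68 x = 0) \<Longrightarrow> Q s'"
  shows "run work_bound clear_table s Q"
  unfolding clear_table_def
proof (rule run_Seq, rule run_For[where N = "key_count * (n + 1)" and
    Inv = "\<lambda>j s'. \<forall>x<j. nmem s' 68 x = 0"], goal_cases)
  case (6 s')
  show ?case
    by (intro run_Seq run_NStore run_RStore Q) (use 6 in \<open>auto simp: same_def\<close>)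
qed (use parameter_bounds s in \<open>auto simp: same_def has_parameters_def less_Suc_eq intro!: run_NStore\<close>)

end

section \<open>Dynamic programming over commodities\<close>

definition choose_value :: com where
  "choose_value = Cond (NLess (NV 78) (NV 13))
     (RSet 79 (RDiv (RMul (ROfNat (NArr 55 (NV 78))) (RV 65)) (ROfNat (NArr 55 (NV 13)))))
     (Cond (NLess (NV 78) (NAdd (NV 13) (NV 17)))
       (RSet 79 (RMul (ROfNat (NAdd (NSub (NV 78) (NV 13)) (NLit 1))) (RV 65)))
       (RSet 79 (RMul (RV 77) (RAdd (ROfNat (NLit 1))
         (RDiv (ROfNat (NSub (NV 78) (NAdd (NV 13) (NV 17)))) (ROfNat (NV 12)))))))"

definition test_digit :: com where
  "test_digit = Cond (RLess (RMul (ROfNat (NV 17)) (RArr 3 (NAdd (NV 76) (NV 81))))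
       (RMul (RMul (ROfNat (NAdd (NV 83) (NLit 1))) (RV 79)) (RArr 4 (NV 81))))
     Skip (NSet 82 (NAdd (NV 82) (NLit 1)))"

definition set_digit :: com where
  "set_digit = NSet 82 (NLit 0) ;; For 83 (NV 23) test_digit"

definition set_key :: com where
  "set_key = NSet 80 (NLit 0) ;;
     For 81 (NV 11) (set_digit ;; Mul 84 85 (NV 80) (NV 25) ;; NSet 80 (NAdd (NV 85) (NV 82)))"

text \<open>Layer \<open>i\<close> starts at \<open>key_count * i\<close>, stored in array 74; array
  87 is the key of the source and array 80 the key of the tried period. The comparison with array 26
  keeps the target inside the next layer, and a present target gives way only to a strictly cheaper
  entry.\<close>

definition relax :: com where
  "relax = (let src = NAdd (NV 74) (NV 87); dst = NAdd (NAdd (NV 74) (NV 26)) (NAdd (NV 87) (NV 80));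
       new = RAdd (RArr 69 src) (RV 86) in
     Cond (BAnd (BAnd (NLess (NLit 0) (NArr 68 src)) (NLess (NAdd (NV 87) (NV 80)) (NV 26)))
         (BNot (BAnd (NLess (NLit 0) (NArr 68 dst)) (BNot (RLess new (RArr 69 dst))))))
       (NStore 68 dst (NLit 1) ;; RStore 69 dst new ;; RStore 70 dst (RV 79) ;; NStore 71 dst src)
       Skip)"

definition set_item_cost :: com where
  "set_item_cost = RSet 86 (RAdd (RDiv (RArr 1 (NV 72)) (RV 79)) (RMul (RArr 2 (NV 72)) (RV 79)))"

definition try_choice :: com where
  "try_choice = choose_value ;; set_key ;; set_item_cost ;; For 87 (NV 26) relax"

definition prepare_item :: com where
  "prepare_item = Mul 73 74 (NV 26) (NV 72) ;; Mul 75 76 (NV 72) (NV 11) ;;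
     RSet 77 (RMax (RMax (RArr 31 (NV 72)) (RArr 30 (NV 72))) (RMul (ROfNat (NV 17)) (RV 65)))"

definition fill_table :: com where
  "fill_table = For 72 (NV 10) (prepare_item ;; For 78 (NV 27) try_choice)"

lemma writes_fill_table [simp]:
  "writes choose_value = {79}" "writes test_digit = {82}" "writes set_digit = {82, 83}"
  "writes set_key = {80, 81, 82, 83, 84, 85}" "writes relax = {68, 69, 70, 71}"
  "writes set_item_cost = {86}" "writes try_choice = {68, 69, 70, 71, 79, 80, 81, 82, 83, 84, 85, 86, 87}"
  "writes prepare_item = {73, 74, 75, 76, 77}"
  "writes fill_table = {68, 69, 70, 71, 72, 73, 74, 75, 76, 77, 78, 79, 80, 81, 82, 83, 84, 85, 86, 87}"
  by (auto simp: choose_value_def test_digit_def set_digit_def set_key_def relax_def set_item_cost_def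
    try_choice_def prepare_item_def fill_table_def Let_def)

text \<open>Entries of layer \<open>i\<close> have indices in \<open>[U i, U (i + 1))\<close>.\<close>

primrec trace :: "nat \<Rightarrow> (nat \<Rightarrow> real) \<Rightarrow> (nat \<Rightarrow> nat) \<Rightarrow> (nat \<Rightarrow> real) \<Rightarrow> nat \<Rightarrow> nat \<Rightarrow> bool" where
  "trace U tv pr V 0 x = True"
| "trace U tv pr V (Suc i) x = (x < U * (i + 2) \<and> tv x = V i \<and> trace U tv pr V i (pr x))"

text \<open>The bound built into \<open>trace\<close> confines it to layers up to \<open>i\<close>,
  so later writes to higher layers do not disturb it.\<close>

lemma trace_cong:
  assumes "\<And>y. y < U * (i + 1) \<Longrightarrow> tv' y = tv y \<and> pr' y = pr y" "\<And>j. j < i \<Longrightarrow> V' j = V j"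
    "trace U tv pr V i x"
  shows "trace U tv' pr' V' i x"
  using assms
proof (induction i arbitrary: x)
  case (Suc i)
  have "y < U * (i + 1) \<Longrightarrow> y < U * (Suc i + 1)" for y by simp
  then have "trace U tv' pr' V' i (pr x)" using Suc.IH[of "pr x"] Suc.prems by simp
  moreover have "x < U * (Suc i + 1)" using Suc.prems(3) by simp
  ultimately show ?case using Suc.prems by simp
qed simp

text \<open>Effect of a sweep over the source keys below \<open>m\<close>, for a period
  \<open>t\<close> with key \<open>w\<close> and item cost \<open>k\<close>. The source layer starts
  at \<open>a\<close>, the target layer at \<open>a + U\<close>. The third clause gives soundness;
  the last two give completeness, as no present entry gets worse and every treated source is
  accounted for.\<close>

definition relaxed :: "nat \<Rightarrow> nat \<Rightarrow> nat \<Rightarrow> real \<Rightarrow> real \<Rightarrow> nat \<Rightarrow> state \<Rightarrow> state \<Rightarrow> bool" where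
  "relaxed U a w t k m s s' \<longleftrightarrow>
     (\<forall>x<a + U. nmem s' 68 x = nmem s 68 x \<and> rmem s' 69 x = rmem s 69 x \<and>
        rmem s' 70 x = rmem s 70 x \<and> nmem s' 71 x = nmem s 71 x) \<and>
     (\<forall>x\<ge>a + U + U. nmem s' 68 x = nmem s 68 x) \<and>
     (\<forall>v<U. nmem s' 68 (a + U + v) \<noteq> 0 \<longrightarrow>
        nmem s 68 (a + U + v) \<noteq> 0 \<and> rmem s' 69 (a + U + v) = rmem s 69 (a + U + v) \<and>
          rmem s' 70 (a + U + v) = rmem s 70 (a + U + v) \<and> nmem s' 71 (a + U + v) = nmem s 71 (a + U + v) \<or>
        (\<exists>u. u + w = v \<and> nmem s 68 (a + u) \<noteq> 0 \<and> rmem s' 69 (a + U + v) = rmem s 69 (a + u) + k \<and>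
          rmem s' 70 (a + U + v) = t \<and> nmem s' 71 (a + U + v) = a + u)) \<and>
     (\<forall>v<U. nmem s 68 (a + U + v) \<noteq> 0 \<longrightarrow>
        nmem s' 68 (a + U + v) \<noteq> 0 \<and> rmem s' 69 (a + U + v) \<le> rmem s 69 (a + U + v)) \<and>
     (\<forall>u<m. nmem s 68 (a + u) \<noteq> 0 \<longrightarrow> u + w < U \<longrightarrow>
        nmem s' 68 (a + U + (u + w)) \<noteq> 0 \<and> rmem s' 69 (a + U + (u + w)) \<le> rmem s 69 (a + u) + k)"

lemma relaxed_0: "(\<And>a. a \<in> {68..71} \<Longrightarrow> nmem s' a = nmem s a \<and> rmem s' a = rmem s a) \<Longrightarrow> relaxed U a w t k 0 s s'"
  by (simp add: relaxed_def)

lemma relaxed_cong: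
  assumes "relaxed U a w t k m s s1" "\<And>a. a \<in> {68..71} \<Longrightarrow> nmem s' a = nmem s1 a \<and> rmem s' a = rmem s1 a"
  shows "relaxed U a w t k m s s'"
proof -
  have "nmem s' 68 = nmem s1 68" "rmem s' 69 = rmem s1 69" "rmem s' 70 = rmem s1 70" "nmem s' 71 = nmem s1 71"
    using assms(2) by simp_all
  then show ?thesis using assms(1) by (simp add: relaxed_def)
qed

lemma relaxed_skip:
  assumes r: "relaxed U a w t k m s s'" and m: "m < U"
    and no: "nmem s' 68 (a + m) = 0 \<or> \<not> m + w < U \<or>
      nmem s' 68 (a + U + (m + w)) \<noteq> 0 \<and> rmem s' 69 (a + U + (m + w)) \<le> rmem s' 69 (a + m) + k"
  shows "relaxed U a w t k (Suc m) s s'"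
proof -
  have "nmem s' 68 (a + m) = nmem s 68 (a + m)" "rmem s' 69 (a + m) = rmem s 69 (a + m)"
    using r m by (simp_all add: relaxed_def)
  then have "nmem s 68 (a + m) \<noteq> 0 \<longrightarrow> m + w < U \<longrightarrow>
        nmem s' 68 (a + U + (m + w)) \<noteq> 0 \<and> rmem s' 69 (a + U + (m + w)) \<le> rmem s 69 (a + m) + k"
    using no by auto
  then show ?thesis using r unfolding relaxed_def less_Suc_eq by blast
qed

lemma relaxed_update:
  assumes r: "relaxed U a w t k m s s'" and m: "m < U" and src: "nmem s' 68 (a + m) \<noteq> 0" and mw: "m + w < U"
    and better: "nmem s' 68 (a + U + (m + w)) = 0 \<or> rmem s' 69 (a + m) + k < rmem s' 69 (a + U + (m + w))"
    and s'': "nmem s'' 68 = (nmem s' 68)(a + U + (m + w) := 1)"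
      "rmem s'' 69 = (rmem s' 69)(a + U + (m + w) := rmem s' 69 (a + m) + k)"
      "rmem s'' 70 = (rmem s' 70)(a + U + (m + w) := t)" "nmem s'' 71 = (nmem s' 71)(a + U + (m + w) := a + m)"
  shows "relaxed U a w t k (Suc m) s s''"
proof -
  have e: "nmem s' 68 (a + m) = nmem s 68 (a + m)" "rmem s' 69 (a + m) = rmem s 69 (a + m)"
    using r m by (simp_all add: relaxed_def)
  have x1: "\<forall>x<a + U. nmem s'' 68 x = nmem s 68 x \<and> rmem s'' 69 x = rmem s 69 x \<and>
      rmem s'' 70 x = rmem s 70 x \<and> nmem s'' 71 x = nmem s 71 x"
    using r unfolding relaxed_def s'' by simp
  have x2: "\<forall>x\<ge>a + U + U. nmem s'' 68 x = nmem s 68 x"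
    using r mw unfolding relaxed_def s'' by simp
  have x3: "nmem s 68 (a + U + v) \<noteq> 0 \<and> rmem s'' 69 (a + U + v) = rmem s 69 (a + U + v) \<and>
          rmem s'' 70 (a + U + v) = rmem s 70 (a + U + v) \<and> nmem s'' 71 (a + U + v) = nmem s 71 (a + U + v) \<or>
        (\<exists>u. u + w = v \<and> nmem s 68 (a + u) \<noteq> 0 \<and> rmem s'' 69 (a + U + v) = rmem s 69 (a + u) + k \<and>
          rmem s'' 70 (a + U + v) = t \<and> nmem s'' 71 (a + U + v) = a + u)"
    if v: "v < U" "nmem s'' 68 (a + U + v) \<noteq> 0" for v
  proof (cases "v = m + w")
    case True
    then show ?thesis using src unfolding s'' e by (intro disjI2 exI[of _ m]) simp
  next
    case False
    then have "nmem s' 68 (a + U + v) \<noteq> 0" using v(2) unfolding s'' by simp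
    then show ?thesis using r v(1) False unfolding relaxed_def s'' by simp
  qed
  have x4: "nmem s'' 68 (a + U + v) \<noteq> 0 \<and> rmem s'' 69 (a + U + v) \<le> rmem s 69 (a + U + v)"
    if v: "v < U" "nmem s 68 (a + U + v) \<noteq> 0" for v
  proof -
    have o: "nmem s' 68 (a + U + v) \<noteq> 0" "rmem s' 69 (a + U + v) \<le> rmem s 69 (a + U + v)"
      using r v unfolding relaxed_def by blast+
    show ?thesis
    proof (cases "v = m + w")
      case True
      then show ?thesis using o better unfolding s'' by auto
    next
      case False
      then show ?thesis using o unfolding s'' by simp
    qed
  qed
  have x5: "nmem s'' 68 (a + U + (u + w)) \<noteq> 0 \<and> rmem s'' 69 (a + U + (u + w)) \<le> rmem s 69 (a + u) + k"
    if u: "u < Suc m" "nmem s 68 (a + u) \<noteq> 0" "u + w < U" for u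
  proof (cases "u = m")
    case True
    then show ?thesis unfolding s'' e by simp
  next
    case False
    then have "u < m" using u(1) by simp
    then have "nmem s' 68 (a + U + (u + w)) \<noteq> 0 \<and> rmem s' 69 (a + U + (u + w)) \<le> rmem s 69 (a + u) + k"
      using r u unfolding relaxed_def by blast
    then show ?thesis using False unfolding s'' by simp
  qed
  show ?thesis
    unfolding relaxed_def using x1 x2 x3 x4 x5 by blast
qed

context instance_with_accuracy
begin

lemma run_choose_value:
  assumes "has_thresholds s" "nmem s 78 0 = c" "rmem s 77 0 = personal B i" "rmem s 65 0 = B"
  shows "run work_bound choose_value s (\<lambda>s'. rmem s' 79 0 = choice_value (nmem s 55) B i c)"
  unfolding choose_value_def
  by (intro run_Cond run_RStore)
    (use assms in \<open>simp_all add: has_thresholds_def has_parameters_def choice_value_def del: of_nat_diff\<close>)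

lemma card_less_Suc:
  "card {x. x < Suc j \<and> P x} = card {x. x < j \<and> P x} + (if P j then 1 else 0)"
proof -
  have "{x. x < Suc j \<and> P x} = (if P j then insert j {x. x < j \<and> P x} else {x. x < j \<and> P x})"
    by (auto simp: less_Suc_eq)
  then show ?thesis by simp
qed

lemma run_set_digit:
  assumes s: "has_parameters s" "nmem s 76 0 = i * D" "rmem s 79 0 = t" "nmem s 81 0 = d" and i: "i < n" "d < D"
  shows "run work_bound set_digit s (\<lambda>s'. nmem s' 82 0 = digit i t d)"
  unfolding set_digit_def
proof (rule run_Seq, rule run_NStore, rule run_For[where N = cap and
    Inv = "\<lambda>j s'. nmem s' 82 0 = card {x. x < j \<and> real (x + 1) * t * beta I d \<le> real (n * E) * alpha I i d}"], goal_cases)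
  case (5 j s1)
  have sm: "same {82, 83} s s1" using 5(2) by (auto simp: same_def)
  then have p: "has_parameters s1" "nmem s1 76 0 = i * D" "rmem s1 79 0 = t" "nmem s1 81 0 = d"
    using has_parameters_same[OF s(1) sm] s by (simp_all add: same_def)
  show ?case
    unfolding test_digit_def card_less_Suc
    by (intro run_Cond run_Skip run_NStore)
      (use p i 5(3,4) in \<open>simp_all add: has_parameters_def has_input_def not_less algebra_simps\<close>)
qed (use s parameter_bounds in \<open>auto simp: same_def has_parameters_def digit_def\<close>)

lemma run_set_key:
  assumes s: "has_parameters s" "nmem s 76 0 = i * D" "rmem s 79 0 = t" and i: "i < n"
  shows "run work_bound set_key s (\<lambda>s'. nmem s' 80 0 = key i t)"
  unfolding set_key_def
proof (rule run_Seq, rule run_NStore, rule run_For[where N = D and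
    Inv = "\<lambda>j s'. nmem s' 80 0 = horner (digit i t) key_base j"], goal_cases)
  case (5 j s1)
  have sm: "same {80, 81, 82, 83, 84, 85} s s1" using 5(2) by (auto simp: same_def)
  then have p: "has_parameters s1" "nmem s1 76 0 = i * D" "rmem s1 79 0 = t"
    using has_parameters_same[OF s(1) sm] s by (simp_all add: same_def)
  show ?case
  proof (rule run_Seq, rule run_frame[OF run_set_digit[OF p 5(3) i 5(1)]], goal_cases)
    case (1 s2)
    have "has_parameters s2" using has_parameters_same[OF p(1) 1(1)] by simp
    moreover have "nmem s2 80 0 = horner (digit i t) key_base j" using 1(1) 5(4) by (simp add: same_def)
    ultimately show ?case
      using 1(2) parameter_bounds
      by (intro run_Seq run_Mul[where a = "horner (digit i t) key_base j" and b = key_base, OF _ _ _ _ refl] run_NStore)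
        (auto simp: same_def has_parameters_def)
  qed
qed (use s parameter_bounds in \<open>auto simp: same_def has_parameters_def key_def\<close>)

lemma run_relax:
  assumes s: "nmem s 26 0 = key_count" "nmem s 74 0 = a" "nmem s 80 0 = w" "rmem s 79 0 = t" "rmem s 86 0 = k"
  shows "run work_bound (For 87 (NV 26) relax) s (relaxed key_count a w t k key_count s)"
proof (rule run_For[where N = key_count and Inv = "\<lambda>m s'. relaxed key_count a w t k m s s'"], goal_cases)
  case (5 m s1)
  have p: "nmem s1 26 0 = key_count" "nmem s1 74 0 = a" "nmem s1 80 0 = w" "rmem s1 79 0 = t" "rmem s1 86 0 = k"
    using 5(2) s by (simp_all add: same_def)
  show ?case
    unfolding relax_def Let_def
  proof (rule run_Cond)
    assume b: "bval (BAnd (BAnd (NLess (NLit 0) (NArr 68 (NAdd (NV 74) (NV 87)))) (NLess (NAdd (NV 87) (NV 80)) (NV 26)))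
         (BNot (BAnd (NLess (NLit 0) (NArr 68 (NAdd (NAdd (NV 74) (NV 26)) (NAdd (NV 87) (NV 80)))))
           (BNot (RLess (RAdd (RArr 69 (NAdd (NV 74) (NV 87))) (RV 86))
             (RArr 69 (NAdd (NAdd (NV 74) (NV 26)) (NAdd (NV 87) (NV 80))))))))) s1"
    show "run work_bound
     (NStore 68 (NAdd (NAdd (NV 74) (NV 26)) (NAdd (NV 87) (NV 80))) (NLit 1) ;;
      RStore 69 (NAdd (NAdd (NV 74) (NV 26)) (NAdd (NV 87) (NV 80))) (RAdd (RArr 69 (NAdd (NV 74) (NV 87))) (RV 86)) ;;
      RStore 70 (NAdd (NAdd (NV 74) (NV 26)) (NAdd (NV 87) (NV 80))) (RV 79) ;;
      NStore 71 (NAdd (NAdd (NV 74) (NV 26)) (NAdd (NV 87) (NV 80))) (NAdd (NV 74) (NV 87))) s1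
     (\<lambda>s''. relaxed key_count a w t k (Suc m) s (nstore s'' 87 0 (Suc m)))"
      by (intro run_Seq run_NStore run_RStore relaxed_update[OF 5(4) 5(1)]) (use b p 5(3) in auto)
  next
    assume b: "\<not> bval (BAnd (BAnd (NLess (NLit 0) (NArr 68 (NAdd (NV 74) (NV 87)))) (NLess (NAdd (NV 87) (NV 80)) (NV 26)))
         (BNot (BAnd (NLess (NLit 0) (NArr 68 (NAdd (NAdd (NV 74) (NV 26)) (NAdd (NV 87) (NV 80)))))
           (BNot (RLess (RAdd (RArr 69 (NAdd (NV 74) (NV 87))) (RV 86))
             (RArr 69 (NAdd (NAdd (NV 74) (NV 26)) (NAdd (NV 87) (NV 80))))))))) s1"
    have "relaxed key_count a w t k (Suc m) s s1"
      by (rule relaxed_skip[OF 5(4,1)]) (use b p 5(3) in auto)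
    then show "run work_bound Skip s1 (\<lambda>s''. relaxed key_count a w t k (Suc m) s (nstore s'' 87 0 (Suc m)))"
      by (intro run_Skip) (erule relaxed_cong, auto)
  qed
qed (use s work_bound_ge(2)[OF order_refl] in \<open>auto simp: same_def intro!: relaxed_0\<close>)

section \<open>Soundness and completeness of the table\<close>

definition chosen :: "(nat \<Rightarrow> nat) \<Rightarrow> real \<Rightarrow> (nat \<Rightarrow> nat) \<Rightarrow> nat \<Rightarrow> real" where
  "chosen A B c i = choice_value A B i (c i)"

text \<open>Exact cost and trace tie an entry to one concrete selection, so the periods read back
  have precisely the recorded cost.\<close>

definition sound_layer :: "(nat \<Rightarrow> nat) \<Rightarrow> real \<Rightarrow> nat \<Rightarrow> state \<Rightarrow> bool" where
  "sound_layer A B i s \<longleftrightarrow> (\<forall>u<key_count. nmem s 68 (key_count * i + u) \<noteq> 0 \<longrightarrow>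
     (\<exists>c. (\<forall>j<i. c j < choices) \<and> (\<Sum>j<i. key j (chosen A B c j)) = u \<and>
       rmem s 69 (key_count * i + u) = (\<Sum>j<i. item_cost j (chosen A B c j)) \<and>
       trace key_count (rmem s 70) (nmem s 71) (chosen A B c) i (key_count * i + u)))"

text \<open>Of a selection only the key and an upper bound on the cost are kept. The stored entry
  may stem from another selection with this key, which \<open>same_key_usage\<close> makes
  acceptable.\<close>

definition complete_layer :: "(nat \<Rightarrow> nat) \<Rightarrow> real \<Rightarrow> nat \<Rightarrow> state \<Rightarrow> bool" where
  "complete_layer A B i s \<longleftrightarrow> (\<forall>c. (\<forall>j<i. c j < choices) \<longrightarrow>
     nmem s 68 (key_count * i + (\<Sum>j<i. key j (chosen A B c j))) \<noteq> 0 \<and>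
     rmem s 69 (key_count * i + (\<Sum>j<i. key j (chosen A B c j))) \<le> (\<Sum>j<i. item_cost j (chosen A B c j)))"

text \<open>The state of the table after the choices below \<open>C\<close> for item \<open>i\<close> have been tried, \<open>s\<close> being
  the state before.\<close>

definition extended :: "(nat \<Rightarrow> nat) \<Rightarrow> real \<Rightarrow> nat \<Rightarrow> nat \<Rightarrow> state \<Rightarrow> state \<Rightarrow> bool" where
  "extended A B i C s s' \<longleftrightarrow>
     (\<forall>x<key_count * (i + 1). nmem s' 68 x = nmem s 68 x \<and> rmem s' 69 x = rmem s 69 x \<and>
        rmem s' 70 x = rmem s 70 x \<and> nmem s' 71 x = nmem s 71 x) \<and>
     (\<forall>x\<ge>key_count * (i + 2). nmem s' 68 x = nmem s 68 x) \<and> sound_layer A B (Suc i) s' \<and>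
     (\<forall>c<C. \<forall>u<key_count. nmem s 68 (key_count * i + u) \<noteq> 0 \<longrightarrow> u + key i (choice_value A B i c) < key_count \<longrightarrow>
        nmem s' 68 (key_count * (i + 1) + (u + key i (choice_value A B i c))) \<noteq> 0 \<and>
        rmem s' 69 (key_count * (i + 1) + (u + key i (choice_value A B i c)))
          \<le> rmem s 69 (key_count * i + u) + item_cost i (choice_value A B i c))"

text \<open>An entry is either kept, or new, and then its selection extends that of its source by
  the choice \<open>C\<close>. Traces through lower layers survive because the sweep writes to layer
  \<open>i + 1\<close> only.\<close>

lemma sound_layer_relaxed:
  assumes sound: "sound_layer A B i s" "sound_layer A B (Suc i) s'"
    and old: "\<forall>x<key_count * (i + 1). nmem s' 68 x = nmem s 68 x \<and> rmem s' 69 x = rmem s 69 x \<and>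
        rmem s' 70 x = rmem s 70 x \<and> nmem s' 71 x = nmem s 71 x"
    and C: "C < choices" and t: "t = choice_value A B i C"
    and r: "relaxed key_count (key_count * i) (key i t) t (item_cost i t) key_count s' s''"
  shows "sound_layer A B (Suc i) s''"
  unfolding sound_layer_def
proof (intro allI impI)
  let ?U = key_count
  fix v assume v: "v < ?U" and ok: "nmem s'' 68 (?U * Suc i + v) \<noteq> 0"
  let ?x = "?U * Suc i + v"
  have x: "?x = ?U * i + ?U + v" by simp
  have pres: "rmem s'' 70 y = rmem s' 70 y \<and> nmem s'' 71 y = nmem s' 71 y" if "y < ?U * (i + 1)" for y
    using r that unfolding relaxed_def by simp
  consider (keep) "nmem s' 68 ?x \<noteq> 0" "rmem s'' 69 ?x = rmem s' 69 ?x" "rmem s'' 70 ?x = rmem s' 70 ?x"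
      "nmem s'' 71 ?x = nmem s' 71 ?x"
    | (new) u where "u + key i t = v" "nmem s' 68 (?U * i + u) \<noteq> 0"
      "rmem s'' 69 ?x = rmem s' 69 (?U * i + u) + item_cost i t" "rmem s'' 70 ?x = t" "nmem s'' 71 ?x = ?U * i + u"
    using r v ok unfolding relaxed_def x by blast
  then show "\<exists>c. (\<forall>j<Suc i. c j < choices) \<and> (\<Sum>j<Suc i. key j (chosen A B c j)) = v \<and>
       rmem s'' 69 ?x = (\<Sum>j<Suc i. item_cost j (chosen A B c j)) \<and>
       trace ?U (rmem s'' 70) (nmem s'' 71) (chosen A B c) (Suc i) ?x"
  proof cases
    case keep
    obtain c where c: "\<forall>j<Suc i. c j < choices" "(\<Sum>j<Suc i. key j (chosen A B c j)) = v"
       "rmem s' 69 ?x = (\<Sum>j<Suc i. item_cost j (chosen A B c j))"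
       "trace ?U (rmem s' 70) (nmem s' 71) (chosen A B c) (Suc i) ?x"
      using sound(2) v keep(1) unfolding sound_layer_def by blast
    have "trace ?U (rmem s'' 70) (nmem s'' 71) (chosen A B c) i (nmem s' 71 ?x)"
    proof (rule trace_cong)
      show "trace ?U (rmem s' 70) (nmem s' 71) (chosen A B c) i (nmem s' 71 ?x)" using c(4) by (simp only: trace.simps)
    qed (rule pres refl; assumption)+
    then have "trace ?U (rmem s'' 70) (nmem s'' 71) (chosen A B c) (Suc i) ?x"
      using c(4) keep(3,4) by simp
    then show ?thesis using c(1-3) keep(2) by (intro exI[of _ c]) simp
  next
    case new
    have u: "u < ?U" using new(1) v by simp
    have "?U * i + u < ?U * (i + 1)" using u by simp
    then have os: "nmem s' 68 (?U * i + u) = nmem s 68 (?U * i + u)" "rmem s' 69 (?U * i + u) = rmem s 69 (?U * i + u)"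
      using old by blast+
    have "nmem s 68 (?U * i + u) \<noteq> 0" using new(2) os by simp
    then obtain c where c: "\<forall>j<i. c j < choices" "(\<Sum>j<i. key j (chosen A B c j)) = u"
       "rmem s 69 (?U * i + u) = (\<Sum>j<i. item_cost j (chosen A B c j))"
       "trace ?U (rmem s 70) (nmem s 71) (chosen A B c) i (?U * i + u)"
      using sound(1) u unfolding sound_layer_def by blast
    define c' where "c' = c(i := C)"
    have c': "chosen A B c' j = chosen A B c j" if "j < i" for j using that by (simp add: chosen_def c'_def)
    have c'i: "chosen A B c' i = t" by (simp add: chosen_def c'_def t)
    have "trace ?U (rmem s'' 70) (nmem s'' 71) (chosen A B c') i (?U * i + u)"
    proof (rule trace_cong)
      show "trace ?U (rmem s 70) (nmem s 71) (chosen A B c) i (?U * i + u)" by (rule c(4))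
      show "rmem s'' 70 y = rmem s 70 y \<and> nmem s'' 71 y = nmem s 71 y" if "y < ?U * (i + 1)" for y
        using pres[OF that] old that by simp
    qed (rule c')
    then have "trace ?U (rmem s'' 70) (nmem s'' 71) (chosen A B c') (Suc i) ?x"
      using new(4,5) c'i v by simp
    moreover have "(\<Sum>j<Suc i. key j (chosen A B c' j)) = v"
      using c' c(2) new(1) c'i by (simp cong: sum.cong_simp)
    moreover have "rmem s'' 69 ?x = (\<Sum>j<Suc i. item_cost j (chosen A B c' j))"
      using c' c(3) new(3) c'i os by (simp cong: sum.cong_simp)
    moreover have "\<forall>j<Suc i. c' j < choices" using c(1) C by (simp add: c'_def less_Suc_eq)
    ultimately show ?thesis by (intro exI[of _ c']) simp
  qed
qed

lemma extended_Suc: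
  assumes sound: "sound_layer A B i s" and ext: "extended A B i C s s'"
    and C: "C < choices" and t: "t = choice_value A B i C"
    and r: "relaxed key_count (key_count * i) (key i t) t (item_cost i t) key_count s' s''"
  shows "extended A B i (Suc C) s s''"
proof -
  let ?U = key_count
  have old: "\<forall>x<?U * (i + 1). nmem s' 68 x = nmem s 68 x \<and> rmem s' 69 x = rmem s 69 x \<and>
        rmem s' 70 x = rmem s 70 x \<and> nmem s' 71 x = nmem s 71 x"
    using ext unfolding extended_def by blast
  have sound': "sound_layer A B (Suc i) s'" using ext unfolding extended_def by blast
  have e: "?U * (i + 1) = ?U * i + ?U" "?U * (i + 2) = ?U * i + ?U + ?U" by (simp_all add: algebra_simps)
  have x1: "\<forall>x<?U * (i + 1). nmem s'' 68 x = nmem s 68 x \<and> rmem s'' 69 x = rmem s 69 x \<and>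
        rmem s'' 70 x = rmem s 70 x \<and> nmem s'' 71 x = nmem s 71 x"
    using old r unfolding relaxed_def e by simp
  have x2: "\<forall>x\<ge>?U * (i + 2). nmem s'' 68 x = nmem s 68 x"
    using ext r unfolding relaxed_def extended_def e by simp
  have x3: "nmem s'' 68 (?U * (i + 1) + (u + key i (choice_value A B i c))) \<noteq> 0 \<and>
        rmem s'' 69 (?U * (i + 1) + (u + key i (choice_value A B i c)))
          \<le> rmem s 69 (?U * i + u) + item_cost i (choice_value A B i c)"
    if c: "c < Suc C" and u: "u < ?U" "nmem s 68 (?U * i + u) \<noteq> 0" "u + key i (choice_value A B i c) < ?U" for c u
  proof (cases "c = C")
    case True
    have "?U * i + u < ?U * (i + 1)" using u by simp
    then have "nmem s' 68 (?U * i + u) = nmem s 68 (?U * i + u)" "rmem s' 69 (?U * i + u) = rmem s 69 (?U * i + u)"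
      using old by blast+
    moreover have "nmem s'' 68 (?U * i + ?U + (u + key i t)) \<noteq> 0 \<and>
        rmem s'' 69 (?U * i + ?U + (u + key i t)) \<le> rmem s' 69 (?U * i + u) + item_cost i t"
      using r u calculation unfolding relaxed_def True t[symmetric] by (metis (no_types, lifting))
    ultimately show ?thesis unfolding True e t by simp
  next
    case False
    then have "c < C" using c by simp
    then have "nmem s' 68 (?U * (i + 1) + (u + key i (choice_value A B i c))) \<noteq> 0 \<and>
        rmem s' 69 (?U * (i + 1) + (u + key i (choice_value A B i c)))
          \<le> rmem s 69 (?U * i + u) + item_cost i (choice_value A B i c)"
      using ext u unfolding extended_def by blast
    moreover have "nmem s'' 68 (?U * (i + 1) + v) \<noteq> 0 \<and> rmem s'' 69 (?U * (i + 1) + v) \<le> rmem s' 69 (?U * (i + 1) + v)"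
      if "v < ?U" "nmem s' 68 (?U * (i + 1) + v) \<noteq> 0" for v
      using r that unfolding relaxed_def e by blast
    ultimately show ?thesis using u(3) by (meson order_trans)
  qed
  show ?thesis
    unfolding extended_def using x1 x2 x3 sound_layer_relaxed[OF sound sound' old C t r] by blast
qed

text \<open>Key sums of at most \<open>n\<close> commodities stay below \<open>key_count\<close>, so
  the range test in \<open>relax\<close> never discards a selection.\<close>

lemma extended_complete:
  assumes ext: "extended A B i choices s s'" and complete: "complete_layer A B i s" and i: "i < n"
  shows "complete_layer A B (Suc i) s'"
  unfolding complete_layer_def
proof (intro allI impI)
  fix c assume c: "\<forall>j<Suc i. c j < choices"
  let ?u = "\<Sum>j<i. key j (chosen A B c j)"
  have u: "?u < key_count" by (rule sum_key_less) (use i in simp)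
  have "?u + key i (chosen A B c i) = (\<Sum>j<Suc i. key j (chosen A B c j))" by simp
  also have "\<dots> < key_count" by (rule sum_key_less) (use i in simp)
  finally have u': "?u + key i (choice_value A B i (c i)) < key_count" by (simp add: chosen_def)
  have "\<forall>j<i. c j < choices" using c by simp
  then have s: "nmem s 68 (key_count * i + ?u) \<noteq> 0"
    "rmem s 69 (key_count * i + ?u) \<le> (\<Sum>j<i. item_cost j (chosen A B c j))"
    using complete unfolding complete_layer_def by blast+
  have ci: "c i < choices" using c by simp
  have "nmem s' 68 (key_count * (i + 1) + (?u + key i (choice_value A B i (c i)))) \<noteq> 0 \<and>
        rmem s' 69 (key_count * (i + 1) + (?u + key i (choice_value A B i (c i))))
          \<le> rmem s 69 (key_count * i + ?u) + item_cost i (choice_value A B i (c i))"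
    using ext ci u s(1) u' unfolding extended_def by blast
  then show "nmem s' 68 (key_count * Suc i + (\<Sum>j<Suc i. key j (chosen A B c j))) \<noteq> 0 \<and>
     rmem s' 69 (key_count * Suc i + (\<Sum>j<Suc i. key j (chosen A B c j))) \<le> (\<Sum>j<Suc i. item_cost j (chosen A B c j))"
    using s(2) by (simp add: chosen_def[symmetric] add.commute add.left_commute)
qed

lemma table_cong:
  assumes "\<And>a. a \<in> {68..71} \<Longrightarrow> nmem s' a = nmem s a \<and> rmem s' a = rmem s a"
  shows "sound_layer A B i s' = sound_layer A B i s" "complete_layer A B i s' = complete_layer A B i s"
    "extended A B i C s0 s' = extended A B i C s0 s"
proof -
  have e: "nmem s' 68 = nmem s 68" "rmem s' 69 = rmem s 69" "rmem s' 70 = rmem s 70" "nmem s' 71 = nmem s 71"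
    using assms by simp_all
  show s: "sound_layer A B i s' = sound_layer A B i s" for i by (simp only: sound_layer_def e)
  show "complete_layer A B i s' = complete_layer A B i s" by (simp only: complete_layer_def e)
  show "extended A B i C s0 s' = extended A B i C s0 s" by (simp only: extended_def e s)
qed

lemma run_try_choice:
  assumes s: "has_thresholds s" "nmem s 72 0 = i" "nmem s 74 0 = key_count * i" "nmem s 76 0 = i * D"
      "rmem s 77 0 = personal B i" "rmem s 65 0 = B" "nmem s 55 = A" "nmem s 78 0 = C"
    and i: "i < n" and C: "C < choices"
    and sound: "sound_layer A B i s0" and ext: "extended A B i C s0 s"
  shows "run work_bound try_choice s (extended A B i (Suc C) s0)"
  unfolding try_choice_def
proof (rule run_Seq, rule run_frame[OF run_choose_value[OF s(1,8,5,6)]], goal_cases)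
  case (1 s1)
  define t where "t = choice_value A B i C"
  have t1: "rmem s1 79 0 = t" using 1(2) by (simp add: t_def s(7))
  have p1: "has_thresholds s1" by (rule has_thresholds_same[OF s(1) 1(1)]) simp
  have m1: "nmem s1 72 0 = i" "nmem s1 74 0 = key_count * i" "nmem s1 76 0 = i * D"
    using 1(1) s by (simp_all add: same_def)
  have e1: "extended A B i C s0 s1" using ext by (subst table_cong(3)) (use 1(1) in \<open>auto simp: same_def\<close>)
  have q1: "has_parameters s1" using p1 by (simp add: has_thresholds_def)
  show ?case
  proof (rule run_Seq, rule run_frame[OF run_set_key[OF q1 m1(3) t1 i]], goal_cases)
    case (1 s2)
    have q2: "has_parameters s2" by (rule has_parameters_same[OF q1 1(1)]) simp
    have m2: "nmem s2 72 0 = i" "nmem s2 74 0 = key_count * i" "rmem s2 79 0 = t"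
      using 1(1) m1 t1 by (simp_all add: same_def)
    have e2: "extended A B i C s0 s2" using e1 by (subst table_cong(3)) (use 1(1) in \<open>auto simp: same_def\<close>)
    let ?s = "rstore s2 86 0 (item_cost i t)"
    have e3: "extended A B i C s0 ?s" using e2 by (subst table_cong(3)) auto
    have "run work_bound (For 87 (NV 26) relax) ?s
        (relaxed key_count (key_count * i) (key i t) t (item_cost i t) key_count ?s)"
      by (rule run_relax) (use m2 q2 1(2) in \<open>simp_all add: has_parameters_def\<close>)
    then have "run work_bound (For 87 (NV 26) relax) ?s (extended A B i (Suc C) s0)"
      by (rule run_conseq) (rule extended_Suc[OF sound e3 C t_def])
    moreover have "rval (RAdd (RDiv (RArr 1 (NV 72)) (RV 79)) (RMul (RArr 2 (NV 72)) (RV 79))) s2 = item_cost i t"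
      using m2 q2 i by (simp add: has_parameters_def has_input_def item_cost_def)
    ultimately show ?case unfolding set_item_cost_def by (intro run_Seq run_RStore) simp
  qed
qed

lemma run_prepare_item:
  assumes s: "has_thresholds s" "nmem s 72 0 = i" "rmem s 65 0 = B" and i: "i < n"
  shows "run work_bound prepare_item s (\<lambda>s'. nmem s' 74 0 = key_count * i \<and> nmem s' 76 0 = i * D \<and>
    rmem s' 77 0 = personal B i)"
proof -
  have "i \<le> work_bound" using i parameter_bounds(1) by simp
  then show ?thesis
    unfolding prepare_item_def
    by (intro run_Seq run_Mul[where a = key_count and b = i, OF _ _ _ _ refl]
        run_Mul[where a = i and b = D, OF _ _ _ _ refl] run_RStore)
      (use s i parameter_bounds in \<open>simp_all add: same_def has_thresholds_def has_parameters_def personal_def\<close>)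
qed

lemma run_fill_table:
  assumes s: "has_thresholds s" "rmem s 65 0 = B" "nmem s 55 = A" "nmem s 68 0 = 1" "rmem s 69 0 = 0"
    "\<forall>x. 0 < x \<longrightarrow> x < key_count * (n + 1) \<longrightarrow> nmem s 68 x = 0"
  shows "run work_bound fill_table s (\<lambda>s'. sound_layer A B n s' \<and> complete_layer A B n s')"
  unfolding fill_table_def
proof (rule run_For[where N = n and Inv = "\<lambda>i s'. sound_layer A B i s' \<and> complete_layer A B i s' \<and>
    (\<forall>x. key_count * (i + 1) \<le> x \<longrightarrow> x < key_count * (n + 1) \<longrightarrow> nmem s' 68 x = 0)"], goal_cases)
  case 4
  have "0 < key_count" by (simp add: key_count_def key_base_def)
  moreover have "u = 0" if "u < key_count" "nmem s 68 u \<noteq> 0" for u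
  proof (rule ccontr)
    assume "u \<noteq> 0"
    moreover have "u < key_count * (n + 1)" using that(1) by simp
    ultimately show False using s(6) that(2) by simp
  qed
  ultimately show ?case using s(4-6) by (auto simp: sound_layer_def complete_layer_def)
next
  case (5 i s1)
  have p1: "has_thresholds s1" by (rule has_thresholds_same[OF s(1) 5(2)]) simp
  have m1: "rmem s1 65 0 = B" "nmem s1 55 = A" using 5(2) s by (simp_all add: same_def)
  show ?case
  proof (rule run_Seq, rule run_frame[OF run_prepare_item[OF p1 5(3) m1(1) 5(1)]], goal_cases)
    case (1 s2)
    have p2: "has_thresholds s2" by (rule has_thresholds_same[OF p1 1(1)]) simp
    have m2: "rmem s2 65 0 = B" "nmem s2 55 = A" "nmem s2 72 0 = i" "nmem s2 68 = nmem s1 68"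
      using 1(1) m1 5(3) by (simp_all add: same_def)
    have t2: "sound_layer A B i s2" "complete_layer A B i s2"
      using 5(4) 1(1) by (subst table_cong; auto simp: same_def)+
    have clear: "nmem s2 68 x = 0" if "key_count * (i + 1) \<le> x" "x < key_count * (n + 1)" for x
      using 5(4) m2(4) that by simp
    show ?case
    proof (rule run_For[where N = choices and Inv = "\<lambda>C s'. extended A B i C s2 s'"], goal_cases)
      case 4
      have "key_count * Suc i + v < key_count * (n + 1)" if "v < key_count" for v
      proof -
        have "key_count * Suc i + v < key_count * (Suc i + 1)" using that by simp
        also have "\<dots> \<le> key_count * (n + 1)" using 5(1) by (intro mult_le_mono) auto
        finally show ?thesis .
      qed
      \<comment> \<open>The next layer is still empty, hence vacuously sound before the first choice
        is tried.\<close>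
      then have "sound_layer A B (Suc i) s2" using clear by (auto simp: sound_layer_def)
      then have "extended A B i 0 s2 s2" by (simp add: extended_def)
      then show ?case by (subst table_cong(3)[of _ s2]) auto
    next
      case (5 C s3)
      have p3: "has_thresholds s3" by (rule has_thresholds_same[OF p2 5(2)]) simp
      have m3: "nmem s3 72 0 = i" "nmem s3 74 0 = key_count * i" "nmem s3 76 0 = i * D"
        "rmem s3 77 0 = personal B i" "rmem s3 65 0 = B" "nmem s3 55 = A"
        using 5(2) m2 1(2) by (simp_all add: same_def)
      have "run work_bound try_choice s3 (extended A B i (Suc C) s2)"
        by (rule run_try_choice[OF p3 m3 5(3) \<open>i < n\<close> 5(1) t2(1) 5(4)])
      then show ?case by (rule run_conseq) (subst table_cong(3); auto)
    next
      case (6 s')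
      have c: "complete_layer A B (Suc i) s'" by (rule extended_complete[OF 6(3) t2(2) \<open>i < n\<close>])
      have d: "sound_layer A B (Suc i) s'" using 6(3) by (simp only: extended_def)
      have "nmem s' 68 x = 0" if "key_count * (Suc i + 1) \<le> x" "x < key_count * (n + 1)" for x
      proof -
        have "key_count * (i + 1) \<le> key_count * (Suc i + 1)" by simp
        then have "nmem s2 68 x = 0" using that by (intro clear) linarith+
        then show ?thesis using 6(3) that by (simp add: extended_def)
      qed
      moreover have "sound_layer A B (Suc i) (nstore s' 72 0 (Suc i))" "complete_layer A B (Suc i) (nstore s' 72 0 (Suc i))"
        using c d by (subst table_cong; auto)+
      ultimately show ?case by simp
    qed (use p2 parameter_bounds in \<open>auto simp: same_def has_thresholds_def has_parameters_def\<close>)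
  qed
qed (use s parameter_bounds in \<open>auto simp: same_def has_thresholds_def has_parameters_def\<close>)

end

section \<open>Extraction and search\<close>

text \<open>Pass \<open>j\<close> recovers commodity \<open>n - 1 - j\<close>, as predecessors lead
  downwards from the last layer. The stretch by \<open>1 + 3 / E\<close> compensates the consumption
  \<open>(1 + 3 e) beta\<close> permitted by \<open>same_key_usage\<close>.\<close>

definition backtrack_step :: com where
  "backtrack_step = RStore 93 (NSub (NSub (NV 10) (NLit 1)) (NV 92))
       (RMul (RAdd (ROfNat (NLit 1)) (RDiv (ROfNat (NLit 3)) (ROfNat (NV 12)))) (RArr 70 (NV 91))) ;;
     NSet 91 (NArr 71 (NV 91))"

definition backtrack :: com where
  "backtrack = NSet 91 (NAdd (NV 89) (NV 90)) ;; For 92 (NV 10) backtrack_step"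

definition add_usage :: com where
  "add_usage = RSet 96 (RAdd (RV 96) (RDiv (RArr 3 (NV 97)) (RArr 93 (NV 98)))) ;;
     NSet 97 (NAdd (NV 97) (NV 11))"

definition check_resource :: com where
  "check_resource = RSet 96 (ROfNat (NLit 0)) ;; NSet 97 (NV 95) ;; For 98 (NV 10) add_usage ;;
     Cond (RLess (RArr 4 (NV 95)) (RV 96)) (NSet 94 (NLit 1)) Skip"

text \<open>Capacities are tested exactly, so feasibility of the output does not rest on rounded
  data; the rounding only has to guarantee that the test succeeds for the relevant keys.\<close>

definition check_policy :: com where
  "check_policy = NSet 94 (NLit 0) ;; For 95 (NV 11) check_resource"

text \<open>Candidates are compared by their estimate, array 66 plus the table cost, and not by
  their true cost.\<close>

definition record_policy :: com where
  "record_policy = RSet 99 (RAdd (RV 66) (RArr 69 (NAdd (NV 89) (NV 90)))) ;;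
     Cond (BAnd (NLess (NV 94) (NLit 1)) (BNot (BAnd (NLess (NLit 0) (NV 100)) (BNot (RLess (RV 99) (RV 101))))))
       (NSet 100 (NLit 1) ;; RSet 101 (RV 99) ;; For 102 (NV 10) (RStore 5 (NV 102) (RArr 93 (NV 102))))
       Skip"

definition try_entry :: com where
  "try_entry = Cond (NLess (NLit 0) (NArr 68 (NAdd (NV 89) (NV 90))))
     (backtrack ;; check_policy ;; record_policy) Skip"

definition scan_table :: com where
  "scan_table = Mul 88 89 (NV 26) (NV 10) ;; For 90 (NV 26) try_entry"

definition iteration :: com where
  "iteration = decode ;; multiply_digits ;; Cond (NLess (NLit 0) (NV 56))
     (count_period ;; set_grid ;; clear_table ;; fill_table ;; scan_table) Skip"

definition program :: com where
  "program = read_input ;; set_parameters ;; set_thresholds ;; For 50 (NV 22) iteration"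

lemma writes_extraction [simp]:
  "writes backtrack_step = {91, 93}" "writes backtrack = {91, 92, 93}" "writes add_usage = {96, 97}"
  "writes check_resource = {94, 96, 97, 98}" "writes check_policy = {94, 95, 96, 97, 98}"
  "writes record_policy = {5, 99, 100, 101, 102}"
  "writes try_entry = {5, 91, 92, 93, 94, 95, 96, 97, 98, 99, 100, 101, 102}"
  "writes scan_table = {5, 88, 89, 90, 91, 92, 93, 94, 95, 96, 97, 98, 99, 100, 101, 102}"
  by (auto simp: backtrack_step_def backtrack_def add_usage_def check_resource_def check_policy_def
    record_policy_def try_entry_def scan_table_def)

lemma writes_iteration: "a \<in> writes iteration \<Longrightarrow> a = 5 \<or> a \<in> {46} \<union> {51..}"
  by (auto simp: iteration_def)

lemma digits_exist:
  "(\<And>j. j < m \<Longrightarrow> A j < b) \<Longrightarrow> \<exists>z<b ^ m. \<forall>j<m. z div b ^ j mod b = A j" for b :: nat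
proof (induction m)
  case (Suc m)
  then obtain z where z: "z < b ^ m" "\<forall>j<m. z div b ^ j mod b = A j" by auto
  have b: "b > 0" and Am: "A m < b" using Suc.prems[of m] by auto
  let ?z = "z + A m * b ^ m"
  have "?z < (1 + A m) * b ^ m" using z(1) by simp
  also have "\<dots> \<le> b * b ^ m" using Am by (intro mult_le_mono1) simp
  finally have lt: "?z < b ^ Suc m" by simp
  have "?z div b ^ j mod b = A j" if "j < Suc m" for j
  proof (cases "j = m")
    case True
    have "?z div b ^ m = A m" using z(1) b by simp
    then show ?thesis using True Am by simp
  next
    case False
    then have j: "j < m" using that by simp
    \<comment> \<open>The new top digit changes \<open>?z div b ^ j\<close> by a multiple of
      \<open>b\<close>, which lower digits do not see.\<close>
    have "b ^ m = b ^ j * (b * b ^ (m - Suc j))"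
      using j by (simp flip: power_Suc power_add)
    then have "?z = z + b ^ j * (b * (b ^ (m - Suc j) * A m))" by (simp only: mult_ac)
    then have "?z div b ^ j = z div b ^ j + b * (b ^ (m - Suc j) * A m)"
      using b div_mult_self2[of "b ^ j" z "b * (b ^ (m - Suc j) * A m)"] by (simp only: add.commute) simp
    then show ?thesis using z(2) j by simp
  qed
  then show ?case using lt by blast
qed simp

lemma cost_cong: "(\<And>i. i < ncom I \<Longrightarrow> T i = T' i) \<Longrightarrow> cost I T = cost I T'"
proof -
  assume a: "\<And>i. i < ncom I \<Longrightarrow> T i = T' i"
  then have "order_count (ncom I) T = order_count (ncom I) T'" by (simp add: order_count_def fun_eq_iff)
  then show ?thesis using a by (simp add: cost_def joint_ordering_cost_def)
qed

lemma feasible_cong: "(\<And>i. i < ncom I \<Longrightarrow> T i = T' i) \<Longrightarrow> feasible I T = feasible I T'"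
  by (simp add: feasible_def)

section \<open>Correctness of extraction and search\<close>

context instance_with_accuracy
begin

text \<open>The factor between true cost and estimate is that of \<open>candidate_cost\<close> for
  the stretch \<open>x = 1 + 3 e\<close>.\<close>

definition valid_best :: "state \<Rightarrow> bool" where
  "valid_best s \<longleftrightarrow> (nmem s 100 0 \<noteq> 0 \<longrightarrow>
     feasible I (rmem s 5) \<and> cost I (rmem s 5) \<le> (1 + 3 * e) * (1 + e) * rmem s 101 0)"

definition found :: "state \<Rightarrow> real \<Rightarrow> bool" where
  "found s b \<longleftrightarrow> nmem s 100 0 \<noteq> 0 \<and> rmem s 101 0 \<le> b"

text \<open>A preorder that permits specifying commands independently of what was recorded earlier:
  the record stays valid and no bound already reached is lost.\<close>

definition improves :: "state \<Rightarrow> state \<Rightarrow> bool" where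
  "improves s s' \<longleftrightarrow> (valid_best s \<longrightarrow> valid_best s') \<and> (\<forall>b. found s b \<longrightarrow> found s' b)"

lemma improves_trans: "improves s s1 \<Longrightarrow> improves s1 s2 \<Longrightarrow> improves s s2"
  by (simp add: improves_def)

lemma improves_refl: "improves s s"
  by (simp add: improves_def)

lemma best_cong:
  assumes "nmem s' 100 = nmem s 100" "rmem s' 101 = rmem s 101" "rmem s' 5 = rmem s 5"
  shows "valid_best s' = valid_best s" "found s' = found s"
  using assms by (simp_all add: valid_best_def found_def[abs_def])

lemma improves_same:
  assumes "same W s s'" "5 \<notin> W" "100 \<notin> W" "101 \<notin> W"
  shows "improves s s'"
proof -
  have "nmem s' 100 = nmem s 100" "rmem s' 101 = rmem s 101" "rmem s' 5 = rmem s 5"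
    using assms by (simp_all add: same_def)
  then show ?thesis by (simp only: improves_def best_cong[of s' s] simp_thms)
qed

definition usage_within :: "real \<Rightarrow> (nat \<Rightarrow> real) \<Rightarrow> bool" where
  "usage_within x T \<longleftrightarrow> (\<forall>d<D. (\<Sum>i<n. alpha I i d / T i) \<le> x * beta I d)"

lemma run_backtrack:
  assumes s: "has_parameters s" "nmem s 89 0 = key_count * n" "nmem s 90 0 = u"
    and tr: "trace key_count (rmem s 70) (nmem s 71) V n (key_count * n + u)"
  shows "run work_bound backtrack s (\<lambda>s'. \<forall>i<n. rmem s' 93 i = (1 + 3 * e) * V i)"
  unfolding backtrack_def
proof (rule run_Seq, rule run_NStore, rule run_For[where N = n and
    Inv = "\<lambda>j s'. trace key_count (rmem s 70) (nmem s 71) V (n - j) (nmem s' 91 0) \<and>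
      (\<forall>i. n - j \<le> i \<longrightarrow> i < n \<longrightarrow> rmem s' 93 i = (1 + 3 * e) * V i)"], goal_cases)
  case (5 j s1)
  have m: "rmem s1 70 = rmem s 70" "nmem s1 71 = nmem s 71" "nmem s1 10 0 = n" "nmem s1 12 0 = E"
    using 5(2) s by (simp_all add: same_def has_parameters_def)
  obtain i where i: "n - j = Suc i" using 5(1) by (cases "n - j") auto
  have ii: "n - Suc 0 - j = i" "n - Suc j = i" using i by simp_all
  have t: "rmem s 70 (nmem s1 91 0) = V i" "trace key_count (rmem s 70) (nmem s 71) V i (nmem s 71 (nmem s1 91 0))"
    using 5(4) unfolding i by simp_all
  show ?case
    unfolding backtrack_step_def
    by (intro run_Seq run_NStore run_RStore)
      (use 5(3,4) m t in \<open>auto simp: i ii not_le less_Suc_eq_le le_Suc_eq Suc_le_eq\<close>)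
qed (use s tr parameter_bounds(1) in \<open>simp_all add: same_def has_parameters_def\<close>)

lemma run_check_policy:
  assumes s: "has_parameters s"
  shows "run work_bound check_policy s (\<lambda>s'. (nmem s' 94 0 = 0) = usage_within 1 (rmem s 93))"
  unfolding check_policy_def
proof (rule run_Seq, rule run_NStore, rule run_For[where N = D and
    Inv = "\<lambda>j s'. (nmem s' 94 0 = 0) = (\<forall>d<j. (\<Sum>i<n. alpha I i d / rmem s 93 i) \<le> beta I d)"], goal_cases)
  case (5 d s1)
  have sm: "same {94, 95, 96, 97, 98} s s1" using 5(2) by (auto simp: same_def)
  have p1: "has_parameters s1" by (rule has_parameters_same[OF s sm]) simp
  have m1: "rmem s1 93 = rmem s 93" using sm by (simp add: same_def)
  show ?case
    unfolding check_resource_def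
  proof (rule run_Seq, rule run_RStore, rule run_Seq, rule run_NStore, rule run_Seq, rule run_For[where N = n and
      Inv = "\<lambda>j s'. rmem s' 96 0 = (\<Sum>i<j. alpha I i d / rmem s 93 i) \<and> nmem s' 97 0 = j * D + d"], goal_cases)
    case (5 j s2)
    have sm2: "same {96, 97, 98} s1 s2" using 5(2) by (auto simp: same_def)
    have p2: "has_parameters s2" by (rule has_parameters_same[OF p1 sm2]) simp
    have "rmem s2 93 = rmem s 93" using sm2 m1 by (simp add: same_def)
    then show ?case
      unfolding add_usage_def using 5 p2 \<open>d < D\<close>
      by (intro run_Seq run_RStore run_NStore) (simp add: has_parameters_def has_input_def)
  next
    case (6 s2)
    have sm2: "same {96, 97, 98} s1 s2" using 6(1) by (auto simp: same_def)
    have p2: "has_parameters s2" by (rule has_parameters_same[OF p1 sm2]) simp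
    have "nmem s2 94 = nmem s1 94" "nmem s2 95 0 = d" using sm2 5(3) by (simp_all add: same_def)
    then show ?case
      using 5(1,4) 6(3) p2
      by (intro run_Cond run_NStore run_Skip) (auto simp: less_Suc_eq has_parameters_def has_input_def not_less)
  qed (use p1 5(3) parameter_bounds(1) in \<open>simp_all add: same_def has_parameters_def\<close>)
qed (use s work_bound_ge(5) in \<open>simp_all add: same_def has_parameters_def usage_within_def\<close>)

lemma run_record_policy:
  assumes s: "has_parameters s" "nmem s 89 0 = x" "nmem s 90 0 = u" and b: "b = rmem s 66 0 + rmem s 69 (x + u)"
    and ok: "nmem s 94 0 = 0 \<Longrightarrow> feasible I (rmem s 93) \<and> cost I (rmem s 93) \<le> (1 + 3 * e) * (1 + e) * b"
  shows "run work_bound record_policy s (\<lambda>s'. improves s s' \<and> (nmem s 94 0 = 0 \<longrightarrow> found s' b))"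
  unfolding record_policy_def
proof (rule run_Seq, rule run_RStore, rule run_Cond, goal_cases)
  case 1
  then have c: "nmem s 94 0 = 0" "nmem s 100 0 = 0 \<or> b < rmem s 101 0" using s b by auto
  show ?case
  proof (rule run_Seq, rule run_NStore, rule run_Seq, rule run_RStore, rule run_For[where N = n and
      Inv = "\<lambda>j s'. \<forall>i<j. rmem s' 5 i = rmem s 93 i"], goal_cases)
    case (5 j s1)
    have "rmem s1 93 = rmem s 93" using 5(2) by (simp add: same_def)
    then show ?case using 5(3,4) by (intro run_RStore) (auto simp: less_Suc_eq)
  next
    case (6 s')
    have m: "nmem s' 100 0 = 1" "rmem s' 101 0 = b" using 6(1) s b by (simp_all add: same_def)
    have "cost I (rmem s' 5) = cost I (rmem s 93)" "feasible I (rmem s' 5) = feasible I (rmem s 93)"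
      using 6(3) by (intro cost_cong feasible_cong; simp)+
    then have "valid_best s'" using ok[OF c(1)] m by (simp add: valid_best_def)
    moreover have "found s' b" using m by (simp add: found_def)
    moreover have "found s' b'" if "found s b'" for b' using that m c(2) by (auto simp: found_def)
    ultimately show ?case by (simp add: improves_def)
  qed (use s parameter_bounds(1) in \<open>simp_all add: same_def has_parameters_def\<close>)
next
  case 2
  then have c: "nmem s 94 0 = 0 \<longrightarrow> nmem s 100 0 \<noteq> 0 \<and> \<not> b < rmem s 101 0" using s b by auto
  have "improves s (rstore s 99 y v)" for y v
    by (rule improves_same[of "{99}"]) (auto simp: same_def)
  then show ?case using c by (intro run_Skip) (auto simp: found_def)
qed

text \<open>The entry stems from some selection, whereas the guarantee concerns any selection with
  the same key. Equality of keys carries approximate feasibility from the latter to the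
  former.\<close>

lemma run_try_entry:
  assumes s: "has_parameters s" "nmem s 89 0 = key_count * n" "nmem s 90 0 = u" and u: "u < key_count"
    and A: "\<And>l. l \<le> buckets \<Longrightarrow> A l > 0" and B: "B > 0"
    and est: "\<And>c. estimate A B c = rmem s 66 0 + (\<Sum>i<n. item_cost i (chosen A B c i))"
    and sound: "sound_layer A B n s"
  shows "run work_bound try_entry s (\<lambda>s'. improves s s' \<and> (nmem s 68 (key_count * n + u) \<noteq> 0 \<longrightarrow>
    (\<forall>c. (\<forall>i<n. c i < choices) \<longrightarrow> (\<Sum>i<n. key i (chosen A B c i)) = u \<longrightarrow> usage_within (1 + 2 * e) (chosen A B c) \<longrightarrow>
      found s' (rmem s 66 0 + rmem s 69 (key_count * n + u)))))"
  unfolding try_entry_def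
proof (rule run_Cond, goal_cases)
  case 2
  then show ?case using s by (intro run_Skip) (simp add: improves_refl)
next
  case 1
  let ?x = "key_count * n + u"
  have "nmem s 68 ?x \<noteq> 0" using 1 s by simp
  then obtain c where c: "\<forall>j<n. c j < choices" "(\<Sum>j<n. key j (chosen A B c j)) = u"
       "rmem s 69 ?x = (\<Sum>j<n. item_cost j (chosen A B c j))"
       "trace key_count (rmem s 70) (nmem s 71) (chosen A B c) n ?x"
    using sound u unfolding sound_layer_def by blast
  have pos: "chosen A B c' i > 0" if "i < n" "\<forall>j<n. c' j < choices" for c' i
    unfolding chosen_def using that A B by (intro choice_value_pos) auto
  define b where "b = rmem s 66 0 + rmem s 69 ?x"
  have b: "b = estimate A B c" using est[of c] c(3) by (simp add: b_def)
  let ?S = "\<lambda>i. (1 + 3 * e) * chosen A B c i"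
  have x: "1 \<le> 1 + 3 * e" using e_pos by linarith
  have costS: "cost I ?S \<le> (1 + 3 * e) * (1 + e) * b"
    unfolding b chosen_def using c(1) A B by (intro candidate_cost[OF _ _ _ x]) auto
  \<comment> \<open>A consumption of at most \<open>(1 + 3 e) beta\<close> before stretching is at
    most \<open>beta\<close> afterwards.\<close>
  have within: "usage_within 1 ?S" if "\<forall>i<n. c' i < choices" "(\<Sum>i<n. key i (chosen A B c' i)) = u"
      "usage_within (1 + 2 * e) (chosen A B c')" for c'
    unfolding usage_within_def
  proof (intro allI impI)
    fix d assume d: "d < D"
    have "(\<Sum>i<n. alpha I i d / chosen A B c i) \<le> (1 + 3 * e) * beta I d"
      using that c(1,2) d by (intro same_key_usage[of "chosen A B c" "chosen A B c'"] pos) (auto simp: usage_within_def)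
    moreover have "(\<Sum>i<n. alpha I i d / ?S i) = (\<Sum>i<n. alpha I i d / chosen A B c i) / (1 + 3 * e)"
      unfolding sum_divide_distrib by (simp add: mult.commute)
    ultimately show "(\<Sum>i<n. alpha I i d / ?S i) \<le> 1 * beta I d"
      using x by (simp only: pos_divide_le_eq[of "1 + 3 * e"] mult_1 mult.commute[of "beta I d"])
  qed
  show ?case
  proof (rule run_Seq, rule run_frame[OF run_backtrack[OF s c(4)]], rule run_Seq, goal_cases)
    case (1 s1)
    have p1: "has_parameters s1" by (rule has_parameters_same[OF s(1) 1(1)]) simp
    have w: "usage_within 1 (rmem s1 93) = usage_within 1 ?S"
      using 1(2) by (simp add: usage_within_def)
    show ?case
    proof (rule run_frame[OF run_check_policy[OF p1]], goal_cases)
      case (1 s2)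
      have p2: "has_parameters s2" by (rule has_parameters_same[OF p1 1(1)]) simp
      have m2: "rmem s2 93 = rmem s1 93" using 1(1) by (simp add: same_def)
      have sm: "same {91, 92, 93, 94, 95, 96, 97, 98} s s2"
        using \<open>same (writes backtrack) s s1\<close> 1(1) by (simp add: same_def)
      have S: "rmem s2 93 i = ?S i" if "i < n" for i using that \<open>\<forall>i<n. rmem s1 93 i = ?S i\<close> by (simp add: m2)
      have i2: "improves s s2" by (rule improves_same[OF sm]) auto
      have "run work_bound record_policy s2 (\<lambda>s'. improves s2 s' \<and> (nmem s2 94 0 = 0 \<longrightarrow> found s' b))"
      proof (rule run_record_policy[OF p2])
        show "nmem s2 89 0 = key_count * n" "nmem s2 90 0 = u" "b = rmem s2 66 0 + rmem s2 69 (key_count * n + u)"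
          using sm s by (simp_all add: same_def b_def)
        assume "nmem s2 94 0 = 0"
        then have "usage_within 1 ?S" using 1(2) w by simp
        moreover have "?S i > 0" if "i < n" for i
          using pos[OF that c(1)] x by (intro mult_pos_pos; linarith)
        ultimately have "feasible I ?S" by (simp add: feasible_def usage_within_def)
        then show "feasible I (rmem s2 93) \<and> cost I (rmem s2 93) \<le> (1 + 3 * e) * (1 + e) * b"
          using costS cost_cong[of I "rmem s2 93" ?S] feasible_cong[of I "rmem s2 93" ?S] S by simp
      qed
      then show ?case
      proof (rule run_conseq)
        fix s' assume s': "improves s2 s' \<and> (nmem s2 94 0 = 0 \<longrightarrow> found s' b)"
        have "found s' b" if "\<forall>i<n. c' i < choices" "(\<Sum>i<n. key i (chosen A B c' i)) = u"
            "usage_within (1 + 2 * e) (chosen A B c')" for c'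
          using within[OF that] s' 1(2) w by simp
        then show "improves s s' \<and> (nmem s 68 ?x \<noteq> 0 \<longrightarrow> (\<forall>c. (\<forall>i<n. c i < choices) \<longrightarrow>
          (\<Sum>i<n. key i (chosen A B c i)) = u \<longrightarrow> usage_within (1 + 2 * e) (chosen A B c) \<longrightarrow>
          found s' (rmem s 66 0 + rmem s 69 ?x)))"
          using improves_trans[OF i2] s' unfolding b_def by blast
      qed
    qed
  qed
qed

lemma run_scan_table:
  assumes s: "has_parameters s"
    and A: "\<And>l. l \<le> buckets \<Longrightarrow> A l > 0" and B: "B > 0"
    and est: "\<And>c. estimate A B c = rmem s 66 0 + (\<Sum>i<n. item_cost i (chosen A B c i))"
    and sound: "sound_layer A B n s" and complete: "complete_layer A B n s"
  shows "run work_bound scan_table s (\<lambda>s'. improves s s' \<and> (\<forall>c. (\<forall>i<n. c i < choices) \<longrightarrow>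
    usage_within (1 + 2 * e) (chosen A B c) \<longrightarrow> found s' (estimate A B c)))"
  unfolding scan_table_def
proof (rule run_Seq, rule run_Mul[where a = key_count and b = n, OF _ _ _ _ refl], goal_cases)
  case (5 s0)
  let ?x = "\<lambda>u. key_count * n + u"
  have p0: "has_parameters s0" by (rule has_parameters_same[OF s 5(1)]) simp
  have t0: "nmem s0 68 = nmem s 68" "rmem s0 69 = rmem s 69" "rmem s0 66 = rmem s 66"
    using 5(1) by (simp_all add: same_def)
  have i0: "improves s s0" by (rule improves_same[OF 5(1)]) auto
  have sound0: "sound_layer A B n s0" using sound by (subst table_cong(1)) (use 5(1) in \<open>auto simp: same_def\<close>)
  show ?case
  proof (rule run_For[where N = key_count and Inv = "\<lambda>v s'. improves s s' \<and> (\<forall>u<v. nmem s 68 (?x u) \<noteq> 0 \<longrightarrow>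
    (\<forall>c. (\<forall>i<n. c i < choices) \<longrightarrow> (\<Sum>i<n. key i (chosen A B c i)) = u \<longrightarrow> usage_within (1 + 2 * e) (chosen A B c) \<longrightarrow>
      found s' (rmem s 66 0 + rmem s 69 (?x u))))"], goal_cases)
    case 4
    have "improves s0 (nstore s0 90 0 0)" by (rule improves_same[of "{90}"]) (auto simp: same_def)
    then show ?case using improves_trans[OF i0] by simp
  next
    case (5 v s1)
    have p1: "has_parameters s1" by (rule has_parameters_same[OF p0 5(2)]) simp
    have m1: "nmem s1 89 0 = key_count * n" "nmem s1 68 = nmem s 68" "rmem s1 69 = rmem s 69" "rmem s1 66 = rmem s 66"
      using 5(2) t0 \<open>nmem s0 89 0 = key_count * n\<close> by (simp_all add: same_def)
    have sound1: "sound_layer A B n s1" using sound0 by (subst table_cong(1)) (use 5(2) in \<open>auto simp: same_def\<close>)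
    have est1: "estimate A B c = rmem s1 66 0 + (\<Sum>i<n. item_cost i (chosen A B c i))" for c
      using est m1 by simp
    show ?case
    proof (rule run_conseq[OF run_try_entry[OF p1 m1(1) 5(3,1) A B est1 sound1]], goal_cases)
      case (2 s2)
      let ?s = "nstore s2 90 0 (Suc v)"
      have "improves s2 ?s" by (rule improves_same[of "{90}"]) (auto simp: same_def)
      then have imp: "improves s1 ?s" using 2 improves_trans by blast
      have fnd: "found ?s = found s2" by (rule best_cong(2)) auto
      show ?case
      proof (intro conjI allI impI)
        show "improves s ?s" using 5(4) imp improves_trans by blast
        fix u c assume u: "u < Suc v" "nmem s 68 (?x u) \<noteq> 0" and c: "\<forall>i<n. c i < choices"
          "(\<Sum>i<n. key i (chosen A B c i)) = u" "usage_within (1 + 2 * e) (chosen A B c)"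
        show "found ?s (rmem s 66 0 + rmem s 69 (?x u))"
        proof (cases "u = v")
          case True
          then show ?thesis using 2 u c unfolding m1 fnd by simp
        next
          case False
          then have "u < v" using u(1) by simp
          from mp[OF spec[OF conjunct2[OF 5(4)], of u] this]
          have "found s1 (rmem s 66 0 + rmem s 69 (?x u))" using u c by simp
          then show ?thesis using imp by (simp add: improves_def)
        qed
      qed
    qed
  next
    case (6 s')
    have "found s' (estimate A B c)" if c: "\<forall>i<n. c i < choices" "usage_within (1 + 2 * e) (chosen A B c)" for c
    proof -
      \<comment> \<open>The key of the given selection singles out the entry to look at; by
        completeness it is present and not more expensive than the selection.\<close>
      let ?u = "\<Sum>i<n. key i (chosen A B c i)"
      have u: "?u < key_count" by (rule sum_key_less) simp
      note cm = mp[OF spec[OF complete[unfolded complete_layer_def], of c] c(1)]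
      note mp[OF spec[OF conjunct2[OF 6(3)], of ?u] u]
      from spec[OF mp[OF this conjunct1[OF cm]], of c] have "found s' (rmem s 66 0 + rmem s 69 (?x ?u))"
        using c by simp
      then show ?thesis using conjunct2[OF cm] est[of c] by (simp add: found_def)
    qed
    then show ?case using conjunct1[OF 6(3)] by simp
  qed (use p0 work_bound_ge(2)[OF order_refl] in \<open>simp_all add: same_def has_parameters_def\<close>)
qed (use s parameter_bounds(1) in \<open>simp_all add: same_def has_parameters_def\<close>)

lemma run_evaluate:
  assumes s: "has_thresholds s" and A: "\<And>l. l \<le> buckets + 1 \<Longrightarrow> nmem s 55 l > 0"
    and P: "nmem s 56 0 = (\<Prod>l<buckets + 2. nmem s 55 l)" "nmem s 56 0 \<le> work_bound"
  defines "B \<equiv> grid_base (nmem s 55 (buckets + 1))"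
  shows "run work_bound (count_period ;; set_grid ;; clear_table ;; fill_table ;; scan_table) s
    (\<lambda>s'. improves s s' \<and> (\<forall>c. (\<forall>i<n. c i < choices) \<longrightarrow>
      usage_within (1 + 2 * e) (chosen (nmem s 55) B c) \<longrightarrow> found s' (estimate (nmem s 55) B c)))"
proof -
  let ?A = "nmem s 55"
  have A': "?A l > 0" if "l \<le> buckets" for l using A[of l] that by simp
  have ps: "has_parameters s" using s by (simp add: has_thresholds_def)
  have P0: "nmem s 56 0 > 0" unfolding P(1) using A by (intro prod_pos) auto
  have B: "B > 0"
    unfolding B_def grid_base_def using base_pos n_pos E_pos A[of "buckets + 1"] by simp
  have est: "estimate ?A B c = K0 * (real (period_count (buckets + 1) ?A (nmem s 56 0)) /
      (real (nmem s 56 0) * (B / ?A buckets))) + (\<Sum>i<n. item_cost i (chosen ?A B c i))" for c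
    unfolding chosen_def
  proof (rule estimate_period[OF _ P0 B])
    fix l assume "l \<le> buckets"
    then show "?A l > 0 \<and> ?A l dvd nmem s 56 0"
      unfolding P(1) using A'[of l] by (intro conjI dvd_prodI) simp_all
  qed
  show ?thesis
  proof (rule run_Seq, rule run_count_period[OF ps A' P(2)], assumption, goal_cases)
    case (1 s1)
    have s1: "has_thresholds s1" by (rule has_thresholds_same[OF s 1(1)]) simp
    have m1: "nmem s1 55 = ?A" "nmem s1 56 = nmem s 56" using 1(1) by (simp_all add: same_def)
    show ?case
    proof (rule run_Seq, rule run_set_grid[OF s1], goal_cases)
      case (1 s2)
      have s2: "has_parameters s2" using has_thresholds_same[OF s1 1(1)] by (simp add: has_thresholds_def)
      have m2: "nmem s2 55 = ?A" "rmem s2 65 0 = B" "rmem s2 66 0 = K0 * (real (period_count (buckets + 1) ?A (nmem s 56 0)) /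
          (real (nmem s 56 0) * (B / ?A buckets)))"
        using 1 m1 \<open>nmem s1 60 0 = _\<close> by (simp_all add: same_def B_def)
      have sm2: "same {46, 60, 61, 62, 63, 64, 65, 66} s s2"
        using \<open>same (writes count_period) s s1\<close> 1(1) by (simp add: same_def)
      show ?case
      proof (rule run_Seq, rule run_clear_table[OF s2], goal_cases)
        case (1 s3)
        have sm3: "same {46, 60, 61, 62, 63, 64, 65, 66, 67, 68, 69} s s3" using sm2 1(1) by (simp add: same_def)
        have s3: "has_thresholds s3" by (rule has_thresholds_same[OF s sm3]) simp
        have m3: "rmem s3 65 0 = B" "nmem s3 55 = ?A" "rmem s3 66 0 = rmem s2 66 0" using 1(1) m2 by (simp_all add: same_def)
        show ?case
        proof (rule run_Seq, rule run_frame[OF run_fill_table[OF s3 m3(1,2) 1(2-4)]], goal_cases)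
          case (1 s4)
          have sm4: "same ({46} \<union> {60..87}) s s4" using sm3 1(1) by (auto simp: same_def)
          have s4: "has_parameters s4" by (rule has_parameters_same[OF ps sm4]) auto
          have "rmem s4 66 0 = rmem s2 66 0" using 1(1) m3(3) by (simp add: same_def)
          then have est4: "estimate ?A B c = rmem s4 66 0 + (\<Sum>i<n. item_cost i (chosen ?A B c i))" for c
            using est m2(3) by simp
          have i4: "improves s s4" by (rule improves_same[OF sm4]) auto
          have "run work_bound scan_table s4 (\<lambda>s'. improves s4 s' \<and> (\<forall>c. (\<forall>i<n. c i < choices) \<longrightarrow>
              usage_within (1 + 2 * e) (chosen ?A B c) \<longrightarrow> found s' (estimate ?A B c)))"
            by (rule run_scan_table[OF s4 A' B est4 conjunct1[OF 1(2)] conjunct2[OF 1(2)]])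
          then show ?case by (rule run_conseq) (use improves_trans[OF i4] in simp)
        qed
      qed
    qed
  qed
qed

definition decoded :: "nat \<Rightarrow> nat \<Rightarrow> nat" where
  "decoded z j = z div digit_base ^ j mod digit_base"

text \<open>Digits up to \<open>buckets\<close> are the numerators. The grid index sits above them,
  so a decoded code can be used in the place of \<open>A\<close> as it is.\<close>

lemma estimate_cong:
  assumes "\<And>l. l \<le> buckets \<Longrightarrow> A l = A' l"
  shows "estimate A B c = estimate A' B c" "chosen A B c = chosen A' B c"
proof -
  have v: "choice_value A B i c = choice_value A' B i c" for i c
    using assms by (simp add: choice_value_def)
  have "order_density (buckets + 1) (\<lambda>l. real (A l) * (B / A buckets)) =
      order_density (buckets + 1) (\<lambda>l. real (A' l) * (B / A' buckets))"
  proof -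
    have "(\<Union>l<buckets + 1. progression (real (A l) * (B / A buckets))) =
        (\<Union>l<buckets + 1. progression (real (A' l) * (B / A' buckets)))"
      using assms by (intro SUP_cong) auto
    then show ?thesis by (simp only: order_density_def)
  qed
  then show "estimate A B c = estimate A' B c" by (simp add: estimate_def v)
  show "chosen A B c = chosen A' B c" by (simp add: chosen_def v fun_eq_iff)
qed

lemma run_iteration:
  assumes s: "has_thresholds s" and z: "nmem s 50 0 = z" "z < digit_base ^ (buckets + 2)"
  shows "run work_bound iteration s (\<lambda>s'. improves s s' \<and> ((\<forall>j<buckets + 2. decoded z j > 0) \<longrightarrow>
    (\<forall>c. (\<forall>i<n. c i < choices) \<longrightarrow>
      usage_within (1 + 2 * e) (chosen (decoded z) (grid_base (decoded z (buckets + 1))) c) \<longrightarrow>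
      found s' (estimate (decoded z) (grid_base (decoded z (buckets + 1))) c))))"
proof -
  have ps: "has_parameters s" using s by (simp add: has_thresholds_def)
  have zY: "nmem s 50 0 \<le> work_bound" using z by (intro work_bound_ge(1)) simp
  show ?thesis
    unfolding iteration_def
  proof (rule run_Seq, rule run_decode[OF ps zY], goal_cases)
    case (1 s1)
    have s1: "has_thresholds s1" by (rule has_thresholds_same[OF s 1(1)]) simp
    have p1: "has_parameters s1" using s1 by (simp add: has_thresholds_def)
    have d1: "nmem s1 55 j = decoded z j" if "j < buckets + 2" for j
      using 1(2) that z by (simp add: decoded_def)
    have lt: "decoded z j < digit_base" for j using digit_base_pos by (simp add: decoded_def)
    have dl: "nmem s1 55 j \<le> work_bound" if "j < buckets + 2" for j
      using d1[OF that] lt[of j] by (intro work_bound_ge(3)) simp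
    show ?case
    proof (rule run_Seq, rule run_multiply_digits[OF p1], goal_cases)
      case (1 j)
      then show ?case by (rule dl)
    next
      case (2 s2)
      have s2: "has_thresholds s2" by (rule has_thresholds_same[OF s1 2(1)]) simp
      have A: "nmem s2 55 = nmem s1 55" using 2(1) by (simp add: same_def)
      have sm: "same {51, 52, 53, 54, 55, 56, 57, 58, 59} s s2"
        using \<open>same (writes decode) s s1\<close> 2(1) by (simp add: same_def)
      have i2: "improves s s2" by (rule improves_same[OF sm]) auto
      have P: "nmem s2 56 0 = (\<Prod>l<buckets + 2. nmem s2 55 l)" using 2(2) A by simp
      have "nmem s2 56 0 \<le> (\<Prod>l<buckets + 2. digit_base)"
        unfolding P A using d1 lt by (intro prod_mono) (auto simp: less_imp_le)
      then have PY: "nmem s2 56 0 \<le> work_bound" by (intro work_bound_ge(1)) simp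
      show ?case
      proof (rule run_Cond)
        assume "bval (NLess (NLit 0) (NV 56)) s2"
        then have "(\<Prod>l<buckets + 2. nmem s2 55 l) \<noteq> 0" using P by simp
        then have pos: "nmem s2 55 l > 0" if "l < buckets + 2" for l
          using that by (simp only: prod_zero_iff[OF finite_lessThan]) auto
        have e: "estimate (nmem s2 55) B c = estimate (decoded z) B c" "chosen (nmem s2 55) B c = chosen (decoded z) B c"
          for B c using d1 A by (intro estimate_cong; simp)+
        have g: "nmem s2 55 (buckets + 1) = decoded z (buckets + 1)" using d1 A by simp
        have "run work_bound (count_period ;; set_grid ;; clear_table ;; fill_table ;; scan_table) s2
          (\<lambda>s'. improves s2 s' \<and> (\<forall>c. (\<forall>i<n. c i < choices) \<longrightarrow>
            usage_within (1 + 2 * e) (chosen (nmem s2 55) (grid_base (nmem s2 55 (buckets + 1))) c) \<longrightarrow>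
            found s' (estimate (nmem s2 55) (grid_base (nmem s2 55 (buckets + 1))) c)))"
          by (rule run_evaluate[OF s2 _ P PY]) (rule pos, simp)
        then show "run work_bound (count_period ;; set_grid ;; clear_table ;; fill_table ;; scan_table) s2
          (\<lambda>s'. improves s s' \<and> ((\<forall>j<buckets + 2. decoded z j > 0) \<longrightarrow> (\<forall>c. (\<forall>i<n. c i < choices) \<longrightarrow>
            usage_within (1 + 2 * e) (chosen (decoded z) (grid_base (decoded z (buckets + 1))) c) \<longrightarrow>
            found s' (estimate (decoded z) (grid_base (decoded z (buckets + 1))) c))))"
          unfolding e g by (rule run_conseq) (use improves_trans[OF i2] in simp)
      next
        assume "\<not> bval (NLess (NLit 0) (NV 56)) s2"
        then have "(\<Prod>l<buckets + 2. nmem s2 55 l) = 0" using P by simp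
        then have "\<exists>l\<in>{..<buckets + 2}. nmem s2 55 l = 0" by (simp only: prod_zero_iff[OF finite_lessThan])
        then obtain l where l: "l < buckets + 2" "nmem s2 55 l = 0" by blast
        then have "decoded z l = 0" using d1 A by simp
        then have "\<not> (\<forall>j<buckets + 2. decoded z j > 0)" using l(1) by force
        then show "run work_bound Skip s2
          (\<lambda>s'. improves s s' \<and> ((\<forall>j<buckets + 2. decoded z j > 0) \<longrightarrow> (\<forall>c. (\<forall>i<n. c i < choices) \<longrightarrow>
            usage_within (1 + 2 * e) (chosen (decoded z) (grid_base (decoded z (buckets + 1))) c) \<longrightarrow>
            found s' (estimate (decoded z) (grid_base (decoded z (buckets + 1))) c))))"
          using i2 by (intro run_Skip) blast
      qed
    qed
  qed
qed

lemma run_search: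
  assumes s: "has_thresholds s" "nmem s 100 0 = 0"
  shows "run work_bound (For 50 (NV 22) iteration) s (\<lambda>s'. valid_best s' \<and>
    (\<forall>T. feasible I T \<longrightarrow> found s' ((1 + 6 * e) * (1 + 2 * e) * cost I T)))"
proof (rule run_For[where N = "digit_base ^ (buckets + 2)" and Inv = "\<lambda>z s'. valid_best s' \<and> (\<forall>z'<z.
    (\<forall>j<buckets + 2. decoded z' j > 0) \<longrightarrow> (\<forall>c. (\<forall>i<n. c i < choices) \<longrightarrow>
      usage_within (1 + 2 * e) (chosen (decoded z') (grid_base (decoded z' (buckets + 1))) c) \<longrightarrow>
      found s' (estimate (decoded z') (grid_base (decoded z' (buckets + 1))) c)))"], goal_cases)
  case 1
  then show ?case using writes_iteration[of 50] by auto
next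
  case (2 s')
  have "22 \<notin> writes iteration" using writes_iteration[of 22] by auto
  then show ?case using 2 s(1) by (simp add: same_def has_thresholds_def has_parameters_def)
next
  case 3
  then show ?case by (rule work_bound_ge(1)) simp
next
  case 4
  then show ?case using s(2) by (simp add: valid_best_def)
next
  case (5 z s1)
  have s1: "has_thresholds s1" by (rule has_thresholds_same[OF s(1) 5(2)]) (use writes_iteration in force)
  show ?case
  proof (rule run_conseq[OF run_iteration[OF s1 5(3,1)]])
    fix s2
    let ?G = "\<lambda>s' z'. (\<forall>j<buckets + 2. decoded z' j > 0) \<longrightarrow> (\<forall>c. (\<forall>i<n. c i < choices) \<longrightarrow>
      usage_within (1 + 2 * e) (chosen (decoded z') (grid_base (decoded z' (buckets + 1))) c) \<longrightarrow>
      found s' (estimate (decoded z') (grid_base (decoded z' (buckets + 1))) c))"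
    let ?s = "nstore s2 50 0 (Suc z)"
    assume a: "improves s1 s2 \<and> ?G s2 z"
    have fnd: "found ?s = found s2" "valid_best ?s = valid_best s2" by (rule best_cong; simp)+
    have "\<forall>z'<Suc z. ?G s2 z'"
    proof (rule allI, rule impI, goal_cases)
      case (1 z')
      show ?case
      proof (cases "z' = z")
        case True
        then show ?thesis using conjunct2[OF a] by (simp only:)
      next
        case False
        then have "z' < z" using 1 by simp
        with spec[OF conjunct2[OF 5(4)], of z'] have G: "?G s1 z'" by (rule mp)
        have imp: "found s2 b" if "found s1 b" for b using a that by (simp add: improves_def)
        show ?thesis using G by (intro impI allI imp) blast
      qed
    qed
    moreover have "valid_best s2" using 5(4) a by (simp add: improves_def)
    ultimately show "valid_best ?s \<and> (\<forall>z'<Suc z. ?G ?s z')" unfolding fnd by (rule conjI[rotated])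
  qed
next
  case (6 s')
  have "found s' ((1 + 6 * e) * (1 + 2 * e) * cost I T)" if T: "feasible I T" for T
  proof -
    obtain A k c where x: "\<And>l. l \<le> buckets \<Longrightarrow> 0 < A l \<and> A l < digit_base" "0 < k" "k < digit_base"
      "\<And>i. i < n \<Longrightarrow> c i < choices"
      "\<And>i. i < n \<Longrightarrow> choice_value A (grid_base k) i (c i) > 0"
      "\<And>d. d < D \<Longrightarrow> (\<Sum>i<n. alpha I i d / choice_value A (grid_base k) i (c i)) \<le> (1 + 2 * e) * beta I d"
      "estimate A (grid_base k) c \<le> (1 + 6 * e) * (1 + 2 * e) * cost I T"
      by (rule structured_policy[OF T]) (rule that, assumption+)
    \<comment> \<open>The code sought has the numerators as its lower digits and the grid index on
      top.\<close>
    define A' where "A' = A(buckets + 1 := k)"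
    have A': "A' j < digit_base \<and> 0 < A' j" if "j < buckets + 2" for j
      using x(1)[of j] x(2,3) that by (auto simp: A'_def)
    have "\<exists>z<digit_base ^ (buckets + 2). \<forall>j<buckets + 2. z div digit_base ^ j mod digit_base = A' j"
      by (rule digits_exist) (simp add: A')
    then obtain z where z: "z < digit_base ^ (buckets + 2)" "\<forall>j<buckets + 2. z div digit_base ^ j mod digit_base = A' j"
      by (elim exE conjE) (rule that)
    have dz: "decoded z j = A' j" if "j < buckets + 2" for j using z(2) that by (simp add: decoded_def)
    have k: "decoded z (buckets + 1) = k" using dz by (simp add: A'_def)
    have e: "estimate (decoded z) B c = estimate A B c" "chosen (decoded z) B c = chosen A B c" for B
      using dz by (intro estimate_cong; simp add: A'_def)+
    have "\<forall>j<buckets + 2. decoded z j > 0" using dz A' by simp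
    moreover have "usage_within (1 + 2 * e) (chosen (decoded z) (grid_base (decoded z (buckets + 1))) c)"
      unfolding k e using x(6) by (simp add: usage_within_def chosen_def)
    ultimately have "found s' (estimate (decoded z) (grid_base (decoded z (buckets + 1))) c)"
      using mp[OF spec[OF conjunct2[OF 6(3)], of z] z(1)] x(4) by blast
    then show ?thesis using x(7) unfolding k e by (simp add: found_def)
  qed
  then show ?case using conjunct1[OF 6(3)] by simp
qed

end

section \<open>Running time\<close>

context instance_with_accuracy
begin

text \<open>A common period exceeding the sum of all relative demands respects every capacity.
  Existence matters twice: \<open>opt\<close> is an infimum over a non-empty set, and the search is
  sure to record a policy.\<close>

lemma feasible_exists: "\<exists>T. feasible I T"
proof -
  define \<tau> where "\<tau> = 1 + (\<Sum>d<D. (\<Sum>i<n. alpha I i d) / beta I d)"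
  have nonneg: "(\<Sum>i<n. alpha I i d) / beta I d \<ge> 0" if "d < D" for d
    using alpha_nonneg[OF _ that] beta_pos[OF that] by (intro divide_nonneg_pos sum_nonneg) auto
  then have "0 \<le> (\<Sum>d<D. (\<Sum>i<n. alpha I i d) / beta I d)" by (intro sum_nonneg) simp
  then have \<tau>: "\<tau> \<ge> 1" by (simp add: \<tau>_def)
  have "(\<Sum>i<n. alpha I i d / \<tau>) \<le> beta I d" if d: "d < D" for d
  proof -
    have "(\<Sum>i<n. alpha I i d) / beta I d \<le> (\<Sum>d<D. (\<Sum>i<n. alpha I i d) / beta I d)"
      using d nonneg by (intro member_le_sum) auto
    then have "(\<Sum>i<n. alpha I i d) / beta I d \<le> \<tau>" by (simp add: \<tau>_def)
    then show ?thesis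
      using beta_pos[OF d] \<tau> unfolding sum_divide_distrib[symmetric] by (simp add: field_simps)
  qed
  then have "feasible I (\<lambda>_. \<tau>)" using \<tau> by (simp add: feasible_def)
  then show ?thesis by blast
qed

lemma has_input_input_state: "has_input (input_state I \<epsilon>)"
proof -
  have "i * D + d < n * D" if "i < n" "d < D" for i d
  proof -
    have "i * D + d < Suc i * D" using that(2) by simp
    also have "\<dots> \<le> n * D" using that(1) by (intro mult_le_mono1) simp
    finally show ?thesis .
  qed
  then show ?thesis by (simp add: has_input_def input_state_def Let_def)
qed

lemma run_program:
  assumes \<epsilon>: "\<epsilon> > 0" and E: "E = accuracy \<epsilon>"
  shows "run work_bound program (input_state I \<epsilon>) (\<lambda>s'. valid_best s' \<and>
    (\<forall>T. feasible I T \<longrightarrow> found s' ((1 + 6 * e) * (1 + 2 * e) * cost I T)))"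
proof -
  let ?s = "input_state I \<epsilon>"
  have r: "rmem ?s 0 1 = \<epsilon>" and m: "nmem ?s 0 0 = n" "nmem ?s 0 1 = D" "nmem ?s 100 0 = 0"
    by (simp_all add: input_state_def Let_def)
  show ?thesis
    unfolding program_def
  proof (rule run_Seq, rule run_read_input, goal_cases)
    case (3 s1)
    have i1: "has_input s1" by (rule has_input_same[OF has_input_input_state 3(1)]) simp
    have m1: "nmem s1 10 0 = n" "nmem s1 11 0 = D" "nmem s1 12 0 = E" using 3 r m E by simp_all
    have z1: "nmem s1 100 0 = 0" using 3(1) m by (simp add: same_def)
    show ?case
    proof (rule run_Seq, rule run_set_parameters[OF i1 m1], goal_cases)
      case (1 s2)
      have z2: "nmem s2 100 0 = 0" using 1(1) z1 by (simp add: same_def)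
      show ?case
      proof (rule run_Seq, rule run_set_thresholds[OF 1(2)], goal_cases)
        case (1 s3)
        have "nmem s3 100 0 = 0" using 1(1) z2 by (simp add: same_def)
        then show ?case by (rule run_search[OF 1(2)])
      qed
    qed
  qed (use r \<epsilon> E parameter_bounds(2) in simp_all)
qed

text \<open>\<open>digit_base\<close> is at most \<open>n\<^sup>2 * E ^ (9 E\<^sup>2)\<close>, and
  there are \<open>E\<^sup>2 + 2 \<le> 2 E\<^sup>2\<close> digits. The codes thus contribute
  exponents \<open>4 E\<^sup>2\<close> of \<open>n\<close> and \<open>18 E\<^sup>4\<close> of
  \<open>E\<close>, the keys \<open>2 D\<close> to both.\<close>

lemma work_bound_le: "work_bound \<le> n ^ (6 * (D * E ^ 4)) * E ^ (20 * (D * E ^ 4))"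
proof -
  have E4: "4 \<le> E" by (rule E_ge)
  have E1: "1 \<le> E" and n1: "1 \<le> n" and D1: "1 \<le> D" using E_pos n_pos D_pos by auto
  have EE: "4 * E \<le> E ^ 2" "16 \<le> E ^ 2"
    using E4 mult_le_mono[OF E4 E4] by (simp_all add: power2_eq_square)
  have EEE: "4 * E ^ 2 \<le> E ^ 3" using E4 by (simp add: power2_eq_square power3_eq_cube)
  have c: "2 * coeff_bound \<le> E ^ 8"
  proof -
    have "2 * coeff_bound = 2 * E * (E ^ 2 + 1) ^ 2" by (simp add: coeff_bound_def buckets_def)
    also have "\<dots> \<le> E * E * (E ^ 3) ^ 2" using E4 EE EEE by (intro mult_le_mono power_mono) auto
    also have "\<dots> = E ^ 8" by (simp add: eval_nat_numeral)
    finally show ?thesis .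
  qed
  have "denom_bound \<le> (E ^ 8) ^ (E ^ 2 + 1)"
    unfolding denom_bound_def buckets_def by (rule power_mono[OF c]) simp
  then have "digit_base \<le> E * n ^ 2 * E ^ 4 * (E ^ 8) ^ (E ^ 2 + 1)"
    unfolding digit_base_def using E4 by (intro mult_le_mono) auto
  also have "\<dots> = n ^ 2 * (E ^ 1 * E ^ 4 * E ^ (8 * (E ^ 2 + 1)))" by (simp only: power_mult power_one_right mult_ac)
  also have "\<dots> = n ^ 2 * E ^ (1 + 4 + 8 * (E ^ 2 + 1))" by (simp only: power_add)
  also have "\<dots> \<le> n ^ 2 * E ^ (9 * E ^ 2)"
    using EE E1 by (intro mult_le_mono order_refl power_increasing) auto
  finally have d: "digit_base \<le> n ^ 2 * E ^ (9 * E ^ 2)" .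
  have DE: "E ^ 2 \<le> D * E ^ 4" "E ^ 4 \<le> D * E ^ 4" "D \<le> D * E ^ 4"
    using mult_le_mono[OF D1 power_increasing[OF _ E1, of 2 4]] D1 E1 by simp_all
  have "digit_base ^ (buckets + 2) \<le> (n ^ 2 * E ^ (9 * E ^ 2)) ^ (buckets + 2)"
    by (rule power_mono[OF d]) simp
  also have "\<dots> \<le> (n ^ 2 * E ^ (9 * E ^ 2)) ^ (2 * E ^ 2)"
    unfolding buckets_def using n1 E1 EE by (intro power_increasing) (auto simp: Suc_le_eq)
  also have "\<dots> = n ^ (2 * (2 * E ^ 2)) * E ^ (9 * E ^ 2 * (2 * E ^ 2))"
    by (simp only: power_mult_distrib power_mult)
  also have "9 * E ^ 2 * (2 * E ^ 2) = 18 * E ^ 4" using power_add[of E 2 2] by simp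
  finally have z: "digit_base ^ (buckets + 2) \<le> n ^ (4 * E ^ 2) * E ^ (18 * E ^ 4)" by (simp add: mult.assoc)
  have "key_base \<le> n ^ 2 * E ^ 2"
  proof -
    have "key_base = n ^ 2 * (2 * E) + 1" by (simp add: key_base_def cap_def power2_eq_square)
    also have "\<dots> \<le> n ^ 2 * (2 * E) + n ^ 2 * 1" using n1 by (simp add: Suc_le_eq)
    also have "\<dots> = n ^ 2 * (2 * E + 1)" by (simp add: algebra_simps)
    also have "\<dots> \<le> n ^ 2 * E ^ 2" using EE E1 by (intro mult_le_mono2) linarith
    finally show ?thesis .
  qed
  then have "key_count \<le> (n ^ 2 * E ^ 2) ^ D" unfolding key_count_def by (intro power_mono) auto
  also have "\<dots> = n ^ (2 * D) * E ^ (2 * D)" by (simp only: power_mult_distrib power_mult)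
  finally have "work_bound \<le> (n ^ (4 * E ^ 2) * E ^ (18 * E ^ 4)) * (n ^ (2 * D) * E ^ (2 * D))"
    unfolding work_bound_def by (rule mult_le_mono[OF z])
  also have "\<dots> = n ^ (4 * E ^ 2 + 2 * D) * E ^ (18 * E ^ 4 + 2 * D)" by (simp only: power_add mult_ac)
  also have "\<dots> \<le> n ^ (6 * (D * E ^ 4)) * E ^ (20 * (D * E ^ 4))"
    using n1 E1 DE by (intro mult_le_mono power_increasing) linarith+
  finally show ?thesis .
qed

text \<open>By \<open>E = 2 powr log 2 E\<close> and \<open>b \<ge> 2\<close> the power of
  \<open>E\<close> becomes a power of \<open>b\<close>; the logarithm entering the exponent is what
  the soft-O absorbs. The constant is 6 + 20.\<close>

lemma work_bound_powr:
  fixes b :: real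
  assumes b: "b \<ge> 2" "b \<ge> real n"
  shows "real work_bound \<le> b powr (26 * (real D * real E ^ 4) * log 2 E)"
proof -
  let ?x = "real D * real E ^ 4"
  have b1: "b \<ge> 1" and E1: "real E \<ge> 1" using b E_pos by auto
  have x: "?x \<ge> 0" by simp
  have "log 2 2 \<le> log 2 E" using E_real_ge by (subst log_le_cancel_iff) auto
  then have L: "1 \<le> log 2 E" by simp
  have "real n ^ (6 * (D * E ^ 4)) \<le> b ^ (6 * (D * E ^ 4))" using b by (intro power_mono) auto
  also have "\<dots> = b powr (6 * ?x)" using b1 by (subst powr_realpow[symmetric]) auto
  also have "\<dots> \<le> b powr (6 * ?x * log 2 E)"
    using b1 mult_left_mono[OF L, of "6 * ?x"] x by (intro powr_mono) auto
  finally have 1: "real n ^ (6 * (D * E ^ 4)) \<le> b powr (6 * ?x * log 2 E)" .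
  have "real E = 2 powr log 2 E" using E1 by simp
  also have "\<dots> \<le> b powr log 2 E" using b L by (intro powr_mono2) auto
  finally have "real E ^ (20 * (D * E ^ 4)) \<le> (b powr log 2 E) ^ (20 * (D * E ^ 4))"
    by (intro power_mono) auto
  also have "\<dots> = b powr (20 * ?x * log 2 E)"
    using b1 by (subst powr_realpow[symmetric]) (auto simp: powr_powr mult.commute)
  finally have 2: "real E ^ (20 * (D * E ^ 4)) \<le> b powr (20 * ?x * log 2 E)" .
  have "real work_bound \<le> real (n ^ (6 * (D * E ^ 4)) * E ^ (20 * (D * E ^ 4)))"
    by (rule of_nat_mono[OF work_bound_le])
  also have "\<dots> = real n ^ (6 * (D * E ^ 4)) * real E ^ (20 * (D * E ^ 4))" by simp
  also have "\<dots> \<le> b powr (6 * ?x * log 2 E) * b powr (20 * ?x * log 2 E)"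
    using 1 2 by (intro mult_mono) auto
  also have "\<dots> = b powr (26 * ?x * log 2 E)" by (simp add: powr_add[symmetric] algebra_simps)
  finally show ?thesis .
qed

end

section \<open>The exponent as a function of \<open>D\<close> and \<open>\<epsilon>\<close>\<close>

definition scale_param :: "nat \<times> real \<Rightarrow> real" where
  "scale_param = (\<lambda>(D, \<epsilon>). real D ^ 3 / (min 1 \<epsilon>) ^ 4)"

text \<open>The accuracy is at most \<open>60 / min 1 \<epsilon>\<close> rounded up, and the
  rounding is covered by \<open>1 \<le> 1 / min 1 \<epsilon>\<close>.\<close>

lemma accuracy_le:
  assumes "\<epsilon> > 0"
  shows "real (accuracy \<epsilon>) \<le> 61 / min 1 \<epsilon>"
proof -
  let ?m = "min 1 \<epsilon>"
  have m: "?m > 0" "?m \<le> 1" "?m \<le> \<epsilon>" using assms by auto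
  define k where "k = nat \<lceil>60 / ?m\<rceil>"
  have q: "60 \<le> 60 / ?m" using m by (simp add: field_simps)
  then have k: "60 / ?m \<le> real k" "real k < 60 / ?m + 1" unfolding k_def by linarith+
  have "60 \<le> real k * ?m" using k(1) m(1) by (simp add: field_simps)
  also have "\<dots> \<le> real k * \<epsilon>" using m by (intro mult_left_mono) auto
  finally have "60 \<le> real k * \<epsilon>" .
  moreover have "60 \<le> k" using q k(1) by linarith
  ultimately have "accuracy \<epsilon> \<le> k" using accuracy(3)[OF assms] by blast
  then have "real (accuracy \<epsilon>) \<le> 60 / ?m + 1" using k(2) by linarith
  also have "\<dots> \<le> 60 / ?m + 1 / ?m" using m(2) by (simp only: add_left_mono le_divide_eq_1_pos[OF m(1)])
  also have "\<dots> = 61 / ?m" by (simp flip: add_divide_distrib)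
  finally show ?thesis .
qed

text \<open>The exponent is linear in \<open>D\<close>, and \<open>D \<le> D ^ 3\<close> brings it
  into the required form. With \<open>g\<close> for the scale parameter,
  \<open>61 \<le> 2 ^ 6\<close> and \<open>log 2 (1 + g) \<ge> 1\<close> lead to the factor 7 for
  the logarithm of the accuracy.\<close>

lemma exponent_bound:
  assumes \<epsilon>: "\<epsilon> > 0" and D: "D \<ge> 1"
  shows "real D * real (accuracy \<epsilon>) ^ 4 * log 2 (accuracy \<epsilon>)
    \<le> 61 ^ 4 * 7 * (scale_param (D, \<epsilon>) * log 2 (1 + scale_param (D, \<epsilon>)))"
proof -
  let ?m = "min 1 \<epsilon>" and ?g = "scale_param (D, \<epsilon>)" and ?E = "real (accuracy \<epsilon>)"
  have m: "?m > 0" "?m \<le> 1" using \<epsilon> by auto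
  have E: "60 \<le> ?E" "?E \<le> 61 / ?m" using accuracy(1)[OF \<epsilon>] accuracy_le[OF \<epsilon>] by simp_all
  have g: "?g = real D ^ 3 / ?m ^ 4" by (simp add: scale_param_def)
  have "?m ^ 4 \<le> ?m ^ 1" using m by (intro power_decreasing) auto
  then have "1 / ?m \<le> 1 / ?m ^ 4" using m by (intro divide_left_mono) auto
  also have "\<dots> \<le> ?g" unfolding g using D m by (intro divide_right_mono) auto
  finally have mg: "1 / ?m \<le> ?g" .
  have "1 \<le> 1 / ?m" using m by simp
  then have g1: "1 \<le> ?g" using mg by linarith
  have "log 2 2 \<le> log 2 (1 + ?g)" using g1 by (subst log_le_cancel_iff) auto
  then have lg: "1 \<le> log 2 (1 + ?g)" by simp
  have lE: "log 2 ?E \<le> log 2 (2 ^ 6 * (1 + ?g))"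
  proof (subst log_le_cancel_iff)
    have "?E \<le> 61 * ?g" using E(2) mult_left_mono[OF mg, of 61] by simp
    then show "?E \<le> 2 ^ 6 * (1 + ?g)" using g1 by simp
  qed (use E g1 in auto)
  have "log 2 (2 ^ 6 * (1 + ?g)) = log 2 (2 ^ 6) + log 2 (1 + ?g)" using g1 by (subst log_mult) auto
  moreover have "log 2 (2 ^ 6 :: real) = 6" by (subst log_nat_power) auto
  ultimately have l: "log 2 ?E \<le> 7 * log 2 (1 + ?g)" using lE lg by linarith
  have "?E ^ 4 \<le> (61 / ?m) ^ 4" using E by (intro power_mono) auto
  then have "real D * ?E ^ 4 \<le> real D ^ 3 * (61 / ?m) ^ 4"
    using D self_le_power[of "real D" 3] by (intro mult_mono) auto
  also have "\<dots> = 61 ^ 4 * ?g" by (simp add: g power_divide)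
  finally have "real D * ?E ^ 4 \<le> 61 ^ 4 * ?g" .
  then have "real D * ?E ^ 4 * log 2 ?E \<le> (61 ^ 4 * ?g) * (7 * log 2 (1 + ?g))"
  proof (rule mult_mono)
    show "0 \<le> log 2 ?E" using E by simp
  qed (use l g1 in simp_all)
  then show ?thesis by (simp add: mult_ac)
qed

theorem theorem1p7:
  "\<exists>(prog :: com) (\<phi> :: nat \<times> real \<Rightarrow> real) (C :: real).
     \<phi> \<in> exponents \<and>
     (\<forall>(\<epsilon> :: real) (I :: rc_instance). \<epsilon> > 0 \<longrightarrow> valid_instance I \<longrightarrow>
        (\<exists>t. approximates prog I \<epsilon> t \<and>
             real t \<le> C * real (max 2 (ncom I)) powr \<phi> (nres I, \<epsilon>)))"
proof -
  \<comment> \<open>Twice the loop depth, because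
    \<open>Suc work_bound \<le> work_bound\<^sup>2\<close>; the other factors come from
    \<open>work_bound_powr\<close> and \<open>exponent_bound\<close>.\<close>
  define \<kappa> where "\<kappa> = real (2 * depth program) * 26 * (61 ^ 4 * 7)"
  define \<phi> where "\<phi> x = \<kappa> * scale_param x * log 2 (1 + scale_param x) ^ 1" for x
  have \<kappa>: "\<kappa> \<ge> 0" by (simp add: \<kappa>_def)
  have "\<bar>\<phi> x\<bar> \<le> \<kappa> * scale_param x * log 2 (1 + scale_param x) ^ 1"
    if "x \<in> {(D, \<epsilon>). D \<ge> 1 \<and> \<epsilon> > 0}" for x
  proof -
    have "scale_param x \<ge> 0" using that by (auto simp: scale_param_def)
    then have "\<phi> x \<ge> 0" unfolding \<phi>_def using \<kappa> by (intro mult_nonneg_nonneg) auto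
    then show ?thesis by (simp add: \<phi>_def)
  qed
  then have "\<phi> \<in> exponents"
    unfolding exponents_def soft_O_on_def scale_param_def[symmetric] by blast
  moreover have "\<exists>t. approximates program I \<epsilon> t \<and>
      real t \<le> real (weight program) * real (max 2 (ncom I)) powr \<phi> (nres I, \<epsilon>)"
    if \<epsilon>: "\<epsilon> > 0" and I: "valid_instance I" for \<epsilon> I
  proof -
    interpret instance_with_accuracy I "accuracy \<epsilon>"
      using I accuracy(1)[OF \<epsilon>] by unfold_locales auto
    let ?E = "real (accuracy \<epsilon>)" and ?e = "1 / real (accuracy \<epsilon>)"
    obtain t s where run: "exec program (input_state I \<epsilon>) t s" "t \<le> weight program * Suc work_bound ^ depth program"
      and best: "valid_best s" "\<forall>T. feasible I T \<longrightarrow> found s ((1 + 6 * ?e) * (1 + 2 * ?e) * cost I T)"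
      using run_program[OF \<epsilon> refl] unfolding run_def by blast
    obtain T0 where "feasible I T0" using feasible_exists by blast
    \<comment> \<open>Applied to one feasible policy, the guarantee shows that a policy was recorded
      at all.\<close>
    then have ne: "nmem s 100 0 \<noteq> 0" using best(2) by (auto simp: found_def)
    then have out: "feasible I (rmem s 5)" "cost I (rmem s 5) \<le> (1 + 3 * ?e) * (1 + ?e) * rmem s 101 0"
      using best(1) by (simp_all add: valid_best_def)
    have e60: "?e \<le> 1 / 60" "60 * ?e \<le> \<epsilon>"
      using accuracy(1,2)[OF \<epsilon>] E_pos by (simp_all add: field_simps)
    have factor: "(1 + 3 * ?e) * (1 + ?e) * ((1 + 6 * ?e) * (1 + 2 * ?e)) \<le> 1 + \<epsilon>"
    proof -
      \<comment> \<open>Each product of two factors is linearised by adding a non-negative multiple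
        of \<open>x * (1 / 60 - x)\<close> that cancels the quadratic term.\<close>
      have poly: "(1 + 3 * x) * (1 + x) * ((1 + 6 * x) * (1 + 2 * x)) \<le> 1 + 60 * x"
        if x: "0 \<le> x" "x \<le> 1 / 60" for x :: real
      proof -
        have "(1 + 3 * x) * (1 + x) \<le> (1 + 3 * x) * (1 + x) + 3 * (x * (1 / 60 - x))" using x by simp
        also have "\<dots> = 1 + 4 * x + 3 * x / 60" by (simp add: algebra_simps)
        also have "\<dots> \<le> 1 + 5 * x" using x by simp
        finally have 1: "(1 + 3 * x) * (1 + x) \<le> 1 + 5 * x" .
        have "(1 + 6 * x) * (1 + 2 * x) \<le> (1 + 6 * x) * (1 + 2 * x) + 12 * (x * (1 / 60 - x))" using x by simp
        also have "\<dots> = 1 + 8 * x + 12 * x / 60" by (simp add: algebra_simps)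
        also have "\<dots> \<le> 1 + 9 * x" using x by simp
        finally have 2: "(1 + 6 * x) * (1 + 2 * x) \<le> 1 + 9 * x" .
        have "(1 + 3 * x) * (1 + x) * ((1 + 6 * x) * (1 + 2 * x)) \<le> (1 + 5 * x) * (1 + 9 * x)"
          using 1 2 x by (intro mult_mono) auto
        also have "\<dots> \<le> (1 + 5 * x) * (1 + 9 * x) + 45 * (x * (1 / 60 - x))" using x by simp
        also have "\<dots> = 1 + 14 * x + 45 * x / 60" by (simp add: algebra_simps)
        also have "\<dots> \<le> 1 + 60 * x" using x by simp
        finally show ?thesis .
      qed
      have "0 \<le> ?e" by simp
      then show ?thesis using poly[of ?e] e60 by linarith
    qed
    \<comment> \<open>\<open>opt\<close> is an infimum that may fail to be attained, so the output
      is compared with every feasible policy first.\<close>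
    have le: "cost I (rmem s 5) / (1 + \<epsilon>) \<le> cost I T" if T: "feasible I T" for T
    proof -
      have c0: "cost I T \<ge> 0" by (rule cost_nonneg) (use T in \<open>simp add: feasible_def\<close>)
      have "rmem s 101 0 \<le> (1 + 6 * ?e) * (1 + 2 * ?e) * cost I T" using best(2) T by (simp add: found_def)
      then have "cost I (rmem s 5) \<le> (1 + 3 * ?e) * (1 + ?e) * ((1 + 6 * ?e) * (1 + 2 * ?e) * cost I T)"
        using out(2) by (elim order_trans) (intro mult_left_mono mult_nonneg_nonneg; simp)
      also have "\<dots> = ((1 + 3 * ?e) * (1 + ?e) * ((1 + 6 * ?e) * (1 + 2 * ?e))) * cost I T" by (simp only: mult.assoc)
      also have "\<dots> \<le> (1 + \<epsilon>) * cost I T" using factor c0 by (rule mult_right_mono)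
      finally show ?thesis using \<epsilon> by (simp add: field_simps)
    qed
    have "cost I (rmem s 5) / (1 + \<epsilon>) \<le> opt I"
      unfolding opt_def using le \<open>feasible I T0\<close> by (intro cINF_greatest) auto
    then have "cost I (rmem s 5) \<le> (1 + \<epsilon>) * opt I" using \<epsilon> by (simp add: field_simps)
    then have approx: "approximates program I \<epsilon> t"
      using run(1) out(1) by (auto simp: approximates_def output_policy_def)
    let ?b = "real (max 2 (ncom I))" and ?w = "26 * (real (nres I) * ?E ^ 4) * log 2 ?E"
    have "2 \<le> work_bound" using parameter_bounds(11) n_pos by linarith
    then have "Suc work_bound \<le> work_bound ^ 2" by (simp add: power2_eq_square) (metis Suc_le_eq add_Suc_right mult_2 mult_le_mono1 add_le_mono1 less_le_trans nat_less_le one_add_one plus_1_eq_Suc)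
    then have "Suc work_bound ^ depth program \<le> (work_bound ^ 2) ^ depth program" by (intro power_mono) auto
    also have "\<dots> = work_bound ^ (2 * depth program)" by (simp only: power_mult)
    finally have "t \<le> weight program * work_bound ^ (2 * depth program)"
      using run(2) by (meson le_trans mult_le_mono2)
    then have "real t \<le> real (weight program * work_bound ^ (2 * depth program))" by (rule of_nat_mono)
    also have "\<dots> = real (weight program) * real work_bound ^ (2 * depth program)" by simp
    also have "\<dots> \<le> real (weight program) * (?b powr ?w) ^ (2 * depth program)"
      by (intro mult_left_mono power_mono work_bound_powr) auto
    also have "(?b powr ?w) ^ (2 * depth program) = ?b powr (?w * real (2 * depth program))"
      by (subst powr_realpow[symmetric]) (simp_all add: powr_powr)
    also have "\<dots> \<le> ?b powr \<phi> (nres I, \<epsilon>)"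
    proof (rule powr_mono)
      have "?w * real (2 * depth program) = real (2 * depth program) * 26 * (real (nres I) * ?E ^ 4 * log 2 ?E)"
        by (simp only: mult_ac)
      also have "\<dots> \<le> real (2 * depth program) * 26 *
          (61 ^ 4 * 7 * (scale_param (nres I, \<epsilon>) * log 2 (1 + scale_param (nres I, \<epsilon>))))"
        using D_pos by (intro mult_left_mono exponent_bound \<epsilon>) auto
      also have "\<dots> = \<phi> (nres I, \<epsilon>)" by (simp only: \<phi>_def \<kappa>_def mult.assoc power_one_right)
      finally show "?w * real (2 * depth program) \<le> \<phi> (nres I, \<epsilon>)" .
    qed simp
    finally have "real t \<le> real (weight program) * ?b powr \<phi> (nres I, \<epsilon>)"
      by (simp add: mult_left_mono)
    then show ?thesis using approx by blast
  qed
  ultimately show ?thesis by blast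
qed

end
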